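(* Let $X \subseteq \mathbb{R}^n$ be open and let $F \colon X \to \mathbb{R}^n$ be of class $C^{1,1}$. Assume that for every $x_0 \in X$ the solution of the initial value problem $\dot x = F(x)$, $x(0)=x_0$, is extendable to $\mathbb{R}_+$, and let $\varphi \colon \mathbb{R}_+\times X \to X$ denote the flow of $\dot x = F(x)$. Let $s,t>0$ and let $\Omega \subseteq X$ be $s$-convex and closed with $\Omega \neq \mathbb{R}^n$. Further assume that there are $M_1,M_2, \lambda_-, \lambda_+ \in \mathbb{R}$ such that $$M_1 \geq 2 \mu_+( F'(x))-\mu_-(F'(x)),$$ $$M_2\geq \limsup_{h \to 0} \frac{\|F'(x+h)-F'(x)\|}{\|h\|},$$ $$\lambda_- \leq \mu_-(F'(x)) \leq \mu_+(F'(x)) \leq \lambda_+$$ for all $x \in \varphi([0,t],\Omega)\subseteq X$. If $s M_2 \int_{0}^t \exp(M_1 \rho)\, d \rho <1$, then the attainable set $\varphi(\tau, \Omega)$ is $r$-convex for all $\tau \in [0,t]$ with $$r=\frac{s\exp((2 \lambda_+-\lambda_-)t)}{1-s M_2 \int_{0}^t \exp(M_1 \rho)\, d \rho}.$$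
   Context: $\mathbb{R}^n$ carries the Euclidean inner product and norm $\|\cdot\|$ (with induced operator norm on linear maps); $\mathbb{R}_+ = [0,\infty)$. A map is of class $C^{1,1}$ if it is of class $C^1$ and its derivative is Lipschitz continuous. The flow $\varphi$ satisfies $\varphi(0,x_0)=x_0$ and $\frac{d}{d\rho}\varphi(\rho,x_0)=F(\varphi(\rho,x_0))$ for all $\rho\ge 0$, $x_0\in X$; $\varphi(\tau,\Omega)$ and $\varphi([0,t],\Omega)$ denote image sets. For $A \in \mathbb{R}^{n\times n}$, $\mu_+(A)$ and $\mu_-(A)$ denote the maximum and minimum, respectively, eigenvalues of the symmetric part $(A+A^* )/2$ of $A$. For $r>0$, a set $\Omega \subseteq \mathbb{R}^n$ is $r$-convex if for all $x,y \in \Omega$ the intersection of all closed balls of radius $r$ (centered at any $c \in \mathbb{R}^n$) that contain both $x$ and $y$ is a subset of $\Omega$; this intersection is considered equal to $\mathbb{R}^n$ if no such ball exists.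
   Formalization: The r-convexity of φ(τ,Ω) is asserted for all τ in [0,t] only if 2λ₊−λ₋ ≥ 0, and otherwise only for τ = t; without this the claim fails, e.g. for F(x) = −x, Ω a closed ball of radius s, λ₋ = λ₊ = M₁ = −1, M₂ = 0, τ < t. *)

theory Defs
  imports "HOL-Analysis.Analysis"
begin

text \<open>Derivatives are kept as bounded linear maps because the norm on \<open>\<Rightarrow>\<^sub>L\<close> is the operator norm
  induced by the Euclidean norm (the norm on matrices \<open>real^'n^'n\<close> is not). On the open set \<open>X\<close> the
  derivative \<open>F'\<close> is uniquely determined by \<open>F\<close>.\<close>

definition C11_on ::
    "(real^'n) set \<Rightarrow> (real^'n \<Rightarrow> real^'n) \<Rightarrow> (real^'n \<Rightarrow> (real^'n) \<Rightarrow>\<^sub>L (real^'n)) \<Rightarrow> bool" where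
  "C11_on X F F' \<longleftrightarrow>
     (\<forall>x\<in>X. (F has_derivative blinfun_apply (F' x)) (at x)) \<and>
     continuous_on X F' \<and>
     (\<exists>L. L-lipschitz_on X F')"

definition symmetric_part :: "real^'n^'n \<Rightarrow> real^'n^'n" where
  "symmetric_part A = (1 / 2) *\<^sub>R (A + transpose A)"

definition eigenvalues :: "real^'n^'n \<Rightarrow> real set" where
  "eigenvalues A = {l. \<exists>v. v \<noteq> 0 \<and> A *v v = l *\<^sub>R v}"

definition mu_plus :: "real^'n^'n \<Rightarrow> real" where
  "mu_plus A = Max (eigenvalues (symmetric_part A))"

definition mu_minus :: "real^'n^'n \<Rightarrow> real" where
  "mu_minus A = Min (eigenvalues (symmetric_part A))"

text \<open>At time \<open>0\<close> the derivative is one-sided.\<close>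

definition global_solution ::
    "(real^'n) set \<Rightarrow> (real^'n \<Rightarrow> real^'n) \<Rightarrow> (real \<Rightarrow> real^'n) \<Rightarrow> real^'n \<Rightarrow> bool" where
  "global_solution X F u x0 \<longleftrightarrow>
     u 0 = x0 \<and>
     (\<forall>\<rho>\<ge>0. u \<rho> \<in> X \<and> (u has_vector_derivative F (u \<rho>)) (at \<rho> within {0..}))"

definition is_flow ::
    "(real^'n) set \<Rightarrow> (real^'n \<Rightarrow> real^'n) \<Rightarrow> (real \<Rightarrow> real^'n \<Rightarrow> real^'n) \<Rightarrow> bool" where
  "is_flow X F \<phi> \<longleftrightarrow> (\<forall>x0\<in>X. global_solution X F (\<lambda>\<rho>. \<phi> \<rho> x0) x0)"

text \<open>If no closed ball of radius \<open>r\<close> contains both points, the intersection below is that of the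
  empty family, i.e. \<open>UNIV\<close>.\<close>

definition r_convex :: "real \<Rightarrow> (real^'n) set \<Rightarrow> bool" where
  "r_convex r S \<longleftrightarrow>
     0 < r \<and> (\<forall>x\<in>S. \<forall>y\<in>S. \<Inter>{cball c r | c. x \<in> cball c r \<and> y \<in> cball c r} \<subseteq> S)"

end

theory Submission
  imports Defs
begin

text \<open>An \<open>r\<close>-convex set is curved at least as much as a sphere of radius \<open>r\<close>. This is a local condition of
second order, so one has to see how much the flow can bend short chords.

\<^emph>\<open>Local form of strong convexity.\<close> An \<open>s\<close>-convex set contains, for any two of its points at distance
\<open>\<ell>\<close>, the ball of radius \<open>\<ell>\<^sup>2 / (8 * s)\<close> around their midpoint (\<open>r_convex_midpoint_cball\<close>).
Conversely, a closed connected set that contains such balls for its short chords, with any radius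
\<open>R > r\<close> in place of \<open>s\<close>, contains the lens of radius \<open>r\<close> of any two points at distance at most \<open>2 * r\<close>
(\<open>lens_subset_if_midpoint_balls\<close>): the set is convex because the pairs of points whose segment lies in
it form an open and closed set of pairs (\<open>convex_if_midpoint_balls\<close>), and an arc of radius \<open>R\<close> that is
pushed outwards from a chord cannot get stuck before it reaches its final position
(\<open>lens_above_chord_subset\<close>).

\<^emph>\<open>Distortion of a chord.\<close> Let \<open>p\<close>, \<open>q\<close> be close points of \<open>\<Omega>\<close>, let \<open>x\<close>, \<open>y\<close>, \<open>m\<close> be the trajectories of
\<open>p\<close>, \<open>q\<close> and their midpoint, and let \<open>D = dist x y\<close>. Consider a trajectory \<open>k\<close> that reaches, at time
\<open>\<tau>\<close>, a point near the midpoint of \<open>x\<close> and \<open>y\<close>. The difference \<open>e\<close> of \<open>k\<close> and the midpoint of \<open>x\<close> and \<open>y\<close>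
satisfies \<open>e' = F' m e + g\<close> with \<open>norm g \<le> M2 / 8 * D\<^sup>2\<close> up to higher order. Since \<open>norm e\<close> grows at
least at rate \<open>mu_minus\<close>, apart from \<open>g\<close>, and \<open>D\<close> at most at rate \<open>mu_plus\<close>, the quotient \<open>N = norm e / D\<^sup>2\<close>
satisfies \<open>N' \<ge> - a * N - M2 / 8\<close> for any upper bound \<open>a\<close> of \<open>2 * mu_plus - mu_minus\<close>, such as
\<open>a = min M1 (2 * lp - lm)\<close>. Integration gives
\<open>N 0 \<le> exp (a * \<tau>) * N \<tau> + M2 / 8 * integral {0..\<tau>} (\<lambda>\<rho>. exp (a * \<rho>))\<close> up to higher order
(\<open>distortion_estimate\<close>). If \<open>N \<tau> \<le> 1 / (8 * R)\<close> with \<open>R > r\<close>, the right-hand side is smaller than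
\<open>1 / (8 * s)\<close> by the choice of \<open>r\<close>, so \<open>k\<close> starts in the midpoint ball of \<open>p\<close> and \<open>q\<close>, which is part of \<open>\<Omega>\<close>.
That every point of the midpoint ball of \<open>x \<tau>\<close> and \<open>y \<tau>\<close> is reached by such a trajectory follows from invariance
of domain (\<open>flow_image_contains_midpoint_balls\<close>).

The bound \<open>M2\<close> is available only on the tube of trajectories that start in \<open>\<Omega>\<close>, and only pointwise.
The remainder \<open>g\<close> is therefore estimated along the images of the segments from the midpoint to \<open>p\<close> and \<open>q\<close>,
which stay in the tube (\<open>midpoint_remainder\<close>). Up to higher order, the Lipschitz constant of such an
image is half of \<open>D\<close>, because the flow maps parallel chords on one segment to almost parallel chords
(\<open>flow_secant\<close>).

The remaining condition on distances follows from \<open>flow_expand_global\<close>: the diameter of the attainable set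
is at most \<open>exp (lp * \<tau>) * (2 * s) \<le> 2 * r\<close>.\<close>

section \<open>Strong convexity from midpoint balls\<close>

text \<open>The infinitesimal form of \<open>r\<close>-convexity. In a disc of radius \<open>r\<close> the cap over a chord of length
\<open>\<ell>\<close> has height \<open>r - sqrt (r\<^sup>2 - \<ell>\<^sup>2 / 4)\<close>, which exceeds \<open>\<ell>\<^sup>2 / (8 * r)\<close> and agrees with it up to
terms of order \<open>\<ell>\<^sup>4\<close>. Only chords shorter than \<open>d\<close> are tested.\<close>

definition midpoint_balls :: "real \<Rightarrow> real \<Rightarrow> 'a::euclidean_space set \<Rightarrow> bool" where
  "midpoint_balls d r K \<longleftrightarrow>
     (\<forall>x\<in>K. \<forall>y\<in>K. dist x y < d \<longrightarrow> cball (midpoint x y) ((dist x y)\<^sup>2 / (8 * r)) \<subseteq> K)"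

lemma midpoint_ballsD:
  assumes "midpoint_balls d r K" "x \<in> K" "y \<in> K" "dist x y < d"
  shows "cball (midpoint x y) ((dist x y)\<^sup>2 / (8 * r)) \<subseteq> K"
  using assms unfolding midpoint_balls_def by blast

lemma midpoint_ballsD_midpoint:
  assumes "midpoint_balls d r K" "0 < r" "x \<in> K" "y \<in> K" "dist x y < d"
  shows "midpoint x y \<in> K"
proof -
  have "midpoint x y \<in> cball (midpoint x y) ((dist x y)\<^sup>2 / (8 * r))"
    using assms(2) by simp
  then show ?thesis
    using midpoint_ballsD[OF assms(1,3-5)] by blast
qed

lemma midpoint_ballsD_interior:
  assumes "midpoint_balls d r K" "0 < r" "x \<in> K" "y \<in> K" "dist x y < d"
    and z: "dist (midpoint x y) z < (dist x y)\<^sup>2 / (8 * r)"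
  shows "z \<in> interior K"
proof -
  have "ball (midpoint x y) ((dist x y)\<^sup>2 / (8 * r)) \<subseteq> K"
    using midpoint_ballsD[OF assms(1,3-5)] ball_subset_cball by blast
  moreover have "z \<in> ball (midpoint x y) ((dist x y)\<^sup>2 / (8 * r))"
    using z by simp
  ultimately show ?thesis
    by (meson interiorI open_ball)
qed

text \<open>A point of the segment outside \<open>K\<close> lies in a maximal gap whose two ends belong to \<open>K\<close>, and the
midpoint of the gap would have to belong to \<open>K\<close> as well.\<close>

lemma closed_segment_subset_if_midpoint_balls:
  fixes K :: "'a::euclidean_space set"
  assumes "closed K" and mb: "midpoint_balls d r K" and "0 < r"
    and xy: "x \<in> K" "y \<in> K" "dist x y < d"
  shows "closed_segment x y \<subseteq> K"
proof
  fix z assume "z \<in> closed_segment x y"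
  define g where "g \<theta> = x + \<theta> *\<^sub>R (y - x)" for \<theta> :: real
  obtain u where u: "u \<in> {0..1}" "z = g u"
    using \<open>z \<in> closed_segment x y\<close>
    by (auto simp: closed_segment_def g_def algebra_simps)
  have cg: "continuous_on UNIV g"
    unfolding g_def by (intro continuous_intros)
  show "z \<in> K"
  proof (rule ccontr)
    assume "z \<notin> K"
    define S1 where "S1 = {0..u} \<inter> g -` K"
    define S2 where "S2 = {u..1} \<inter> g -` K"
    have clK: "closed (g -` K)"
      using continuous_closed_vimage[OF \<open>closed K\<close>, of g] cg
      by (simp add: continuous_on_eq_continuous_at)
    have c1: "compact S1" and c2: "compact S2"
      unfolding S1_def S2_def by (auto intro!: compact_Int_closed clK)
    have n1: "S1 \<noteq> {}" and n2: "S2 \<noteq> {}"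
      using u xy by (auto simp: S1_def S2_def g_def intro!: exI[of _ "0::real"] exI[of _ "1::real"])
    obtain a where a: "a \<in> S1" "\<And>t. t \<in> S1 \<Longrightarrow> t \<le> a"
      using compact_attains_sup[OF c1 n1] by blast
    obtain b where b: "b \<in> S2" "\<And>t. t \<in> S2 \<Longrightarrow> b \<le> t"
      using compact_attains_inf[OF c2 n2] by blast
    have ab: "0 \<le> a" "a \<le> u" "u \<le> b" "b \<le> 1" "g a \<in> K" "g b \<in> K"
      using a(1) b(1) by (auto simp: S1_def S2_def)
    have "g b - g a = (b - a) *\<^sub>R (y - x)"
      by (simp add: g_def algebra_simps)
    then have "dist (g a) (g b) = (b - a) * dist x y"
      using ab by (simp add: dist_norm norm_minus_commute[of "g a"] norm_minus_commute[of x])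
    also have "\<dots> \<le> 1 * dist x y"
      using ab by (intro mult_right_mono) auto
    finally have "dist (g a) (g b) < d" using xy by simp
    then have "midpoint (g a) (g b) \<in> K"
      using midpoint_ballsD_midpoint[OF mb \<open>0 < r\<close>] ab by blast
    moreover have "midpoint (g a) (g b) = g ((a + b) / 2)"
    proof -
      have "g a + g b = 2 *\<^sub>R x + (a + b) *\<^sub>R (y - x)"
        by (simp add: g_def algebra_simps scaleR_2)
      then show ?thesis
        by (simp add: midpoint_def g_def scaleR_add_right)
    qed
    ultimately have mid: "g ((a + b) / 2) \<in> K" by simp
    have "a \<noteq> u" "b \<noteq> u" using ab u \<open>z \<notin> K\<close> by auto
    then have "a < u" "u < b" using ab by auto
    show False
    proof (cases "(a + b) / 2 \<le> u")
      case True
      then have "(a + b) / 2 \<in> S1" using mid ab by (auto simp: S1_def)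
      from a(2)[OF this] \<open>a < u\<close> \<open>u < b\<close> show False by simp
    next
      case False
      then have "(a + b) / 2 \<in> S2" using mid ab by (auto simp: S2_def)
      from b(2)[OF this] \<open>a < u\<close> \<open>u < b\<close> show False by simp
    qed
  qed
qed

text \<open>An inner point of the segment is the midpoint of a short nondegenerate chord on the segment, whose
midpoint ball has positive radius.\<close>

lemma open_segment_subset_interior_if_midpoint_balls:
  fixes K :: "'a::euclidean_space set"
  assumes mb: "midpoint_balls d r K" and "0 < d" "0 < r"
    and seg: "closed_segment x y \<subseteq> K"
    and z: "z \<in> open_segment x y"
  shows "z \<in> interior K"
proof -
  obtain u where u: "0 < u" "u < 1" "z = (1 - u) *\<^sub>R x + u *\<^sub>R y" and "x \<noteq> y"
    using z by (auto simp: in_segment)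
  \<comment> \<open>The chord around \<open>z\<close> of half length \<open>\<eta> * dist x y\<close> stays on the segment and is shorter than \<open>d\<close>.\<close>
  define \<eta> where "\<eta> = min (min u (1 - u)) (d / (4 * dist x y))"
  have \<eta>: "0 < \<eta>" "\<eta> \<le> u" "\<eta> \<le> 1 - u" "\<eta> \<le> d / (4 * dist x y)"
    using u \<open>0 < d\<close> \<open>x \<noteq> y\<close> by (auto simp: \<eta>_def)
  have \<eta>d: "\<eta> * dist x y \<le> d / 4"
    using \<eta>(4) \<open>x \<noteq> y\<close> by (simp add: field_simps)
  define p where "p = (1 - (u - \<eta>)) *\<^sub>R x + (u - \<eta>) *\<^sub>R y"
  define q where "q = (1 - (u + \<eta>)) *\<^sub>R x + (u + \<eta>) *\<^sub>R y"
  have "p \<in> closed_segment x y" "q \<in> closed_segment x y"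
    unfolding in_segment
    subgoal using \<eta> u by (intro exI[of _ "u - \<eta>"]) (auto simp: p_def)
    subgoal using \<eta> u by (intro exI[of _ "u + \<eta>"]) (auto simp: q_def)
    done
  then have pq: "p \<in> K" "q \<in> K" using seg by auto
  have pz: "p = z - \<eta> *\<^sub>R (y - x)" and qz: "q = z + \<eta> *\<^sub>R (y - x)"
    by (simp_all add: p_def q_def u algebra_simps)
  have "q - p = (2 * \<eta>) *\<^sub>R (y - x)"
    unfolding pz qz mult_2 scaleR_add_left by simp
  then have dpq: "dist p q = 2 * \<eta> * dist x y"
    using \<eta> by (simp add: dist_norm norm_minus_commute[of p] norm_minus_commute[of x])
  have "p + q = 2 *\<^sub>R z"
    unfolding pz qz scaleR_2 by simp
  then have "midpoint p q = z"
    by (simp add: midpoint_def)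
  moreover have "0 < (dist p q)\<^sup>2 / (8 * r)"
    using dpq \<eta> \<open>x \<noteq> y\<close> \<open>0 < r\<close> by simp
  moreover have "dist p q < d" using dpq \<eta>d \<open>0 < d\<close> by simp
  ultimately show ?thesis
    using midpoint_ballsD_interior[OF mb \<open>0 < r\<close> pq] by simp
qed

text \<open>The pairs \<open>(x, y)\<close> with \<open>closed_segment x y \<subseteq> K\<close> form a nonempty, relatively closed subset of the
connected set \<open>K \<times> K\<close>. It is also relatively open: the middle part of the segment is a compact
subset of the interior of \<open>K\<close> and so survives small perturbations, and the two remaining end pieces
are short chords.\<close>

lemma convex_if_midpoint_balls:
  fixes K :: "'a::euclidean_space set"
  assumes "closed K" "connected K" and mb: "midpoint_balls d r K" and "0 < d" "0 < r"
  shows "convex K"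
proof -
  define T where "T = {p \<in> K \<times> K. closed_segment (fst p) (snd p) \<subseteq> K}"
  have T_open: "openin (top_of_set (K \<times> K)) T"
    unfolding openin_contains_ball
  proof (intro conjI ballI)
    show "T \<subseteq> K \<times> K" by (auto simp: T_def)
    fix p assume "p \<in> T"
    then obtain x y where p: "p = (x, y)" "x \<in> K" "y \<in> K" "closed_segment x y \<subseteq> K"
      by (auto simp: T_def)
    \<comment> \<open>Relative length of the end pieces; the summand 1 leaves room for moving the end points by at most 1/2 each.\<close>
    define \<epsilon> where "\<epsilon> = min (1 / 3) (d / (2 * (dist x y + 1)))"
    have pos1: "0 < dist x y + 1" using zero_le_dist[of x y] by linarith
    have \<epsilon>: "0 < \<epsilon>" "\<epsilon> \<le> 1 / 3" "\<epsilon> \<le> d / (2 * (dist x y + 1))"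
      using \<open>0 < d\<close> pos1 unfolding \<epsilon>_def by (simp_all only: min.cobounded1 min.cobounded2, simp)
    have \<epsilon>d: "\<epsilon> * (dist x y + 1) \<le> d / 2"
      using \<epsilon>(3) pos1 by (simp add: field_simps)
    define M where "M = (\<lambda>\<theta>. (1 - \<theta>) *\<^sub>R x + \<theta> *\<^sub>R y) ` {\<epsilon>..1 - \<epsilon>}"
    have "\<exists>\<eta>>0. \<eta> \<le> 1 / 2 \<and> (\<forall>x'\<in>K. \<forall>y'\<in>K. dist x x' < \<eta> \<longrightarrow> dist y y' < \<eta> \<longrightarrow>
                closed_segment x' y' \<subseteq> K)"
    proof (cases "x = y")
      case True
      have "closed_segment x' y' \<subseteq> K"
        if "x' \<in> K" "y' \<in> K" "dist x x' < min (1/2) (d / 2)" "dist y y' < min (1/2) (d / 2)" for x' y'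
      proof (rule closed_segment_subset_if_midpoint_balls[OF \<open>closed K\<close> mb \<open>0 < r\<close> that(1,2)])
        show "dist x' y' < d"
          using that(3,4) True dist_triangle3[of x' y' x] by auto
      qed
      then show ?thesis
        using \<open>0 < d\<close> by (intro exI[of _ "min (1/2) (d / 2)"]) auto
    next
      case False
      have "compact M"
        unfolding M_def by (intro compact_continuous_image continuous_intros) auto
      have "M \<subseteq> interior K"
      proof
        fix z assume "z \<in> M"
        then obtain \<theta> where "\<epsilon> \<le> \<theta>" "\<theta> \<le> 1 - \<epsilon>" "z = (1 - \<theta>) *\<^sub>R x + \<theta> *\<^sub>R y"
          by (auto simp: M_def)
        then have "z \<in> open_segment x y"
          unfolding in_segment using \<epsilon>(1) False by (intro conjI exI[of _ \<theta>]) auto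
        then show "z \<in> interior K"
          using open_segment_subset_interior_if_midpoint_balls[OF mb \<open>0 < d\<close> \<open>0 < r\<close> p(4)] by blast
      qed
      then obtain \<eta>0 where \<eta>0: "0 < \<eta>0" "(\<Union>x\<in>M. ball x \<eta>0) \<subseteq> interior K"
        using compact_subset_open_imp_ball_epsilon_subset[OF \<open>compact M\<close> open_interior] by metis
      define \<eta> where "\<eta> = min \<eta>0 (1/2)"
      have \<eta>: "0 < \<eta>" "\<eta> \<le> 1/2" using \<eta>0 by (auto simp: \<eta>_def)
      have "closed_segment x' y' \<subseteq> K"
        if x'y': "x' \<in> K" "y' \<in> K" "dist x x' < \<eta>" "dist y y' < \<eta>" for x' y'
      proof -
        define g where "g \<theta> = (1 - \<theta>) *\<^sub>R x' + \<theta> *\<^sub>R y'" for \<theta> :: real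
        have mid: "g \<theta> \<in> K" if "\<theta> \<in> {\<epsilon>..1 - \<epsilon>}" for \<theta>
        proof -
          have th: "0 \<le> \<theta>" "\<theta> \<le> 1" using that \<epsilon> by auto
          have "(1 - \<theta>) *\<^sub>R x + \<theta> *\<^sub>R y - g \<theta> = (1 - \<theta>) *\<^sub>R (x - x') + \<theta> *\<^sub>R (y - y')"
            by (simp add: g_def algebra_simps)
          then have "dist ((1 - \<theta>) *\<^sub>R x + \<theta> *\<^sub>R y) (g \<theta>) \<le> (1 - \<theta>) * dist x x' + \<theta> * dist y y'"
            unfolding dist_norm using th
            by (metis abs_of_nonneg diff_ge_0_iff_ge norm_scaleR norm_triangle_ineq)
          also have "\<dots> < \<eta>"
            using convex_bound_lt[OF x'y'(3,4), of "1 - \<theta>" \<theta>] th by simp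
          finally have "g \<theta> \<in> ball ((1 - \<theta>) *\<^sub>R x + \<theta> *\<^sub>R y) \<eta>0"
            by (simp add: \<eta>_def)
          moreover have "(1 - \<theta>) *\<^sub>R x + \<theta> *\<^sub>R y \<in> M" using that by (auto simp: M_def)
          ultimately show ?thesis using \<eta>0(2) interior_subset by blast
        qed
        have dxy: "dist x' y' < dist x y + 1"
          using x'y'(3,4) \<eta>(2) dist_triangle[of x' y' x] dist_triangle[of x y' y]
          by (simp add: dist_commute)
        have short: "\<epsilon> * dist x' y' < d"
        proof -
          have "\<epsilon> * dist x' y' \<le> \<epsilon> * (dist x y + 1)"
            using dxy \<epsilon> by (intro mult_left_mono) auto
          then show ?thesis using \<epsilon>d \<open>0 < d\<close> by linarith
        qed
        have e1: "closed_segment x' (g \<epsilon>) \<subseteq> K"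
        proof (rule closed_segment_subset_if_midpoint_balls[OF \<open>closed K\<close> mb \<open>0 < r\<close> x'y'(1)])
          show "g \<epsilon> \<in> K" using mid \<epsilon> by auto
          have "x' - g \<epsilon> = \<epsilon> *\<^sub>R (x' - y')" by (simp add: g_def algebra_simps)
          then show "dist x' (g \<epsilon>) < d" using short \<epsilon> by (simp add: dist_norm)
        qed
        have e2: "closed_segment (g (1 - \<epsilon>)) y' \<subseteq> K"
        proof (rule closed_segment_subset_if_midpoint_balls[OF \<open>closed K\<close> mb \<open>0 < r\<close> _ x'y'(2)])
          show "g (1 - \<epsilon>) \<in> K" using mid \<epsilon> by auto
          have "g (1 - \<epsilon>) - y' = \<epsilon> *\<^sub>R (x' - y')" by (simp add: g_def algebra_simps)
          then show "dist (g (1 - \<epsilon>)) y' < d" using short \<epsilon> by (simp add: dist_norm)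
        qed
        show ?thesis
        proof
          fix z assume "z \<in> closed_segment x' y'"
          then obtain \<theta> where \<theta>: "0 \<le> \<theta>" "\<theta> \<le> 1" "z = g \<theta>"
            by (auto simp: in_segment g_def)
          consider "\<theta> \<le> \<epsilon>" | "\<theta> \<in> {\<epsilon>..1-\<epsilon>}" | "1 - \<epsilon> \<le> \<theta>" by fastforce
          then show "z \<in> K"
          proof cases
            case 1
            have "z = (1 - \<theta> / \<epsilon>) *\<^sub>R x' + (\<theta> / \<epsilon>) *\<^sub>R g \<epsilon>"
              using \<epsilon>(1) by (simp add: \<theta> g_def algebra_simps)
            moreover have "0 \<le> \<theta> / \<epsilon>" "\<theta> / \<epsilon> \<le> 1" using 1 \<epsilon> \<theta> by auto
            ultimately have "z \<in> closed_segment x' (g \<epsilon>)" unfolding in_segment by blast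
            then show ?thesis using e1 by blast
          next
            case 2
            then show ?thesis using mid \<theta> by simp
          next
            case 3
            have "z = (1 - (1 - (1 - \<theta>) / \<epsilon>)) *\<^sub>R g (1 - \<epsilon>) + (1 - (1 - \<theta>) / \<epsilon>) *\<^sub>R y'"
              using \<epsilon>(1) by (simp add: \<theta> g_def algebra_simps) (simp add: divide_simps flip: scaleR_add_left)
            moreover have "0 \<le> 1 - (1 - \<theta>) / \<epsilon>" "1 - (1 - \<theta>) / \<epsilon> \<le> 1" using 3 \<epsilon> \<theta> by auto
            ultimately have "z \<in> closed_segment (g (1 - \<epsilon>)) y'" unfolding in_segment by blast
            then show ?thesis using e2 by blast
          qed
        qed
      qed
      then show ?thesis using \<eta> by blast
    qed
    then obtain \<eta> where \<eta>: "0 < \<eta>"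
      "\<And>x' y'. x' \<in> K \<Longrightarrow> y' \<in> K \<Longrightarrow> dist x x' < \<eta> \<Longrightarrow> dist y y' < \<eta> \<Longrightarrow> closed_segment x' y' \<subseteq> K"
      by blast
    have "ball p \<eta> \<inter> K \<times> K \<subseteq> T"
    proof (clarify)
      fix x' y' assume "(x', y') \<in> ball p \<eta>" "x' \<in> K" "y' \<in> K"
      then have "dist x x' < \<eta>" "dist y y' < \<eta>"
        using dist_fst_le[of p "(x', y')"] dist_snd_le[of p "(x', y')"] p by auto
      then show "(x', y') \<in> T"
        using \<eta>(2) \<open>x' \<in> K\<close> \<open>y' \<in> K\<close> by (simp add: T_def)
    qed
    then show "\<exists>e>0. ball p e \<inter> K \<times> K \<subseteq> T" using \<eta>(1) by blast
  qed
  have "T = (K \<times> K) \<inter> (\<Inter>\<theta>\<in>{0..1}. (\<lambda>p. (1 - \<theta>) *\<^sub>R fst p + \<theta> *\<^sub>R snd p) -` K)"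
    unfolding T_def closed_segment_image_interval image_subset_iff by auto
  moreover have "closed (\<Inter>\<theta>\<in>{0..1::real}. (\<lambda>p. (1 - \<theta>) *\<^sub>R fst p + \<theta> *\<^sub>R snd p) -` K)"
    by (intro closed_INT ballI continuous_closed_vimage[OF \<open>closed K\<close>] continuous_intros)
  ultimately have T_closed: "closedin (top_of_set (K \<times> K)) T"
    unfolding closedin_closed by blast
  have "T = {} \<or> T = K \<times> K"
    using connected_Times[OF \<open>connected K\<close> \<open>connected K\<close>] T_open T_closed
    unfolding connected_clopen by blast
  moreover have "(x, x) \<in> T" if "x \<in> K" for x using that by (simp add: T_def)
  ultimately have T: "T = K \<times> K" by blast
  have "closed_segment x y \<subseteq> K" if "x \<in> K" "y \<in> K" for x y
  proof -
    have "(x, y) \<in> T" using T that by simp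
    then show ?thesis by (simp add: T_def)
  qed
  then show ?thesis
    unfolding convex_contains_segment by blast
qed

text \<open>In the plane spanned by \<open>u\<close> and \<open>e\<close>, with the chord on the axis \<open>u\<close>, the region between the chord
and the circular arc of radius \<open>R\<close> through its ends is the graph region \<open>0 \<le> b \<le> H a\<close>. Slide the
arc down until the region under it lies in \<open>K\<close>, and raise it again as far as this remains true.
Where it gets stuck, the arc touches a point that is not interior to \<open>K\<close>. But this point is the top
of a small cap over a chord with both ends on the arc, hence in \<open>K\<close>, and the midpoint ball of that
chord, which belongs to the smaller radius \<open>r\<close>, contains the point in its interior. In the proof
the stuck position is a maximum point of \<open>H a - b\<close> on the closure of the points of the region
outside \<open>K\<close>.\<close>

lemma lens_above_chord_subset:
  fixes K :: "'a::euclidean_space set" and m u e :: 'a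
  assumes "closed K" "convex K" and mb: "midpoint_balls d r K" and "0 < d" "0 < r" "r < R"
    and uu: "u \<bullet> u = 1" and ee: "e \<bullet> e = 1" and ue: "u \<bullet> e = 0"
    and l: "0 < l" "l \<le> R" and ends: "m - l *\<^sub>R u \<in> K" "m + l *\<^sub>R u \<in> K"
    and ab: "\<bar>a\<bar> \<le> l" "0 \<le> b" "b \<le> sqrt (R\<^sup>2 - a\<^sup>2) - sqrt (R\<^sup>2 - l\<^sup>2)"
  shows "m + a *\<^sub>R u + b *\<^sub>R e \<in> K"
proof (rule ccontr)
  assume notin: "m + a *\<^sub>R u + b *\<^sub>R e \<notin> K"
  define h where "h = sqrt (R\<^sup>2 - l\<^sup>2)"
  have lR: "l\<^sup>2 \<le> R\<^sup>2" using l by (simp add: power_mono)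
  have h: "0 \<le> h" "h\<^sup>2 = R\<^sup>2 - l\<^sup>2" using lR by (auto simp: h_def)
  define H where "H a = sqrt (R\<^sup>2 - a\<^sup>2) - h" for a :: real
  have Hl: "H a = 0" if "\<bar>a\<bar> = l" for a
  proof -
    have "a\<^sup>2 = l\<^sup>2" using that by (metis power2_abs)
    then show ?thesis by (simp add: H_def h_def)
  qed
  define pt where "pt p = m + fst p *\<^sub>R u + snd p *\<^sub>R e" for p :: "real \<times> real"
  define G where "G = {p :: real \<times> real. \<bar>fst p\<bar> \<le> l \<and> 0 \<le> snd p \<and> snd p \<le> H (fst p)}"
  define Bad where "Bad = {p \<in> G. pt p \<notin> K}"
  define f where "f p = H (fst p) - snd p" for p
  have cont_H: "continuous_on UNIV (\<lambda>p::real\<times>real. H (fst p))"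
    unfolding H_def by (intro continuous_intros)
  have cont_f: "continuous_on UNIV f"
    unfolding f_def by (intro continuous_intros cont_H)
  have cont_pt: "continuous_on UNIV pt"
    unfolding pt_def by (intro continuous_intros)
  have "closed G"
    unfolding G_def by (intro closed_Collect_conj closed_Collect_le cont_H continuous_intros)
  have HR: "H a \<le> R" for a
  proof -
    have "sqrt (R\<^sup>2 - a\<^sup>2) \<le> sqrt (R\<^sup>2)" by (rule real_sqrt_le_mono) simp
    then show ?thesis using h l by (simp add: H_def)
  qed
  have "G \<subseteq> {-l..l} \<times> {0..R}"
  proof
    fix p assume "p \<in> G"
    then have "\<bar>fst p\<bar> \<le> l" "0 \<le> snd p" "snd p \<le> R"
      using order_trans[OF _ HR] by (auto simp: G_def)
    then show "p \<in> {-l..l} \<times> {0..R}" by (auto simp: mem_Times_iff abs_le_iff)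
  qed
  then have "bounded G"
    by (rule bounded_subset[rotated]) (intro bounded_Times bounded_closed_interval)
  then have "compact G" using \<open>closed G\<close> compact_eq_bounded_closed by blast
  have "(a, b) \<in> Bad"
    using ab notin by (auto simp: Bad_def G_def H_def h_def pt_def)
  have clG: "closure Bad \<subseteq> G"
    using \<open>closed G\<close> closure_minimal[of Bad G] by (auto simp: Bad_def)
  then have "compact (closure Bad)"
    using \<open>bounded G\<close> bounded_subset compact_eq_bounded_closed closed_closure by blast
  moreover have "closure Bad \<noteq> {}" using \<open>(a, b) \<in> Bad\<close> closure_subset by blast
  ultimately obtain ps where ps: "ps \<in> closure Bad" "\<And>p. p \<in> closure Bad \<Longrightarrow> f p \<le> f ps"
    using continuous_attains_sup[of "closure Bad" f] continuous_on_subset[OF cont_f] by blast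
  define a0 b0 M where "a0 = fst ps" and "b0 = snd ps" and "M = f ps"
  have G0: "\<bar>a0\<bar> \<le> l" "0 \<le> b0" "b0 \<le> H a0" "M = H a0 - b0"
    using ps(1) clG by (auto simp: G_def a0_def b0_def M_def f_def)
  then have "0 \<le> M" by simp
  have above: "pt p \<in> K" if "p \<in> G" "M < f p" for p
    using that ps(2)[of p] closure_subset[of Bad] unfolding M_def by (force simp: Bad_def)
  \<comment> \<open>Points with \<open>f p > M\<close> are in \<open>K\<close> because \<open>M\<close> is the maximum over the closure of the bad points; points off the chord with \<open>f p = M\<close> are limits of such points.\<close>
  have level: "pt p \<in> K" if p: "p \<in> G" "M \<le> f p" "0 < snd p" for p
  proof -
    have "eventually (\<lambda>\<epsilon>. pt (fst p, snd p - \<epsilon>) \<in> K) (at_right 0)"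
      using eventually_at_right_real[OF p(3)]
    proof eventually_elim
      case (elim \<epsilon>)
      then show ?case
        using p by (intro above) (auto simp: G_def f_def)
    qed
    moreover have "((\<lambda>\<epsilon>. pt (fst p, snd p - \<epsilon>)) \<longlongrightarrow> pt (fst p, snd p - 0)) (at_right 0)"
      unfolding pt_def by (auto intro!: tendsto_eq_intros)
    ultimately have "pt (fst p, snd p - 0) \<in> K"
      by (intro Lim_in_closed_set[OF \<open>closed K\<close> _ trivial_limit_at_right_real]) auto
    then show ?thesis by simp
  qed
  have notint: "pt ps \<notin> interior K"
  proof -
    have "pt ` closure Bad \<subseteq> closure (pt ` Bad)"
      by (rule image_closure_subset)
         (auto intro: continuous_on_subset[OF cont_pt] closure_subset[THEN subsetD])
    also have "\<dots> \<subseteq> closure (- K)"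
      by (intro closure_mono) (auto simp: Bad_def)
    also have "\<dots> = - interior K" by (simp add: closure_complement)
    finally show ?thesis using ps(1) by blast
  qed
  have chord: "closed_segment (m - l *\<^sub>R u) (m + l *\<^sub>R u) \<subseteq> K"
    using \<open>convex K\<close> ends by (simp add: convex_contains_segment)
  have chord_pt: "m + c *\<^sub>R u = (1 - (c + l) / (2 * l)) *\<^sub>R (m - l *\<^sub>R u) + ((c + l) / (2 * l)) *\<^sub>R (m + l *\<^sub>R u)" for c
  proof -
    define k where "k = (c + l) / (2 * l)"
    have "(1 - k) *\<^sub>R (m - l *\<^sub>R u) + k *\<^sub>R (m + l *\<^sub>R u) = m + (k * l + k * l - l) *\<^sub>R u"
      unfolding scaleR_add_left scaleR_diff_left by (simp add: scaleR_add_right scaleR_diff_right scaleR_diff_left)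
      moreover have "k * l + k * l - l = c" using l by (simp add: k_def field_simps)
    ultimately show ?thesis by (simp add: k_def)
  qed
  have base: "m + c *\<^sub>R u \<in> K" if "\<bar>c\<bar> \<le> l" for c
  proof -
    have "m + c *\<^sub>R u \<in> closed_segment (m - l *\<^sub>R u) (m + l *\<^sub>R u)"
      unfolding in_segment using l that
      by (intro exI[of _ "(c + l) / (2 * l)"] conjI chord_pt) (auto simp: abs_le_iff)
    then show ?thesis using chord by blast
  qed
  consider "0 < b0" | "b0 = 0" "\<bar>a0\<bar> < l" | "b0 = 0" "\<bar>a0\<bar> = l"
    using G0 by fastforce
  then show False
  proof cases
    case 1
    define c0 where "c0 = b0 + h + M"
    have a0R: "a0\<^sup>2 \<le> l\<^sup>2" using G0(1) by (metis abs_ge_zero power2_abs power_mono)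
    have c0_eq: "c0 = sqrt (R\<^sup>2 - a0\<^sup>2)" using G0(4) by (simp add: c0_def H_def)
    then have circ: "a0\<^sup>2 + c0\<^sup>2 = R\<^sup>2" using a0R lR by simp
    \<comment> \<open>A chord of the arc that is cut off symmetrically around the stuck point: its ends are obtained from the point by rotations about the centre of the arc with sine \<open>s\<close> and \<open>- s\<close>. All requirements hold for small \<open>s > 0\<close>.\<close>
    have t1: "eventually (\<lambda>s. 0 < sqrt (1 - s\<^sup>2) * c0 - s * \<bar>a0\<bar> - h - M) (at_right 0)"
    proof (rule order_tendstoD(1))
      show "((\<lambda>s. sqrt (1 - s\<^sup>2) * c0 - s * \<bar>a0\<bar> - h - M) \<longlongrightarrow> sqrt (1 - 0\<^sup>2) * c0 - 0 * \<bar>a0\<bar> - h - M) (at_right 0)"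
        by (intro tendsto_intros)
      show "0 < sqrt (1 - 0\<^sup>2) * c0 - 0 * \<bar>a0\<bar> - h - M" using 1 by (simp add: c0_def)
    qed
    have t2: "eventually (\<lambda>s. 2 * r < R * (1 + sqrt (1 - s\<^sup>2))) (at_right 0)"
    proof (rule order_tendstoD(1))
      show "((\<lambda>s. R * (1 + sqrt (1 - s\<^sup>2))) \<longlongrightarrow> R * (1 + sqrt (1 - 0\<^sup>2))) (at_right 0)"
        by (intro tendsto_intros)
      show "2 * r < R * (1 + sqrt (1 - 0\<^sup>2))" using \<open>r < R\<close> by simp
    qed
    have t3: "eventually (\<lambda>s. 2 * s * R < d) (at_right 0)"
    proof (rule order_tendstoD(2))
      show "((\<lambda>s. 2 * s * R) \<longlongrightarrow> 2 * 0 * R) (at_right 0)" by (intro tendsto_intros)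
      show "2 * 0 * R < d" using \<open>0 < d\<close> by simp
    qed
    have t4: "eventually (\<lambda>s::real. s \<in> {0<..<1}) (at_right 0)"
      using eventually_at_right_real[of 0 "1::real"] by simp
    obtain s where s: "0 < sqrt (1 - s\<^sup>2) * c0 - s * \<bar>a0\<bar> - h - M"
      "2 * r < R * (1 + sqrt (1 - s\<^sup>2))" "2 * s * R < d" "0 < s" "s < 1"
      using eventually_happens'[OF trivial_limit_at_right_real eventually_conj[OF t1 eventually_conj[OF t2 eventually_conj[OF t3 t4]]]]
      by auto
    define c where "c = sqrt (1 - s\<^sup>2)"
    have "s\<^sup>2 < 1" using s(4,5) by (simp add: power_less_one_iff)
    then have c: "0 \<le> c" "c\<^sup>2 = 1 - s\<^sup>2" "c < 1" using s(4)
      by (auto simp: c_def real_sqrt_lt_1_iff)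
    have on_circle: "(c * a0 + \<sigma> * c0)\<^sup>2 + (c * c0 - \<sigma> * a0)\<^sup>2 = R\<^sup>2" if "\<sigma>\<^sup>2 = s\<^sup>2" for \<sigma>
    proof -
      have "(c * a0 + \<sigma> * c0)\<^sup>2 + (c * c0 - \<sigma> * a0)\<^sup>2 = (c\<^sup>2 + \<sigma>\<^sup>2) * (a0\<^sup>2 + c0\<^sup>2)"
        by (simp add: power2_eq_square algebra_simps)
      then show ?thesis using that c circ by simp
    qed
    have Q: "pt (c * a0 + \<sigma> * c0, c * c0 - \<sigma> * a0 - h - M) \<in> K" if "\<sigma> = s \<or> \<sigma> = - s" for \<sigma>
    proof -
      have "\<sigma> * a0 \<le> s * \<bar>a0\<bar>" using that s(4)
        by (metis abs_ge_self abs_mult abs_of_pos abs_minus_cancel)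
      then have pos: "0 < c * c0 - \<sigma> * a0 - h - M" using s(1) by (simp add: c_def)
      have sq: "(c * a0 + \<sigma> * c0)\<^sup>2 + (c * c0 - \<sigma> * a0)\<^sup>2 = R\<^sup>2"
        using that by (intro on_circle) auto
      have hh: "h \<le> c * c0 - \<sigma> * a0" "0 \<le> c * c0 - \<sigma> * a0" using pos \<open>0 \<le> M\<close> h by auto
      have sqr: "c * c0 - \<sigma> * a0 = sqrt (R\<^sup>2 - (c * a0 + \<sigma> * c0)\<^sup>2)"
        using sq hh(2) by (intro real_sqrt_unique[symmetric]) auto
      have "h\<^sup>2 \<le> (c * c0 - \<sigma> * a0)\<^sup>2" using hh h by (intro power_mono) auto
      then have "(c * a0 + \<sigma> * c0)\<^sup>2 \<le> l\<^sup>2" using sq h(2) by linarith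
      then have al: "\<bar>c * a0 + \<sigma> * c0\<bar> \<le> l" using l by (simp add: abs_le_square_iff[symmetric])
      have fM: "H (c * a0 + \<sigma> * c0) - (c * c0 - \<sigma> * a0 - h - M) = M"
        using sqr by (simp add: H_def)
      show ?thesis
        using pos al fM \<open>0 \<le> M\<close> by (intro level) (auto simp: G_def f_def)
    qed
    define Qp where "Qp = pt (c * a0 + s * c0, c * c0 - s * a0 - h - M)"
    define Qm where "Qm = pt (c * a0 + (- s) * c0, c * c0 - (- s) * a0 - h - M)"
    have QK: "Qp \<in> K" "Qm \<in> K" unfolding Qp_def Qm_def by (intro Q; simp)+
    have norm_ue: "norm (x *\<^sub>R u + y *\<^sub>R e) = sqrt (x\<^sup>2 + y\<^sup>2)" for x y
      using uu ee ue by (simp add: norm_eq_sqrt_inner inner_add_left inner_add_right inner_commute power2_eq_square)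
    have "R > 0" using l by linarith
    have pt_diff: "pt p - pt q = (fst p - fst q) *\<^sub>R u + (snd p - snd q) *\<^sub>R e" for p q
      by (simp add: pt_def algebra_simps)
    have "Qp - Qm = (2 * s * c0) *\<^sub>R u + (- 2 * s * a0) *\<^sub>R e"
      unfolding Qp_def Qm_def pt_diff by (intro arg_cong2[where f = "(+)"] arg_cong[where f = "\<lambda>k. k *\<^sub>R _"]) simp_all
    then have "dist Qp Qm = sqrt ((2 * s * c0)\<^sup>2 + (- 2 * s * a0)\<^sup>2)"
      by (simp only: dist_norm norm_ue)
    also have "(2 * s * c0)\<^sup>2 + (- 2 * s * a0)\<^sup>2 = (2 * s)\<^sup>2 * (a0\<^sup>2 + c0\<^sup>2)"
      by (simp add: power2_eq_square algebra_simps)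
    also have "sqrt \<dots> = 2 * s * R"
      unfolding circ using s(4) \<open>R > 0\<close> by (simp add: real_sqrt_mult)
    finally have dQ: "dist Qp Qm = 2 * s * R" .
    have "midpoint Qp Qm = pt (c * a0, c * c0 - h - M)"
    proof -
      have "pt p + pt q = 2 *\<^sub>R m + (fst p + fst q) *\<^sub>R u + (snd p + snd q) *\<^sub>R e" for p q
        by (simp add: pt_def algebra_simps scaleR_2)
      then show ?thesis
        by (simp add: midpoint_def Qp_def Qm_def) (simp add: pt_def scaleR_add_right add_divide_distrib diff_divide_distrib mult.commute)
    qed
    moreover have "pt (c * a0, c * c0 - h - M) - pt ps = (- (1 - c) * a0) *\<^sub>R u + (- (1 - c) * c0) *\<^sub>R e"
      unfolding pt_diff a0_def[symmetric] b0_def[symmetric] c0_def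
      by (intro arg_cong2[where f = "(+)"] arg_cong[where f = "\<lambda>k. k *\<^sub>R _"]) (simp_all add: algebra_simps)
    ultimately have "dist (midpoint Qp Qm) (pt ps) = sqrt ((- (1 - c) * a0)\<^sup>2 + (- (1 - c) * c0)\<^sup>2)"
      by (simp only: dist_norm norm_ue)
    also have "(- (1 - c) * a0)\<^sup>2 + (- (1 - c) * c0)\<^sup>2 = (1 - c)\<^sup>2 * (a0\<^sup>2 + c0\<^sup>2)"
      by (simp add: power2_eq_square algebra_simps)
    also have "sqrt \<dots> = (1 - c) * R"
      unfolding circ using c \<open>R > 0\<close> by (simp add: real_sqrt_mult)
    finally have dP: "dist (midpoint Qp Qm) (pt ps) = (1 - c) * R" .
    \<comment> \<open>The cap has height \<open>(1 - c) * R\<close>, and the midpoint ball has radius \<open>s\<^sup>2 * R\<^sup>2 / (2 * r)\<close> with \<open>s\<^sup>2 = (1 - c) * (1 + c)\<close>.\<close>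
    have "(1 - c) * R * (2 * r) < (1 - c) * R * (R * (1 + c))"
      using s(2) c \<open>R > 0\<close> by (intro mult_strict_left_mono) (auto simp: c_def[symmetric])
    also have "\<dots> = (1 - c\<^sup>2) * R\<^sup>2" by (simp add: power2_eq_square algebra_simps)
    also have "\<dots> = s\<^sup>2 * R\<^sup>2" using c by simp
    finally have "dist (midpoint Qp Qm) (pt ps) < (dist Qp Qm)\<^sup>2 / (8 * r)"
      unfolding dP dQ using \<open>0 < r\<close> by (simp add: field_simps power_mult_distrib)
    then have "pt ps \<in> interior K"
      using midpoint_ballsD_interior[OF mb \<open>0 < r\<close> QK] dQ s(3) by simp
    then show False using notint by blast
  next
    case 2
    have "pt ps \<in> open_segment (m - l *\<^sub>R u) (m + l *\<^sub>R u)"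
      unfolding in_segment
    proof (intro conjI exI[of _ "(a0 + l) / (2 * l)"])
      show "pt ps = (1 - (a0 + l) / (2 * l)) *\<^sub>R (m - l *\<^sub>R u) + ((a0 + l) / (2 * l)) *\<^sub>R (m + l *\<^sub>R u)"
        using chord_pt[of a0] 2 by (simp add: pt_def a0_def[symmetric] b0_def[symmetric])
      have "u \<noteq> 0" using uu by auto
      then show "m - l *\<^sub>R u \<noteq> m + l *\<^sub>R u" using l
        by (metis add_diff_cancel_left' add_left_cancel diff_conv_add_uminus less_irrefl
            real_vector.scale_minus_left scaleR_cancel_right minus_equation_iff neg_less_0_iff_less order_less_trans)
    qed (use 2 l in \<open>auto simp: abs_less_iff\<close>)
    then show False
      using notint open_segment_subset_interior_if_midpoint_balls[OF mb \<open>0 < d\<close> \<open>0 < r\<close> chord] by blast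
  next
    case 3
    \<comment> \<open>The arc gets stuck only at an end of the chord, so it has not been lowered, and the whole region is in \<open>K\<close>.\<close>
    then have "M = 0" using G0(4) Hl by simp
    have "pt (a, b) \<in> K"
    proof (cases "b = 0")
      case True
      then show ?thesis using base ab by (simp add: pt_def)
    next
      case False
      have "(a, b) \<in> G" using \<open>(a, b) \<in> Bad\<close> by (simp add: Bad_def)
      then show ?thesis using False ab \<open>M = 0\<close> by (intro level) (auto simp: G_def f_def)
    qed
    then show False using \<open>(a, b) \<in> Bad\<close> by (simp add: Bad_def)
  qed
qed

text \<open>The lens is a union of planar regions over the chord, so the previous lemma applies for every
\<open>R > r\<close>, and \<open>R\<close> tends to \<open>r\<close>. The bound on \<open>dist x y\<close> is a global condition that midpoint balls
cannot replace: on the line every interval contains its midpoint balls, whatever its length.\<close>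

lemma lens_subset_if_midpoint_balls:
  fixes K :: "'a::euclidean_space set"
  assumes "closed K" "connected K" "0 < r"
    and mb: "\<And>R. r < R \<Longrightarrow> \<exists>d>0. midpoint_balls d R K"
    and xy: "x \<in> K" "y \<in> K" "dist x y \<le> 2 * r"
  shows "\<Inter>{cball c r | c. x \<in> cball c r \<and> y \<in> cball c r} \<subseteq> K"
proof
  fix z assume "z \<in> \<Inter>{cball c r | c. x \<in> cball c r \<and> y \<in> cball c r}"
  then have z: "dist c z \<le> r" if "dist c x \<le> r" "dist c y \<le> r" for c
    using that by auto
  have "convex K"
    using mb[of "2 * r"] \<open>0 < r\<close> convex_if_midpoint_balls[OF \<open>closed K\<close> \<open>connected K\<close>, of _ "2 * r"]
    by auto
  show "z \<in> K"
  proof (cases "x = y")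
    case True
    define v where "v = sgn (x - z)"
    have "z = x"
    proof (rule ccontr)
      assume "z \<noteq> x"
      then have v: "norm v = 1" "x - z = norm (x - z) *\<^sub>R v"
        by (auto simp: v_def norm_sgn sgn_div_norm)
      have "dist (x + r *\<^sub>R v) x \<le> r" using v \<open>0 < r\<close> by (simp add: dist_norm)
      then have "dist (x + r *\<^sub>R v) z \<le> r" using z True by blast
      moreover have "x + r *\<^sub>R v - z = (norm (x - z) + r) *\<^sub>R v"
        using v(2) by (simp add: algebra_simps)
      ultimately show False
        using v(1) \<open>0 < r\<close> \<open>z \<noteq> x\<close> by (simp add: dist_norm)
    qed
    then show ?thesis using xy by simp
  next
    case False
    define l where "l = dist x y / 2"
    define m where "m = midpoint x y"
    define u where "u = sgn (y - x)"
    have l: "0 < l" "l \<le> r" using False xy by (auto simp: l_def)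
    have uu: "u \<bullet> u = 1" using False by (simp add: u_def norm_sgn flip: power2_norm_eq_inner)
    have yx: "y - x = (2 * l) *\<^sub>R u"
      using False by (simp add: l_def u_def sgn_div_norm dist_norm norm_minus_commute)
    have xm: "x = m - l *\<^sub>R u" "y = m + l *\<^sub>R u"
    proof -
      have "2 *\<^sub>R m = x + y" by (simp add: m_def midpoint_def)
      moreover have "2 *\<^sub>R (l *\<^sub>R u) = y - x" using yx by simp
      ultimately have "2 *\<^sub>R x = 2 *\<^sub>R (m - l *\<^sub>R u)" "2 *\<^sub>R y = 2 *\<^sub>R (m + l *\<^sub>R u)"
        by (simp_all only: scaleR_diff_right scaleR_add_right) (simp_all add: scaleR_2)
      then show "x = m - l *\<^sub>R u" "y = m + l *\<^sub>R u" by simp_all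
    qed
    define a where "a = (z - m) \<bullet> u"
    define w where "w = z - m - a *\<^sub>R u"
    have wu: "w \<bullet> u = 0" by (simp add: w_def a_def inner_diff_left uu)
    define b where "b = norm w"
    have "\<exists>e. e \<bullet> e = 1 \<and> u \<bullet> e = 0 \<and> w = b *\<^sub>R e \<or> w = 0"
    proof (cases "w = 0")
      case False
      then show ?thesis
        using wu by (intro exI[of _ "sgn w"])
          (auto simp: b_def sgn_div_norm inner_commute norm_sgn simp flip: power2_norm_eq_inner)
    qed auto
    then consider "w = 0" | e where "w \<noteq> 0" "e \<bullet> e = 1" "u \<bullet> e = 0" "w = b *\<^sub>R e" by blast
    then show ?thesis
    proof cases
      case 1
      then have zm: "z = m + a *\<^sub>R u" by (simp add: w_def algebra_simps)
      define k where "k = r - l"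
      have nu: "norm u = 1" using uu by (simp add: norm_eq_sqrt_inner)
      have "dist (m + \<sigma> *\<^sub>R k *\<^sub>R u) z \<le> r" if "\<bar>\<sigma>\<bar> = 1" for \<sigma> :: real
      proof (rule z)
        have "m + \<sigma> *\<^sub>R k *\<^sub>R u - x = (\<sigma> * k + l) *\<^sub>R u" "m + \<sigma> *\<^sub>R k *\<^sub>R u - y = (\<sigma> * k - l) *\<^sub>R u"
          by (simp_all add: xm algebra_simps)
        then show "dist (m + \<sigma> *\<^sub>R k *\<^sub>R u) x \<le> r" "dist (m + \<sigma> *\<^sub>R k *\<^sub>R u) y \<le> r"
          using that l nu by (auto simp: dist_norm k_def abs_if split: if_splits)
      qed
      moreover have "dist (m + \<sigma> *\<^sub>R k *\<^sub>R u) z = \<bar>\<sigma> * k - a\<bar>" for \<sigma> :: real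
      proof -
        have "m + \<sigma> *\<^sub>R k *\<^sub>R u - z = (\<sigma> * k - a) *\<^sub>R u"
          by (simp add: zm algebra_simps)
        then show ?thesis using nu by (simp add: dist_norm)
      qed
      ultimately have "\<bar>1 * k - a\<bar> \<le> r" "\<bar>- 1 * k - a\<bar> \<le> r"
        by (metis abs_one, metis abs_minus_cancel abs_one)
      then have "\<bar>a\<bar> \<le> l" by (auto simp: k_def abs_le_iff)
      have "z \<in> closed_segment x y"
        unfolding in_segment
      proof (intro exI[of _ "(a + l) / (2 * l)"] conjI)
        define k where "k = (a + l) / (2 * l)"
        have "(1 - k) *\<^sub>R x + k *\<^sub>R y = m + (k * l + k * l - l) *\<^sub>R u"
      unfolding xm scaleR_add_left scaleR_diff_left by (simp add: scaleR_add_right scaleR_diff_right scaleR_diff_left)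
      moreover have "k * l + k * l - l = a" using l by (simp add: k_def field_simps)
        ultimately show "z = (1 - (a + l) / (2 * l)) *\<^sub>R x + ((a + l) / (2 * l)) *\<^sub>R y"
          by (simp add: zm k_def)
      qed (use \<open>\<bar>a\<bar> \<le> l\<close> l in \<open>auto simp: abs_le_iff\<close>)
      then show ?thesis using \<open>convex K\<close> xy convex_contains_segment by blast
    next
      case (2 e)
      have "0 < b" using 2(1) by (simp add: b_def)
      have zm: "z = m + a *\<^sub>R u + b *\<^sub>R e" using 2(4) unfolding w_def by (simp add: algebra_simps)
      have norm_ue: "norm (s *\<^sub>R u + t *\<^sub>R e) = sqrt (s\<^sup>2 + t\<^sup>2)" for s t
        using uu 2(2,3) by (simp add: norm_eq_sqrt_inner inner_add_left inner_add_right inner_commute power2_eq_square)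
      define h where "h = sqrt (r\<^sup>2 - l\<^sup>2)"
      have lr: "l\<^sup>2 \<le> r\<^sup>2" using l by (simp add: power_mono)
      have h: "0 \<le> h" "h\<^sup>2 = r\<^sup>2 - l\<^sup>2" using lr by (auto simp: h_def)
      \<comment> \<open>The ball whose boundary contains \<open>x\<close>, \<open>y\<close> and the arc over the chord.\<close>
      have "dist (m - h *\<^sub>R e) z \<le> r"
      proof (rule z)
        have "m - h *\<^sub>R e - x = l *\<^sub>R u + (- h) *\<^sub>R e" "m - h *\<^sub>R e - y = (- l) *\<^sub>R u + (- h) *\<^sub>R e"
          by (simp_all add: xm)
        then show "dist (m - h *\<^sub>R e) x \<le> r" "dist (m - h *\<^sub>R e) y \<le> r"
          using h \<open>0 < r\<close> by (simp_all only: dist_norm norm_ue) simp_all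
      qed
      moreover have "m - h *\<^sub>R e - z = (- a) *\<^sub>R u + (- (b + h)) *\<^sub>R e"
        by (simp add: zm algebra_simps)
      ultimately have "sqrt ((- a)\<^sup>2 + (- (b + h))\<^sup>2) \<le> r" by (simp only: dist_norm norm_ue)
      then have abr: "a\<^sup>2 + (b + h)\<^sup>2 \<le> r\<^sup>2"
        by (metis power2_minus sqrt_le_D)
      have "h\<^sup>2 \<le> (b + h)\<^sup>2" using h \<open>0 < b\<close> by (intro power_mono) auto
      then have "a\<^sup>2 \<le> l\<^sup>2" using abr h by linarith
      then have al: "\<bar>a\<bar> \<le> l" using l by (simp add: abs_le_square_iff[symmetric])
      have bh: "b \<le> sqrt (r\<^sup>2 - a\<^sup>2) - h"
        using real_le_rsqrt[of "b + h" "r\<^sup>2 - a\<^sup>2"] abr by simp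
      define bR where "bR R = min b (sqrt (R\<^sup>2 - a\<^sup>2) - sqrt (R\<^sup>2 - l\<^sup>2))" for R
      have "eventually (\<lambda>R. m + a *\<^sub>R u + bR R *\<^sub>R e \<in> K) (at_right r)"
        using eventually_at_right_less
      proof eventually_elim
        case (elim R)
        have "r < (r + R) / 2" using elim by simp
        then obtain d where d: "0 < d" "midpoint_balls d ((r + R) / 2) K" using mb by blast
        show ?case
        proof (rule lens_above_chord_subset[OF \<open>closed K\<close> \<open>convex K\<close> d(2,1) _ _ uu 2(2,3) l(1), where R = R])
          show "0 \<le> bR R"
            using \<open>0 < b\<close> \<open>a\<^sup>2 \<le> l\<^sup>2\<close> by (auto simp: bR_def)
        qed (use elim l xy \<open>0 < r\<close> al in \<open>auto simp: bR_def xm[symmetric]\<close>)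
      qed
      moreover have "((\<lambda>R. m + a *\<^sub>R u + bR R *\<^sub>R e) \<longlongrightarrow> m + a *\<^sub>R u + bR r *\<^sub>R e) (at_right r)"
        unfolding bR_def by (intro tendsto_intros)
      ultimately have "m + a *\<^sub>R u + bR r *\<^sub>R e \<in> K"
        by (intro Lim_in_closed_set[OF \<open>closed K\<close> _ trivial_limit_at_right_real]) auto
      moreover have "bR r = b" using bh by (simp add: bR_def h_def min_def)
      ultimately show ?thesis by (simp add: zm)
    qed
  qed
qed

section \<open>Growth estimates on an interval\<close>

text \<open>Monotonicity from upper right derivatives. The set where \<open>g\<close> stays below the line of slope \<open>\<epsilon>\<close> through
its initial value is closed, and its last point can always be passed.\<close>

lemma nonincreasing_if_right_slopes:
  fixes g :: "real \<Rightarrow> real"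
  assumes "a \<le> b" and cont: "continuous_on {a..b} g"
    and slope: "\<And>x \<epsilon>. a \<le> x \<Longrightarrow> x < b \<Longrightarrow> 0 < \<epsilon> \<Longrightarrow> \<forall>\<^sub>F y in at_right x. g y - g x \<le> \<epsilon> * (y - x)"
  shows "g b \<le> g a"
proof -
  have bound: "g b \<le> g a + \<epsilon> * (b - a)" if "0 < \<epsilon>" for \<epsilon>
  proof (rule ccontr)
    assume neg: "\<not> g b \<le> g a + \<epsilon> * (b - a)"
    define S where "S = {x \<in> {a..b}. g x \<le> g a + \<epsilon> * (x - a)}"
    have "closed S"
      unfolding S_def
      by (intro continuous_on_closed_Collect_le[OF cont] continuous_intros)
    then have "compact S"
      unfolding compact_eq_bounded_closed S_def
      by (auto intro: bounded_subset[OF bounded_closed_interval[of a b]])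
    moreover have "S \<noteq> {}" using \<open>a \<le> b\<close> by (auto simp: S_def)
    ultimately obtain c where c: "c \<in> S" "\<And>x. x \<in> S \<Longrightarrow> x \<le> c"
      using compact_attains_sup[of S] by blast
    have "a \<le> c" "c < b" using c(1) neg by (auto simp: S_def less_le)
    have "\<forall>\<^sub>F y in at_right c. y \<in> S \<and> c < y"
      using slope[OF \<open>a \<le> c\<close> \<open>c < b\<close> \<open>0 < \<epsilon>\<close>] eventually_at_right_real[OF \<open>c < b\<close>]
    proof eventually_elim
      case (elim y)
      then show ?case
        using c(1) \<open>a \<le> c\<close> by (auto simp: S_def algebra_simps)
    qed
    then obtain y where "y \<in> S" "c < y"
      using eventually_happens'[OF trivial_limit_at_right_real] by blast
    then show False using c(2)[of y] by simp
  qed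
  show ?thesis
  proof (cases "a = b")
    case False
    then have "0 < b - a" using \<open>a \<le> b\<close> by simp
    show ?thesis
    proof (rule field_le_epsilon)
      fix \<delta> :: real assume "0 < \<delta>"
      then show "g b \<le> g a + \<delta>"
        using bound[of "\<delta> / (b - a)"] \<open>0 < b - a\<close> by simp
    qed
  qed simp
qed

text \<open>A mean value inequality for functions that are not known to be differentiable. It is applied to
curves \<open>\<theta> \<mapsto> \<phi> \<rho> (p + \<theta> *\<^sub>R (q - p))\<close>, for which only increments are
controlled.\<close>

lemma norm_increment_le_if_right_slopes:
  fixes f :: "real \<Rightarrow> 'a::real_normed_vector"
  assumes "a \<le> b" and cont: "continuous_on {a..b} f"
    and der: "\<And>x. (\<beta> has_real_derivative \<beta>' x) (at x)"
    and slope: "\<And>x \<epsilon>. a \<le> x \<Longrightarrow> x < b \<Longrightarrow> 0 < \<epsilon> \<Longrightarrow>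
      \<forall>\<^sub>F y in at_right x. norm (f y - f x) \<le> (\<beta>' x + \<epsilon>) * (y - x)"
  shows "norm (f b - f a) \<le> \<beta> b - \<beta> a"
proof -
  have cont_\<beta>: "continuous_on {a..b} \<beta>"
    using der by (intro continuous_at_imp_continuous_on ballI) (auto intro: DERIV_isCont)
  have "norm (f b - f a) - \<beta> b \<le> norm (f a - f a) - \<beta> a"
  proof (rule nonincreasing_if_right_slopes[OF \<open>a \<le> b\<close>, where g = "\<lambda>x. norm (f x - f a) - \<beta> x"])
    show "continuous_on {a..b} (\<lambda>x. norm (f x - f a) - \<beta> x)"
      by (intro continuous_intros cont cont_\<beta>)
    fix x \<epsilon> :: real
    assume x: "a \<le> x" "x < b" "0 < \<epsilon>"
    have "((\<lambda>y. (\<beta> y - \<beta> x) / (y - x)) \<longlongrightarrow> \<beta>' x) (at_right x)"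
      using has_field_derivative_at_within[OF der[of x], of "{x<..}"] by (simp add: has_field_derivative_iff)
    then have "\<forall>\<^sub>F y in at_right x. \<beta>' x - \<epsilon> / 2 < (\<beta> y - \<beta> x) / (y - x)"
      using x(3) by (intro order_tendstoD(1)) auto
    moreover have "\<forall>\<^sub>F y in at_right x. norm (f y - f x) \<le> (\<beta>' x + \<epsilon> / 2) * (y - x)"
      using x by (intro slope) auto
    ultimately show "\<forall>\<^sub>F y in at_right x. (norm (f y - f a) - \<beta> y) - (norm (f x - f a) - \<beta> x) \<le> \<epsilon> * (y - x)"
      using eventually_at_right_less
    proof eventually_elim
      case (elim y)
      have "norm (f y - f a) \<le> norm (f y - f x) + norm (f x - f a)"
        using norm_triangle_ineq[of "f y - f x" "f x - f a"] by simp
      moreover have "(\<beta>' x - \<epsilon> / 2) * (y - x) \<le> \<beta> y - \<beta> x"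
        using elim by (simp add: pos_less_divide_eq)
      moreover have "(\<beta>' x + \<epsilon> / 2) * (y - x) - (\<beta>' x - \<epsilon> / 2) * (y - x) = \<epsilon> * (y - x)"
        by (simp add: field_simps)
      ultimately show ?case using elim(2) by linarith
    qed
  qed
  then show ?thesis by simp
qed

text \<open>Formally, \<open>\<sigma> * (sqrt Z)' \<ge> - \<kappa>'\<close>. As \<open>sqrt Z\<close> need not be differentiable at zeros of \<open>Z\<close>, the
proof works with \<open>sqrt (Z + \<epsilon>\<^sup>2)\<close>. The sign \<open>\<sigma>\<close> covers estimates in both time directions.\<close>

lemma sqrt_difference_le_if_derivative_bound:
  fixes Z \<kappa> :: "real \<Rightarrow> real"
  assumes "a \<le> b" and "\<bar>\<sigma>\<bar> = 1"
    and Z: "\<And>x. x \<in> {a..b} \<Longrightarrow> (Z has_real_derivative Z' x) (at x within {a..b})"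
    and \<kappa>: "\<And>x. x \<in> {a..b} \<Longrightarrow> (\<kappa> has_real_derivative \<kappa>' x) (at x within {a..b})"
    and nn: "\<And>x. x \<in> {a..b} \<Longrightarrow> 0 \<le> Z x" "\<And>x. x \<in> {a..b} \<Longrightarrow> 0 \<le> \<kappa>' x"
    and bound: "\<And>x. x \<in> {a..b} \<Longrightarrow> - 2 * \<kappa>' x * sqrt (Z x) \<le> \<sigma> * Z' x"
  shows "\<sigma> * (sqrt (Z a) - sqrt (Z b)) \<le> \<kappa> b - \<kappa> a"
proof (rule field_le_epsilon)
  fix \<delta> :: real assume "0 < \<delta>"
  define \<epsilon> where "\<epsilon> = \<delta> / 2"
  have "0 < \<epsilon>" using \<open>0 < \<delta>\<close> by (simp add: \<epsilon>_def)
  define V where "V x = \<sigma> * sqrt (Z x + \<epsilon>\<^sup>2) + \<kappa> x" for x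
  have pos: "0 < Z x + \<epsilon>\<^sup>2" if "x \<in> {a..b}" for x
    using nn(1)[OF that] \<open>0 < \<epsilon>\<close> by (simp add: add_nonneg_pos)
  have V': "(V has_real_derivative \<sigma> * (Z' x / (2 * sqrt (Z x + \<epsilon>\<^sup>2))) + \<kappa>' x) (at x within {a..b})"
    if "x \<in> {a..b}" for x
    unfolding V_def using pos[OF that]
    by (auto intro!: derivative_eq_intros Z[OF that] \<kappa>[OF that] simp: field_simps)
  have V'_nonneg: "0 \<le> \<sigma> * (Z' x / (2 * sqrt (Z x + \<epsilon>\<^sup>2))) + \<kappa>' x" if x: "x \<in> {a..b}" for x
  proof -
    have "sqrt (Z x) \<le> sqrt (Z x + \<epsilon>\<^sup>2)" by simp
    then have "\<kappa>' x * sqrt (Z x) \<le> \<kappa>' x * sqrt (Z x + \<epsilon>\<^sup>2)"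
      using nn(2)[OF x] by (intro mult_left_mono) auto
    then have "0 \<le> \<sigma> * Z' x + 2 * \<kappa>' x * sqrt (Z x + \<epsilon>\<^sup>2)"
      using bound[OF x] by linarith
    then have "0 \<le> (\<sigma> * Z' x + 2 * \<kappa>' x * sqrt (Z x + \<epsilon>\<^sup>2)) / (2 * sqrt (Z x + \<epsilon>\<^sup>2))"
      using pos[OF x] by (intro divide_nonneg_pos) auto
    also have "\<dots> = \<sigma> * (Z' x / (2 * sqrt (Z x + \<epsilon>\<^sup>2))) + \<kappa>' x"
      using pos[OF x] by (simp add: add_divide_distrib)
    finally show ?thesis .
  qed
  have "V a \<le> V b"
  proof (rule DERIV_nonneg_imp_increasing_open[OF \<open>a \<le> b\<close>])
    fix x assume "a < x" "x < b"
    then show "\<exists>y. (V has_real_derivative y) (at x) \<and> 0 \<le> y"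
      using V'[of x] V'_nonneg[of x] at_within_Icc_at[of a x b] by auto
  next
    show "continuous_on {a..b} V"
      unfolding continuous_on_eq_continuous_within using V' DERIV_continuous by blast
  qed
  have "\<bar>\<sigma> * sqrt (Z x + \<epsilon>\<^sup>2) - \<sigma> * sqrt (Z x)\<bar> \<le> \<epsilon>" if "x \<in> {a..b}" for x
  proof -
    have "sqrt (Z x + \<epsilon>\<^sup>2) \<le> sqrt (Z x) + \<epsilon>"
      using sqrt_add_le_add_sqrt[OF nn(1)[OF that], of "\<epsilon>\<^sup>2"] \<open>0 < \<epsilon>\<close> by simp
    moreover have "sqrt (Z x) \<le> sqrt (Z x + \<epsilon>\<^sup>2)" by simp
    moreover have "\<bar>\<sigma> * sqrt (Z x + \<epsilon>\<^sup>2) - \<sigma> * sqrt (Z x)\<bar> = \<bar>sqrt (Z x + \<epsilon>\<^sup>2) - sqrt (Z x)\<bar>"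
      using \<open>\<bar>\<sigma>\<bar> = 1\<close> by (metis abs_mult mult_1 right_diff_distrib)
    ultimately show ?thesis by simp
  qed
  from this[of a] this[of b]
  have "\<bar>\<sigma> * sqrt (Z a + \<epsilon>\<^sup>2) - \<sigma> * sqrt (Z a)\<bar> \<le> \<epsilon>"
    and "\<bar>\<sigma> * sqrt (Z b + \<epsilon>\<^sup>2) - \<sigma> * sqrt (Z b)\<bar> \<le> \<epsilon>"
    using \<open>a \<le> b\<close> by auto
  with \<open>V a \<le> V b\<close> have "\<sigma> * sqrt (Z a) - \<sigma> * sqrt (Z b) \<le> \<kappa> b - \<kappa> a + 2 * \<epsilon>"
    unfolding V_def abs_le_iff by linarith
  then show "\<sigma> * (sqrt (Z a) - sqrt (Z b)) \<le> \<kappa> b - \<kappa> a + \<delta>"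
    by (simp add: \<epsilon>_def algebra_simps)
qed

lemma has_real_derivative_inner_self:
  fixes e :: "real \<Rightarrow> 'a::real_inner"
  assumes "(e has_vector_derivative e') (at x within S)"
  shows "((\<lambda>x. e x \<bullet> e x) has_real_derivative 2 * (e x \<bullet> e')) (at x within S)"
  using bounded_bilinear.has_vector_derivative[OF bounded_bilinear_inner assms assms]
  by (simp add: has_real_derivative_iff_has_vector_derivative inner_commute)

text \<open>The inequality of Gronwall, forwards and backwards in time: \<open>exp (2 * \<sigma> * A * (x - c)) * (norm (e x))\<^sup>2\<close>
has a derivative to which the previous lemma applies, with \<open>c = a\<close> for \<open>\<sigma> = - 1\<close> and \<open>c = b\<close> for \<open>\<sigma> = 1\<close>.\<close>

lemma gronwall_norm:
  fixes e :: "real \<Rightarrow> 'a::real_inner"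
  assumes "a \<le> b" "0 \<le> B"
    and e: "\<And>x. x \<in> {a..b} \<Longrightarrow> (e has_vector_derivative e' x) (at x within {a..b})"
    and bound: "\<And>x. x \<in> {a..b} \<Longrightarrow> norm (e' x) \<le> A * norm (e x) + B"
    and "0 \<le> A"
  shows "norm (e b) \<le> exp (A * (b - a)) * (norm (e a) + B * (b - a))"
    and "norm (e a) \<le> exp (A * (b - a)) * (norm (e b) + B * (b - a))"
proof -
  have inner_bound: "\<bar>e x \<bullet> e' x\<bar> \<le> A * (e x \<bullet> e x) + B * norm (e x)" if "x \<in> {a..b}" for x
  proof -
    have "\<bar>e x \<bullet> e' x\<bar> \<le> norm (e x) * norm (e' x)" by (rule Cauchy_Schwarz_ineq2)
    also have "\<dots> \<le> norm (e x) * (A * norm (e x) + B)"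
      by (intro mult_left_mono bound that) auto
    also have "\<dots> = A * (e x \<bullet> e x) + B * norm (e x)"
      by (simp add: algebra_simps power2_norm_eq_inner[symmetric] power2_eq_square)
    finally show ?thesis .
  qed
  have sqrt_exp: "sqrt (exp (2 * c) * (v \<bullet> v)) = exp c * norm v" for c :: real and v :: 'a
  proof -
    have "exp (2 * c) * (v \<bullet> v) = (exp c * norm v)\<^sup>2"
      by (simp add: power_mult_distrib power2_norm_eq_inner flip: exp_double)
    then show ?thesis by (simp add: real_sqrt_unique)
  qed
  have main: "\<sigma> * (exp (\<sigma> * A * (a - c)) * norm (e a) - exp (\<sigma> * A * (b - c)) * norm (e b)) \<le> B * b - B * a"
    if \<sigma>: "\<bar>\<sigma>\<bar> = 1" and c: "\<And>x. x \<in> {a..b} \<Longrightarrow> \<sigma> * (x - c) \<le> 0" for \<sigma> c :: real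
  proof -
    define Z where "Z x = exp (2 * (\<sigma> * A * (x - c))) * (e x \<bullet> e x)" for x
    define Z' where "Z' x = exp (2 * (\<sigma> * A * (x - c))) * (2 * (e x \<bullet> e' x) + 2 * \<sigma> * A * (e x \<bullet> e x))" for x
    have "\<sigma> * (sqrt (Z a) - sqrt (Z b)) \<le> B * b - B * a"
    proof (rule sqrt_difference_le_if_derivative_bound[OF \<open>a \<le> b\<close> \<sigma>, where Z' = Z' and \<kappa>' = "\<lambda>_. B"])
      fix x assume x: "x \<in> {a..b}"
      show "(Z has_real_derivative Z' x) (at x within {a..b})"
        unfolding Z_def Z'_def
        by (auto intro!: derivative_eq_intros has_real_derivative_inner_self[OF e[OF x]] simp: algebra_simps)
      show "((*) B has_real_derivative B) (at x within {a..b})"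
        by (auto intro!: derivative_eq_intros)
      show "0 \<le> Z x" by (simp add: Z_def)
      show "0 \<le> B" by fact
      have "\<sigma> * \<sigma> = 1" using \<sigma> by (metis abs_mult_self_eq mult_1)
      then have Z'_eq: "\<sigma> * Z' x = exp (2 * (\<sigma> * A * (x - c))) * (2 * \<sigma> * (e x \<bullet> e' x) + 2 * A * (e x \<bullet> e x))"
        by (simp add: Z'_def algebra_simps)
      have "- \<bar>e x \<bullet> e' x\<bar> \<le> \<sigma> * (e x \<bullet> e' x)"
        using \<sigma> by (metis abs_ge_minus_self abs_mult minus_le_iff mult_1)
      then have "- 2 * B * norm (e x) \<le> 2 * \<sigma> * (e x \<bullet> e' x) + 2 * A * (e x \<bullet> e x)"
        using inner_bound[OF x] by linarith
      then have "exp (2 * (\<sigma> * A * (x - c))) * (- 2 * B * norm (e x)) \<le> \<sigma> * Z' x"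
        unfolding Z'_eq by (intro mult_left_mono) auto
      moreover have "exp (2 * (\<sigma> * A * (x - c))) * norm (e x) * (2 * B) \<le> exp (\<sigma> * A * (x - c)) * norm (e x) * (2 * B)"
      proof (intro mult_right_mono)
        have "\<sigma> * A * (x - c) = A * (\<sigma> * (x - c))" by simp
        also have "\<dots> \<le> 0" by (rule mult_nonneg_nonpos[OF \<open>0 \<le> A\<close> c[OF x]])
        finally show "exp (2 * (\<sigma> * A * (x - c))) \<le> exp (\<sigma> * A * (x - c))"
          unfolding exp_le_cancel_iff by linarith
      qed (use \<open>0 \<le> B\<close> in auto)
      ultimately show "- 2 * B * sqrt (Z x) \<le> \<sigma> * Z' x"
        unfolding Z_def sqrt_exp by (simp add: algebra_simps)
    qed
    then show ?thesis unfolding Z_def sqrt_exp .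
  qed
  have ex: "exp (A * (b - a)) * exp (- (A * (b - a))) = 1"
    by (simp add: exp_minus)
  have "exp (- (A * (b - a))) * norm (e b) \<le> norm (e a) + B * (b - a)"
    using main[of "- 1" a] by (simp add: algebra_simps)
  then have "exp (A * (b - a)) * (exp (- (A * (b - a))) * norm (e b)) \<le> exp (A * (b - a)) * (norm (e a) + B * (b - a))"
    by (intro mult_left_mono) auto
  then show "norm (e b) \<le> exp (A * (b - a)) * (norm (e a) + B * (b - a))"
    using ex by (simp only: mult.assoc[symmetric] mult_1)
  have "exp (- (A * (b - a))) * norm (e a) \<le> norm (e b) + B * (b - a)"
    using main[of 1 b] by (simp add: algebra_simps)
  then have "exp (A * (b - a)) * (exp (- (A * (b - a))) * norm (e a)) \<le> exp (A * (b - a)) * (norm (e b) + B * (b - a))"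
    by (intro mult_left_mono) auto
  then show "norm (e a) \<le> exp (A * (b - a)) * (norm (e b) + B * (b - a))"
    using ex by (simp only: mult.assoc[symmetric] mult_1)
qed

section \<open>Flows in a tube with bounded and Lipschitz derivative\<close>

text \<open>The trajectories of a compact convex set of initial values up to time \<open>T\<close>, together with a
neighbourhood of width \<open>\<epsilon>\<close> in which the right-hand side has crude uniform bounds. The constants \<open>A\<close>
and \<open>L\<close> enter only terms of higher order.\<close>

locale flow_tube =
  fixes F :: "'a::euclidean_space \<Rightarrow> 'a" and F' :: "'a \<Rightarrow> 'a \<Rightarrow>\<^sub>L 'a"
    and \<phi> :: "real \<Rightarrow> 'a \<Rightarrow> 'a" and \<Omega> :: "'a set" and T A L \<epsilon> :: real
  assumes T_nonneg: "0 \<le> T" and A_nonneg: "0 \<le> A" and L_nonneg: "0 \<le> L" and \<epsilon>_pos: "0 < \<epsilon>"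
    and compact_\<Omega>: "compact \<Omega>" and convex_\<Omega>: "convex \<Omega>"
    and flow_0: "p \<in> \<Omega> \<Longrightarrow> \<phi> 0 p = p"
    and flow_ode: "p \<in> \<Omega> \<Longrightarrow> \<rho> \<in> {0..T} \<Longrightarrow>
      ((\<lambda>\<rho>. \<phi> \<rho> p) has_vector_derivative F (\<phi> \<rho> p)) (at \<rho> within {0..T})"
    and flow_cont: "continuous_on ({0..T} \<times> \<Omega>) (\<lambda>(\<rho>, p). \<phi> \<rho> p)"
    and F_deriv: "p \<in> \<Omega> \<Longrightarrow> \<rho> \<in> {0..T} \<Longrightarrow> a \<in> cball (\<phi> \<rho> p) \<epsilon> \<Longrightarrow> (F has_derivative F' a) (at a)"
    and F'_bound: "p \<in> \<Omega> \<Longrightarrow> \<rho> \<in> {0..T} \<Longrightarrow> a \<in> cball (\<phi> \<rho> p) \<epsilon> \<Longrightarrow> norm (F' a) \<le> A"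
    and F'_lipschitz: "p \<in> \<Omega> \<Longrightarrow> \<rho> \<in> {0..T} \<Longrightarrow> a \<in> cball (\<phi> \<rho> p) \<epsilon> \<Longrightarrow> b \<in> cball (\<phi> \<rho> p) \<epsilon> \<Longrightarrow>
      norm (F' a - F' b) \<le> L * dist a b"
begin

lemma F_lipschitz:
  assumes "p \<in> \<Omega>" "\<rho> \<in> {0..T}" "a \<in> cball (\<phi> \<rho> p) \<epsilon>" "b \<in> cball (\<phi> \<rho> p) \<epsilon>"
  shows "norm (F a - F b) \<le> A * norm (a - b)"
proof (rule differentiable_bound[of "cball (\<phi> \<rho> p) \<epsilon>" F "\<lambda>x. F' x"])
  show "(F has_derivative F' x) (at x within cball (\<phi> \<rho> p) \<epsilon>)" if "x \<in> cball (\<phi> \<rho> p) \<epsilon>" for x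
    using F_deriv[OF assms(1,2) that] by (rule has_derivative_at_withinI)
  show "onorm (F' x) \<le> A" if "x \<in> cball (\<phi> \<rho> p) \<epsilon>" for x
    using F'_bound[OF assms(1,2) that] by (simp add: norm_blinfun.rep_eq)
qed (use assms in auto)

text \<open>The difference \<open>F - F' (\<phi> \<rho> p)\<close> has derivative at most \<open>L * \<eta>\<close> on the ball of radius \<open>\<eta>\<close>.\<close>

lemma F_linearization:
  assumes p: "p \<in> \<Omega>" "\<rho> \<in> {0..T}" and "\<eta> \<le> \<epsilon>"
    and ab: "a \<in> cball (\<phi> \<rho> p) \<eta>" "b \<in> cball (\<phi> \<rho> p) \<eta>"
  shows "norm (F a - F b - F' (\<phi> \<rho> p) (a - b)) \<le> L * \<eta> * norm (a - b)"
proof -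
  let ?c = "\<phi> \<rho> p"
  have sub: "x \<in> cball ?c \<epsilon>" if "x \<in> cball ?c \<eta>" for x using that \<open>\<eta> \<le> \<epsilon>\<close> by simp
  have "norm ((\<lambda>x. F x - F' ?c x) a - (\<lambda>x. F x - F' ?c x) b) \<le> L * \<eta> * norm (a - b)"
  proof (rule differentiable_bound[of "cball ?c \<eta>" _ "\<lambda>x. F' x - F' ?c"])
    fix x assume x: "x \<in> cball ?c \<eta>"
    show "((\<lambda>x. F x - F' ?c x) has_derivative (F' x - F' ?c)) (at x within cball ?c \<eta>)"
      using has_derivative_at_withinI[OF F_deriv[OF p sub[OF x]]]
      by (auto intro!: derivative_eq_intros simp: blinfun.bilinear_simps)
    have "norm (F' x - F' ?c) \<le> L * dist x ?c"
      using F'_lipschitz[OF p sub[OF x], of ?c] \<epsilon>_pos by simp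
    also have "\<dots> \<le> L * \<eta>" using x L_nonneg by (intro mult_left_mono) (auto simp: dist_commute)
    finally show "onorm (F' x - F' ?c) \<le> L * \<eta>" by (simp add: norm_blinfun.rep_eq)
  qed (use ab in auto)
  then show ?thesis by (simp add: blinfun.bilinear_simps algebra_simps)
qed

lemma flow_cont_time: "p \<in> \<Omega> \<Longrightarrow> continuous_on {0..T} (\<lambda>\<rho>. \<phi> \<rho> p)"
  using continuous_on_compose2[OF flow_cont, of "{0..T}" "\<lambda>\<rho>. (\<rho>, p)"]
  by (simp add: image_subset_iff continuous_on_Pair)

lemma flow_cont_space: "\<rho> \<in> {0..T} \<Longrightarrow> continuous_on \<Omega> (\<phi> \<rho>)"
  using continuous_on_compose2[OF flow_cont, of \<Omega> "\<lambda>p. (\<rho>, p)"]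
  by (simp add: image_subset_iff continuous_on_Pair)

lemma flow_diff_ode:
  assumes "p \<in> \<Omega>" "q \<in> \<Omega>" "0 \<le> \<alpha>" "\<beta> \<le> T" "\<rho> \<in> {\<alpha>..\<beta>}"
  shows "((\<lambda>\<rho>. \<phi> \<rho> p - \<phi> \<rho> q) has_vector_derivative (F (\<phi> \<rho> p) - F (\<phi> \<rho> q))) (at \<rho> within {\<alpha>..\<beta>})"
  using assms
  by (intro has_vector_derivative_diff has_vector_derivative_within_subset[OF flow_ode, of _ _ "{\<alpha>..\<beta>}"]) auto

lemma flow_bi_lipschitz_interval:
  assumes pq: "p \<in> \<Omega>" "q \<in> \<Omega>" and t: "0 \<le> \<alpha>" "\<alpha> \<le> \<beta>" "\<beta> \<le> T"
    and close: "\<And>\<rho>. \<rho> \<in> {\<alpha>..\<beta>} \<Longrightarrow> dist (\<phi> \<rho> p) (\<phi> \<rho> q) \<le> \<epsilon>"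
  shows "dist (\<phi> \<beta> p) (\<phi> \<beta> q) \<le> exp (A * (\<beta> - \<alpha>)) * dist (\<phi> \<alpha> p) (\<phi> \<alpha> q)"
    and "dist (\<phi> \<alpha> p) (\<phi> \<alpha> q) \<le> exp (A * (\<beta> - \<alpha>)) * dist (\<phi> \<beta> p) (\<phi> \<beta> q)"
proof -
  have bound: "norm (F (\<phi> \<rho> p) - F (\<phi> \<rho> q)) \<le> A * norm (\<phi> \<rho> p - \<phi> \<rho> q) + 0" if "\<rho> \<in> {\<alpha>..\<beta>}" for \<rho>
    using F_lipschitz[OF pq(1), of \<rho> "\<phi> \<rho> p" "\<phi> \<rho> q"] close[OF that] t that \<epsilon>_pos by simp
  note gr = gronwall_norm[OF t(2) order_refl flow_diff_ode[OF pq t(1,3)] bound A_nonneg]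
  show "dist (\<phi> \<beta> p) (\<phi> \<beta> q) \<le> exp (A * (\<beta> - \<alpha>)) * dist (\<phi> \<alpha> p) (\<phi> \<alpha> q)"
    using gr(1) by (simp add: dist_norm)
  show "dist (\<phi> \<alpha> p) (\<phi> \<alpha> q) \<le> exp (A * (\<beta> - \<alpha>)) * dist (\<phi> \<beta> p) (\<phi> \<beta> q)"
    using gr(2) by (simp add: dist_norm)
qed

lemma flow_uniformly_close:
  assumes "0 < e"
  shows "\<exists>\<delta>>0. \<forall>p\<in>\<Omega>. \<forall>q\<in>\<Omega>. dist p q < \<delta> \<longrightarrow> (\<forall>\<rho>\<in>{0..T}. dist (\<phi> \<rho> p) (\<phi> \<rho> q) \<le> e)"
proof -
  have "uniformly_continuous_on ({0..T} \<times> \<Omega>) (\<lambda>(\<rho>, p). \<phi> \<rho> p)"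
    by (intro compact_uniformly_continuous flow_cont compact_Times compact_\<Omega> compact_Icc)
  then obtain \<delta> where \<delta>: "0 < \<delta>"
    "\<And>x y. x \<in> {0..T} \<times> \<Omega> \<Longrightarrow> y \<in> {0..T} \<times> \<Omega> \<Longrightarrow> dist y x < \<delta> \<Longrightarrow>
       dist ((\<lambda>(\<rho>, p). \<phi> \<rho> p) y) ((\<lambda>(\<rho>, p). \<phi> \<rho> p) x) < e"
    using \<open>0 < e\<close> unfolding uniformly_continuous_on_def by metis
  have "dist (\<phi> \<rho> p) (\<phi> \<rho> q) \<le> e" if "p \<in> \<Omega>" "q \<in> \<Omega>" "dist p q < \<delta>" "\<rho> \<in> {0..T}" for p q \<rho>
    using \<delta>(2)[of "(\<rho>, q)" "(\<rho>, p)"] that by (simp add: dist_Pair_Pair)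
  then show ?thesis using \<delta>(1) by blast
qed

abbreviation "E \<equiv> exp (A * T)"

lemma flow_bi_lipschitz:
  obtains \<delta> where "0 < \<delta>" "\<delta> \<le> 1" "E * \<delta> \<le> \<epsilon>"
    "\<And>p q \<rho>. p \<in> \<Omega> \<Longrightarrow> q \<in> \<Omega> \<Longrightarrow> dist p q < \<delta> \<Longrightarrow> \<rho> \<in> {0..T} \<Longrightarrow> dist (\<phi> \<rho> p) (\<phi> \<rho> q) \<le> E * dist p q"
    "\<And>p q \<rho>. p \<in> \<Omega> \<Longrightarrow> q \<in> \<Omega> \<Longrightarrow> dist p q < \<delta> \<Longrightarrow> \<rho> \<in> {0..T} \<Longrightarrow> dist p q \<le> E * dist (\<phi> \<rho> p) (\<phi> \<rho> q)"
proof -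
  obtain \<delta>0 where \<delta>0: "0 < \<delta>0"
    "\<And>p q \<rho>. p \<in> \<Omega> \<Longrightarrow> q \<in> \<Omega> \<Longrightarrow> dist p q < \<delta>0 \<Longrightarrow> \<rho> \<in> {0..T} \<Longrightarrow> dist (\<phi> \<rho> p) (\<phi> \<rho> q) \<le> \<epsilon>"
    using flow_uniformly_close[OF \<epsilon>_pos] by blast
  define \<delta> where "\<delta> = min \<delta>0 (min 1 (\<epsilon> / E))"
  have \<delta>: "0 < \<delta>" "\<delta> \<le> 1" "\<delta> \<le> \<delta>0" "\<delta> \<le> \<epsilon> / E"
    using \<delta>0(1) \<epsilon>_pos by (auto simp: \<delta>_def)
  have "E * \<delta> \<le> \<epsilon>" using \<delta>(4) by (simp add: field_simps)
  have mono: "exp (A * (\<rho> - 0)) * d \<le> E * d" if "\<rho> \<in> {0..T}" "0 \<le> d" for \<rho> d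
    using that A_nonneg by (intro mult_right_mono) (auto intro!: mult_left_mono)
  show thesis
  proof (rule that[OF \<delta>(1,2) \<open>E * \<delta> \<le> \<epsilon>\<close>])
    fix p q \<rho> assume pq: "p \<in> \<Omega>" "q \<in> \<Omega>" "dist p q < \<delta>" and \<rho>: "\<rho> \<in> {0..T}"
    have close: "dist (\<phi> \<rho>' p) (\<phi> \<rho>' q) \<le> \<epsilon>" if "\<rho>' \<in> {0..\<rho>}" for \<rho>'
      using \<delta>0(2)[OF pq(1,2), of \<rho>'] pq(3) \<delta>(3) that \<rho> by auto
    have b: "0 \<le> (0::real)" "0 \<le> \<rho>" "\<rho> \<le> T" using \<rho> by auto
    note gr = flow_bi_lipschitz_interval[OF pq(1,2) b close]
    show "dist (\<phi> \<rho> p) (\<phi> \<rho> q) \<le> E * dist p q"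
      using gr(1) mono[OF \<rho>, of "dist p q"] flow_0 pq by simp
    show "dist p q \<le> E * dist (\<phi> \<rho> p) (\<phi> \<rho> q)"
      using gr(2) mono[OF \<rho>, of "dist (\<phi> \<rho> p) (\<phi> \<rho> q)"] flow_0 pq by simp
  qed
qed

text \<open>Trajectories that meet at some time have a first meeting time. Just before it they are \<open>\<epsilon>\<close>-close,
and the backward estimate shows that they already coincide there.\<close>

lemma flow_inj:
  assumes "\<tau> \<in> {0..T}"
  shows "inj_on (\<phi> \<tau>) \<Omega>"
proof (rule inj_onI, rule ccontr)
  fix p q assume pq: "p \<in> \<Omega>" "q \<in> \<Omega>" "\<phi> \<tau> p = \<phi> \<tau> q" "p \<noteq> q"
  define d where "d \<rho> = dist (\<phi> \<rho> p) (\<phi> \<rho> q)" for \<rho>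
  have cont_d: "continuous_on {0..T} d"
    unfolding d_def by (intro continuous_intros flow_cont_time pq)
  define S where "S = {\<rho> \<in> {0..T}. d \<rho> \<le> 0}"
  have "closed S"
    unfolding S_def by (intro continuous_on_closed_Collect_le[OF cont_d] continuous_intros)
  then have "compact S"
    unfolding compact_eq_bounded_closed S_def
    by (auto intro: bounded_subset[OF bounded_closed_interval[of 0 T]])
  moreover have "\<tau> \<in> S" using assms pq by (simp add: S_def d_def)
  ultimately obtain c where c: "c \<in> S" "\<And>x. x \<in> S \<Longrightarrow> c \<le> x"
    using compact_attains_inf[of S] by blast
  have "c \<noteq> 0" using c(1) pq flow_0 by (auto simp: S_def d_def)
  then have c0: "0 < c" "c \<le> T" "d c = 0" using c(1) by (auto simp: S_def d_def)
  then have "c \<in> {0..T}" by simp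
  have "\<exists>\<eta>>0. \<forall>\<rho>\<in>{0..T}. dist \<rho> c < \<eta> \<longrightarrow> dist (d \<rho>) (d c) < \<epsilon>"
    using cont_d \<epsilon>_pos \<open>c \<in> {0..T}\<close> unfolding continuous_on_iff by blast
  then obtain \<eta> where \<eta>: "0 < \<eta>" "\<And>\<rho>. \<rho> \<in> {0..T} \<Longrightarrow> dist \<rho> c < \<eta> \<Longrightarrow> dist (d \<rho>) (d c) < \<epsilon>"
    by blast
  define \<alpha> where "\<alpha> = max 0 (c - \<eta> / 2)"
  have \<alpha>: "0 \<le> \<alpha>" "\<alpha> < c" using \<eta>(1) c0 by (auto simp: \<alpha>_def)
  have "dist (\<phi> \<rho> p) (\<phi> \<rho> q) \<le> \<epsilon>" if "\<rho> \<in> {\<alpha>..c}" for \<rho>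
  proof -
    have "dist (d \<rho>) (d c) < \<epsilon>"
      using that \<alpha> c0 \<eta>(1) by (intro \<eta>(2)) (auto simp: \<alpha>_def dist_real_def)
    then show ?thesis using c0(3) by (simp add: d_def dist_real_def)
  qed
  then have "d \<alpha> \<le> exp (A * (c - \<alpha>)) * d c"
    unfolding d_def using \<alpha> c0 pq by (intro flow_bi_lipschitz_interval) auto
  then have "\<alpha> \<in> S" using c0 \<alpha> by (simp add: S_def)
  then show False using c(2)[of \<alpha>] \<alpha> by simp
qed

text \<open>Initial values closer than this have trajectories that stay in each other's tube, so that they
separate and approach at most exponentially. The radius is at most 1 so that higher powers of a
distance can be absorbed into lower ones.\<close>

definition close_radius :: real where
  "close_radius = (SOME \<delta>. 0 < \<delta> \<and> \<delta> \<le> 1 \<and> E * \<delta> \<le> \<epsilon> \<and>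
     (\<forall>p\<in>\<Omega>. \<forall>q\<in>\<Omega>. dist p q < \<delta> \<longrightarrow> (\<forall>\<rho>\<in>{0..T}.
        dist (\<phi> \<rho> p) (\<phi> \<rho> q) \<le> E * dist p q \<and> dist p q \<le> E * dist (\<phi> \<rho> p) (\<phi> \<rho> q))))"

lemma close_radius:
  shows close_radius_pos: "0 < close_radius" and close_radius_le_1: "close_radius \<le> 1"
    and close_radius_le_\<epsilon>: "E * close_radius \<le> \<epsilon>"
    and flow_expand: "\<And>p q \<rho>. p \<in> \<Omega> \<Longrightarrow> q \<in> \<Omega> \<Longrightarrow> dist p q < close_radius \<Longrightarrow> \<rho> \<in> {0..T} \<Longrightarrow>
          dist (\<phi> \<rho> p) (\<phi> \<rho> q) \<le> E * dist p q"
    and flow_contract: "\<And>p q \<rho>. p \<in> \<Omega> \<Longrightarrow> q \<in> \<Omega> \<Longrightarrow> dist p q < close_radius \<Longrightarrow> \<rho> \<in> {0..T} \<Longrightarrow>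
          dist p q \<le> E * dist (\<phi> \<rho> p) (\<phi> \<rho> q)"
proof -
  have ex: "\<exists>\<delta>. 0 < \<delta> \<and> \<delta> \<le> 1 \<and> E * \<delta> \<le> \<epsilon> \<and>
     (\<forall>p\<in>\<Omega>. \<forall>q\<in>\<Omega>. dist p q < \<delta> \<longrightarrow> (\<forall>\<rho>\<in>{0..T}.
        dist (\<phi> \<rho> p) (\<phi> \<rho> q) \<le> E * dist p q \<and> dist p q \<le> E * dist (\<phi> \<rho> p) (\<phi> \<rho> q)))"
    using flow_bi_lipschitz by metis
  note * = someI_ex[OF ex, folded close_radius_def]
  show "0 < close_radius" "close_radius \<le> 1" "E * close_radius \<le> \<epsilon>" using * by blast+
  fix p q \<rho> assume "p \<in> \<Omega>" "q \<in> \<Omega>" "dist p q < close_radius" "\<rho> \<in> {0..T}"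
  with * show "dist (\<phi> \<rho> p) (\<phi> \<rho> q) \<le> E * dist p q" "dist p q \<le> E * dist (\<phi> \<rho> p) (\<phi> \<rho> q)"
    by blast+
qed

lemma flow_expand_\<epsilon>:
  assumes "p \<in> \<Omega>" "q \<in> \<Omega>" "dist p q < close_radius" "\<rho> \<in> {0..T}"
  shows "E * dist p q \<le> \<epsilon>" "dist (\<phi> \<rho> p) (\<phi> \<rho> q) \<le> \<epsilon>"
proof -
  have "E * dist p q \<le> E * close_radius" using assms(3) by (intro mult_left_mono) auto
  then show "E * dist p q \<le> \<epsilon>" using close_radius_le_\<epsilon> by linarith
  then show "dist (\<phi> \<rho> p) (\<phi> \<rho> q) \<le> \<epsilon>" using flow_expand[OF assms] by simp
qed

definition "secant_const = E * T * (2 * L * E\<^sup>2)"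

lemma secant_const_nonneg: "0 \<le> secant_const"
  using T_nonneg L_nonneg by (simp add: secant_const_def)

text \<open>The flow has Lipschitz derivative in the initial value, in terms of secants: parallel chords on one segment are mapped to almost parallel chords. The defect
\<open>(\<phi> \<rho> p' - \<phi> \<rho> p'') - \<kappa> *\<^sub>R (\<phi> \<rho> p - \<phi> \<rho> q)\<close> vanishes at time 0 and satisfies the equation linearized
at \<open>\<phi> \<rho> p\<close> up to an error of order \<open>\<kappa> * (dist p q)\<^sup>2\<close>.\<close>

lemma flow_secant:
  assumes pq: "p \<in> \<Omega>" "q \<in> \<Omega>" "dist p q < close_radius" and \<rho>: "\<rho> \<in> {0..T}"
    and p': "p' \<in> closed_segment p q" "p'' \<in> closed_segment p q"
    and \<kappa>: "p' - p'' = \<kappa> *\<^sub>R (p - q)" "0 \<le> \<kappa>" "\<kappa> \<le> 1"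
  shows "norm (\<phi> \<rho> p' - \<phi> \<rho> p'' - \<kappa> *\<^sub>R (\<phi> \<rho> p - \<phi> \<rho> q)) \<le> secant_const * \<kappa> * (dist p q)\<^sup>2"
proof -
  define \<eta> where "\<eta> = dist p q"
  have \<eta>: "0 \<le> \<eta>" "\<eta> < close_radius" using pq by (auto simp: \<eta>_def)
  have p'\<Omega>: "p' \<in> \<Omega>" "p'' \<in> \<Omega>"
    using p' pq convex_\<Omega> convex_contains_segment by blast+
  have dists: "dist p p' \<le> \<eta>" "dist p p'' \<le> \<eta>" "dist p' p'' = \<kappa> * \<eta>"
    using segment_bound(1)[OF p'(1)] segment_bound(1)[OF p'(2)] \<kappa>
    by (auto simp: \<eta>_def dist_norm norm_minus_commute)
  have "\<kappa> * \<eta> \<le> \<eta>" using \<kappa> \<eta> by (simp add: mult_left_le_one_le)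
  define e where "e \<rho> = (\<phi> \<rho> p' - \<phi> \<rho> p'') - \<kappa> *\<^sub>R (\<phi> \<rho> p - \<phi> \<rho> q)" for \<rho>
  define e' where "e' \<rho> = (F (\<phi> \<rho> p') - F (\<phi> \<rho> p'')) - \<kappa> *\<^sub>R (F (\<phi> \<rho> p) - F (\<phi> \<rho> q))" for \<rho>
  have deriv: "(e has_vector_derivative e' s) (at s within {0..\<rho>})" if "s \<in> {0..\<rho>}" for s
    unfolding e_def e'_def using that \<rho>
    by (intro has_vector_derivative_diff[OF flow_diff_ode[OF p'\<Omega>]]
         bounded_linear.has_vector_derivative[OF bounded_linear_scaleR_right flow_diff_ode[OF pq(1,2)]]) auto
  have bound: "norm (e' s) \<le> A * norm (e s) + 2 * L * E\<^sup>2 * \<kappa> * \<eta>\<^sup>2" if s: "s \<in> {0..\<rho>}" for s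
  proof -
    have s': "s \<in> {0..T}" using s \<rho> by auto
    let ?c = "\<phi> s p"
    have E\<eta>: "E * \<eta> \<le> \<epsilon>" using flow_expand_\<epsilon>(1)[OF pq s'] by (simp add: \<eta>_def)
    have in_ball: "\<phi> s x \<in> cball ?c (E * \<eta>)" if "x \<in> \<Omega>" "dist p x \<le> \<eta>" for x
    proof -
      have "dist ?c (\<phi> s x) \<le> E * dist p x"
        using that \<eta> pq s' by (intro flow_expand) auto
      also have "\<dots> \<le> E * \<eta>" using that by (intro mult_left_mono) auto
      finally show ?thesis by simp
    qed
    define r1 where "r1 = F (\<phi> s p') - F (\<phi> s p'') - F' ?c (\<phi> s p' - \<phi> s p'')"
    define r2 where "r2 = F (\<phi> s p) - F (\<phi> s q) - F' ?c (\<phi> s p - \<phi> s q)"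
    have "norm r1 \<le> L * (E * \<eta>) * norm (\<phi> s p' - \<phi> s p'')"
      unfolding r1_def by (intro F_linearization E\<eta> in_ball pq s' p'\<Omega> dists)
    also have "\<dots> \<le> L * (E * \<eta>) * (E * (\<kappa> * \<eta>))"
      using flow_expand[OF p'\<Omega> _ s'] dists(3) \<open>\<kappa> * \<eta> \<le> \<eta>\<close> \<eta> L_nonneg
      by (intro mult_left_mono) (auto simp: dist_norm)
    finally have r1: "norm r1 \<le> L * E\<^sup>2 * \<kappa> * \<eta>\<^sup>2"
      by (simp add: power2_eq_square algebra_simps)
    have "norm r2 \<le> L * (E * \<eta>) * norm (\<phi> s p - \<phi> s q)"
      unfolding r2_def using \<eta> by (intro F_linearization E\<eta> in_ball pq s') (auto simp: \<eta>_def)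
    also have "\<dots> \<le> L * (E * \<eta>) * (E * \<eta>)"
      using flow_expand[OF pq s'] \<eta> L_nonneg
      by (intro mult_left_mono) (auto simp: dist_norm \<eta>_def)
    finally have "norm r2 \<le> L * E\<^sup>2 * \<eta>\<^sup>2"
      by (simp add: power2_eq_square algebra_simps)
    then have r2: "norm (\<kappa> *\<^sub>R r2) \<le> L * E\<^sup>2 * \<kappa> * \<eta>\<^sup>2"
      using mult_left_mono[of "norm r2" "L * E\<^sup>2 * \<eta>\<^sup>2" \<kappa>] \<kappa> by (simp add: algebra_simps)
    have "e' s = F' ?c (e s) + r1 - \<kappa> *\<^sub>R r2"
      by (simp add: e'_def e_def r1_def r2_def blinfun.bilinear_simps algebra_simps)
    then have "norm (e' s) \<le> norm (F' ?c (e s)) + norm r1 + norm (\<kappa> *\<^sub>R r2)"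
      using norm_triangle_ineq4[of "F' ?c (e s) + r1" "\<kappa> *\<^sub>R r2"] norm_triangle_ineq[of "F' ?c (e s)" r1]
      by simp
    moreover have "norm (F' ?c (e s)) \<le> A * norm (e s)"
    proof -
      have "norm (F' ?c) \<le> A" using F'_bound[OF pq(1) s'] \<epsilon>_pos by simp
      then show ?thesis
        by (meson mult_right_mono norm_blinfun norm_ge_zero order_trans)
    qed
    ultimately show ?thesis using r1 r2 by linarith
  qed
  have "norm (e \<rho>) \<le> exp (A * (\<rho> - 0)) * (norm (e 0) + 2 * L * E\<^sup>2 * \<kappa> * \<eta>\<^sup>2 * (\<rho> - 0))"
    using \<rho> L_nonneg \<kappa> by (intro gronwall_norm(1)[OF _ _ deriv bound A_nonneg]) auto
  also have "e 0 = 0" using flow_0 p'\<Omega> pq \<kappa>(1) by (simp add: e_def)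
  also have "exp (A * (\<rho> - 0)) * (norm (0::'a) + 2 * L * E\<^sup>2 * \<kappa> * \<eta>\<^sup>2 * (\<rho> - 0)) \<le> E * (2 * L * E\<^sup>2 * \<kappa> * \<eta>\<^sup>2 * T)"
    using \<rho> A_nonneg L_nonneg \<kappa> by (intro mult_mono) (auto intro!: mult_left_mono)
  finally show ?thesis by (simp add: e_def secant_const_def \<eta>_def algebra_simps)
qed

end

section \<open>Distortion of short chords\<close>

text \<open>The sharp constants of the problem, which are available only at the points of the tube itself: a
pointwise Lipschitz constant \<open>M2\<close> of the derivative, and bounds \<open>up\<close> and \<open>lo\<close> of its quadratic form.
The number \<open>a\<close> bounds the rate \<open>2 * up - lo\<close>, at which the square of the length of a short chord may grow
relative to a displacement of its midpoint.\<close>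

locale curved_flow_tube = flow_tube +
  fixes M2 a :: real and up lo :: "'a \<Rightarrow> real"
  assumes M2_nonneg: "0 \<le> M2"
    and F'_pointwise: "p \<in> \<Omega> \<Longrightarrow> \<rho> \<in> {0..T} \<Longrightarrow> 0 < e \<Longrightarrow>
      \<forall>\<^sub>F b in nhds (\<phi> \<rho> p). norm (F' b - F' (\<phi> \<rho> p)) \<le> (M2 + e) * dist b (\<phi> \<rho> p)"
    and F'_upper: "p \<in> \<Omega> \<Longrightarrow> \<rho> \<in> {0..T} \<Longrightarrow> v \<bullet> F' (\<phi> \<rho> p) v \<le> up (\<phi> \<rho> p) * (v \<bullet> v)"
    and F'_lower: "p \<in> \<Omega> \<Longrightarrow> \<rho> \<in> {0..T} \<Longrightarrow> lo (\<phi> \<rho> p) * (v \<bullet> v) \<le> v \<bullet> F' (\<phi> \<rho> p) v"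
    and up_lo: "p \<in> \<Omega> \<Longrightarrow> \<rho> \<in> {0..T} \<Longrightarrow> 2 * up (\<phi> \<rho> p) - lo (\<phi> \<rho> p) \<le> a"
begin

lemma isCont_F':
  assumes "p \<in> \<Omega>" "\<rho> \<in> {0..T}"
  shows "isCont F' (\<phi> \<rho> p)"
  unfolding continuous_at_eps_delta
proof (intro allI impI)
  fix e :: real assume "0 < e"
  show "\<exists>d>0. \<forall>x'. dist x' (\<phi> \<rho> p) < d \<longrightarrow> dist (F' x') (F' (\<phi> \<rho> p)) < e"
  proof (intro exI[of _ "min \<epsilon> (e / (L + 1))"] conjI allI impI)
    show "0 < min \<epsilon> (e / (L + 1))" using \<epsilon>_pos L_nonneg \<open>0 < e\<close> by simp
    fix x assume x: "dist x (\<phi> \<rho> p) < min \<epsilon> (e / (L + 1))"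
    have "norm (F' x - F' (\<phi> \<rho> p)) \<le> L * dist x (\<phi> \<rho> p)"
      using x \<epsilon>_pos by (intro F'_lipschitz[OF assms]) (auto simp: dist_commute)
    also have "\<dots> \<le> (L + 1) * dist x (\<phi> \<rho> p)" by (intro mult_right_mono) auto
    also have "\<dots> < e" using x L_nonneg by (simp add: field_simps)
    finally show "dist (F' x) (F' (\<phi> \<rho> p)) < e" by (simp add: dist_norm)
  qed
qed

lemma isCont_F:
  assumes "p \<in> \<Omega>" "\<rho> \<in> {0..T}"
  shows "isCont F (\<phi> \<rho> p)"
  using F_deriv[OF assms, of "\<phi> \<rho> p"] \<epsilon>_pos by (auto intro: has_derivative_continuous)

context
  fixes p q :: 'a and \<rho> len :: real and \<gamma> :: "real \<Rightarrow> 'a"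
  assumes pq: "p \<in> \<Omega>" "q \<in> \<Omega>" and \<rho>: "\<rho> \<in> {0..T}"
    and \<gamma>_def: "\<gamma> = (\<lambda>\<theta>. \<phi> \<rho> (p + \<theta> *\<^sub>R (q - p)))"
    and \<gamma>_lip: "\<And>\<theta> \<theta>'. 0 \<le> \<theta> \<Longrightarrow> \<theta> \<le> \<theta>' \<Longrightarrow> \<theta>' \<le> 1 \<Longrightarrow> dist (\<gamma> \<theta>') (\<gamma> \<theta>) \<le> len * (\<theta>' - \<theta>)"
begin

lemma len_nonneg: "0 \<le> len"
  using order_trans[OF zero_le_dist \<gamma>_lip[of 0 1]] by simp

lemma segment_mem: "\<theta> \<in> {0..1} \<Longrightarrow> p + \<theta> *\<^sub>R (q - p) \<in> \<Omega>"
  using convexD_alt[OF convex_\<Omega> pq, of \<theta>] by (simp add: algebra_simps)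

lemma \<gamma>_cont: "continuous_on {0..1} \<gamma>"
  unfolding \<gamma>_def
  by (rule continuous_on_compose2[OF flow_cont_space[OF \<rho>], where f = "\<lambda>\<theta>. p + \<theta> *\<^sub>R (q - p)"])
     (auto intro!: continuous_intros segment_mem)

lemma eventually_\<gamma>_right:
  assumes x: "0 \<le> x" "x < c" "c \<le> 1" and P: "eventually P (nhds (\<gamma> x))"
  shows "\<forall>\<^sub>F y in at_right x. P (\<gamma> y) \<and> x < y \<and> y < c"
proof -
  obtain d where d: "0 < d" "\<And>z. dist z (\<gamma> x) < d \<Longrightarrow> P z"
    using P unfolding eventually_nhds_metric by blast
  have "x < min c (x + d / (len + 1))" using x d len_nonneg by simp
  from eventually_at_right_real[OF this] show ?thesis
  proof eventually_elim
    case (elim y)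
    then have "dist (\<gamma> y) (\<gamma> x) \<le> len * (y - x)" using x by (intro \<gamma>_lip) auto
    also have "\<dots> \<le> (len + 1) * (y - x)" using elim by (intro mult_right_mono) auto
    also have "\<dots> < d" using elim len_nonneg by (simp add: field_simps)
    finally show ?case using d elim by simp
  qed
qed

text \<open>A pointwise Lipschitz bound integrates along a curve that stays in the tube, here the image of a
segment. Straight segments between points of the tube may leave it.\<close>

lemma F'_along_segment:
  assumes "c \<in> {0..1}"
  shows "norm (F' (\<gamma> c) - F' (\<gamma> 0)) \<le> M2 * len * c"
proof -
  have "norm (F' (\<gamma> c) - F' (\<gamma> 0)) \<le> M2 * len * c - M2 * len * 0"
  proof (rule norm_increment_le_if_right_slopes[where f = "\<lambda>\<theta>. F' (\<gamma> \<theta>)" and \<beta>' = "\<lambda>_. M2 * len"])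
    show "0 \<le> c" using assms by simp
    show "continuous_on {0..c} (\<lambda>\<theta>. F' (\<gamma> \<theta>))"
      unfolding continuous_on_eq_continuous_within
    proof
      fix x assume "x \<in> {0..c}"
      then have x: "x \<in> {0..1}" using assms by simp
      have "continuous (at x within {0..c}) \<gamma>"
        using continuous_on_subset[OF \<gamma>_cont, of "{0..c}"] assms \<open>x \<in> {0..c}\<close>
        by (simp add: continuous_on_eq_continuous_within)
      moreover have "isCont F' (\<gamma> x)"
        unfolding \<gamma>_def using isCont_F'[OF segment_mem[OF x] \<rho>] .
      ultimately show "continuous (at x within {0..c}) (\<lambda>\<theta>. F' (\<gamma> \<theta>))"
        by (rule continuous_within_compose3[rotated])
    qed
    show "((\<lambda>\<theta>. M2 * len * \<theta>) has_real_derivative M2 * len) (at x)" for x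
      by (auto intro!: derivative_eq_intros)
    fix x e :: real assume x: "0 \<le> x" "x < c" "0 < e"
    define e1 where "e1 = e / (len + 1)"
    have "0 < e1" using x len_nonneg by (simp add: e1_def)
    have e1len: "e1 * len \<le> e"
      using x len_nonneg by (simp add: e1_def field_simps)
    have x1: "x \<in> {0..1}" "c \<le> 1" using x assms by auto
    have "\<forall>\<^sub>F b in nhds (\<gamma> x). norm (F' b - F' (\<gamma> x)) \<le> (M2 + e1) * dist b (\<gamma> x)"
      using F'_pointwise[OF segment_mem[OF x1(1)] \<rho> \<open>0 < e1\<close>] by (simp add: \<gamma>_def)
    from eventually_\<gamma>_right[OF x(1,2) x1(2) this]
    show "\<forall>\<^sub>F y in at_right x. norm (F' (\<gamma> y) - F' (\<gamma> x)) \<le> (M2 * len + e) * (y - x)"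
    proof eventually_elim
      case (elim y)
      have "dist (\<gamma> y) (\<gamma> x) \<le> len * (y - x)" using elim x assms by (intro \<gamma>_lip) auto
      then have "(M2 + e1) * dist (\<gamma> y) (\<gamma> x) \<le> (M2 + e1) * (len * (y - x))"
        using M2_nonneg \<open>0 < e1\<close> by (intro mult_left_mono) auto
      also have "\<dots> = (M2 * len + e1 * len) * (y - x)" by (simp add: algebra_simps)
      also have "\<dots> \<le> (M2 * len + e) * (y - x)" using e1len elim by (intro mult_right_mono) auto
      finally show ?case using elim by linarith
    qed
  qed
  then show ?thesis by simp
qed

text \<open>The second order remainder of Taylor's formula, along the curve \<open>\<gamma>\<close> instead of the segment between
its ends: \<open>F (\<gamma> \<theta>) - F' (\<gamma> 0) (\<gamma> \<theta>)\<close> has slope at most \<open>M2 * len\<^sup>2 * \<theta>\<close> at \<open>\<theta>\<close>.\<close>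

lemma F_second_order:
  "norm (F (\<gamma> 1) - F (\<gamma> 0) - F' (\<gamma> 0) (\<gamma> 1 - \<gamma> 0)) \<le> M2 * len\<^sup>2 / 2"
proof -
  define f where "f \<theta> = F (\<gamma> \<theta>) - F' (\<gamma> 0) (\<gamma> \<theta>)" for \<theta>
  have "norm (f 1 - f 0) \<le> M2 * len\<^sup>2 * 1\<^sup>2 / 2 - M2 * len\<^sup>2 * 0\<^sup>2 / 2"
  proof (rule norm_increment_le_if_right_slopes[where f = f and \<beta>' = "\<lambda>\<theta>. M2 * len\<^sup>2 * \<theta>"])
    have "continuous_on {0..1} (\<lambda>\<theta>. F (\<gamma> \<theta>))"
      unfolding continuous_on_eq_continuous_within
    proof
      fix x :: real assume x: "x \<in> {0..1}"
      have "continuous (at x within {0..1}) \<gamma>"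
        using \<gamma>_cont x by (simp add: continuous_on_eq_continuous_within)
      moreover have "isCont F (\<gamma> x)"
        unfolding \<gamma>_def using isCont_F[OF segment_mem[OF x] \<rho>] .
      ultimately show "continuous (at x within {0..1}) (\<lambda>\<theta>. F (\<gamma> \<theta>))"
        by (rule continuous_within_compose3[rotated])
    qed
    then show "continuous_on {0..1} f"
      unfolding f_def by (intro continuous_intros \<gamma>_cont)
    show "((\<lambda>\<theta>. M2 * len\<^sup>2 * \<theta>\<^sup>2 / 2) has_real_derivative M2 * len\<^sup>2 * x) (at x)" for x
      by (auto intro!: derivative_eq_intros)
    fix x e :: real assume x: "0 \<le> x" "x < 1" "0 < e"
    have x1: "x \<in> {0..1}" using x by auto
    define u where "u = min 1 (x + e / (L * len\<^sup>2 + 1))"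
    have Ll: "0 < L * len\<^sup>2 + 1" using L_nonneg by (simp add: add_nonneg_pos)
    have u: "x < u" "u \<le> 1" using x Ll by (auto simp: u_def)
    have "\<forall>\<^sub>F b in nhds (\<gamma> x). dist b (\<gamma> x) < \<epsilon>"
      using \<epsilon>_pos by (auto simp: eventually_nhds_metric)
    from eventually_\<gamma>_right[OF x(1) u this]
    show "\<forall>\<^sub>F y in at_right x. norm (f y - f x) \<le> (M2 * len\<^sup>2 * x + e) * (y - x)"
    proof eventually_elim
      case (elim y)
      define D where "D = dist (\<gamma> y) (\<gamma> x)"
      have D: "0 \<le> D" "D \<le> len * (y - x)" "D \<le> \<epsilon>"
        using elim x u unfolding D_def by (auto intro!: \<gamma>_lip)
      have "norm (F (\<gamma> y) - F (\<gamma> x) - F' (\<gamma> x) (\<gamma> y - \<gamma> x)) \<le> L * D * norm (\<gamma> y - \<gamma> x)"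
        unfolding \<gamma>_def using D(3)
        by (intro F_linearization segment_mem x1 \<rho>) (auto simp: D_def \<gamma>_def dist_commute)
      also have "\<dots> = L * (D * D)" by (simp add: D_def dist_norm)
      also have "\<dots> \<le> L * ((len * (y - x)) * (len * (y - x)))"
        using D L_nonneg by (intro mult_left_mono mult_mono) auto
      also have "\<dots> = (L * len\<^sup>2 * (y - x)) * (y - x)" by (simp add: power2_eq_square)
      also have "\<dots> \<le> e * (y - x)"
      proof (rule mult_right_mono)
        have "L * len\<^sup>2 * (y - x) \<le> (L * len\<^sup>2 + 1) * (y - x)" using elim by (intro mult_right_mono) auto
        also have "\<dots> \<le> e" using elim Ll by (simp add: u_def field_simps)
        finally show "L * len\<^sup>2 * (y - x) \<le> e" .
      qed (use elim in simp)
      finally have 1: "norm (F (\<gamma> y) - F (\<gamma> x) - F' (\<gamma> x) (\<gamma> y - \<gamma> x)) \<le> e * (y - x)" .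
      have "norm ((F' (\<gamma> x) - F' (\<gamma> 0)) (\<gamma> y - \<gamma> x)) \<le> norm (F' (\<gamma> x) - F' (\<gamma> 0)) * norm (\<gamma> y - \<gamma> x)"
        by (rule norm_blinfun)
      also have "\<dots> \<le> (M2 * len * x) * (len * (y - x))"
        using F'_along_segment[OF x1] D M2_nonneg len_nonneg x
        by (intro mult_mono) (auto simp: D_def dist_norm)
      finally have 2: "norm ((F' (\<gamma> x) - F' (\<gamma> 0)) (\<gamma> y - \<gamma> x)) \<le> M2 * len\<^sup>2 * x * (y - x)"
        by (simp add: power2_eq_square algebra_simps)
      have "f y - f x = (F (\<gamma> y) - F (\<gamma> x) - F' (\<gamma> x) (\<gamma> y - \<gamma> x)) + (F' (\<gamma> x) - F' (\<gamma> 0)) (\<gamma> y - \<gamma> x)"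
        by (simp add: f_def blinfun.bilinear_simps)
      then have "norm (f y - f x) \<le> norm (F (\<gamma> y) - F (\<gamma> x) - F' (\<gamma> x) (\<gamma> y - \<gamma> x)) + norm ((F' (\<gamma> x) - F' (\<gamma> 0)) (\<gamma> y - \<gamma> x))"
        by (metis norm_triangle_ineq)
      then show ?case using 1 2 by (simp add: distrib_right)
    qed
  qed simp
  moreover have "f 1 - f 0 = F (\<gamma> 1) - F (\<gamma> 0) - F' (\<gamma> 0) (\<gamma> 1 - \<gamma> 0)"
    by (simp add: f_def blinfun.bilinear_simps)
  ultimately show ?thesis by simp
qed

end

text \<open>By the secant estimate, the curve over half of the segment has Lipschitz constant half of the chord length,
up to a term of second order.\<close>

lemma half_segment_remainder:
  assumes pq: "p \<in> \<Omega>" "q \<in> \<Omega>" "dist p q < close_radius" and \<rho>: "\<rho> \<in> {0..T}"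
  defines "x \<equiv> \<phi> \<rho> p" and "m \<equiv> \<phi> \<rho> (midpoint p q)"
  shows "norm (F x - F m - F' m (x - m))
    \<le> M2 * (dist (\<phi> \<rho> p) (\<phi> \<rho> q) + secant_const * (dist p q)\<^sup>2)\<^sup>2 / 8"
proof -
  define m0 where "m0 = midpoint p q"
  define len where "len = (dist (\<phi> \<rho> p) (\<phi> \<rho> q) + secant_const * (dist p q)\<^sup>2) / 2"
  have m0: "m0 \<in> \<Omega>" "m0 \<in> closed_segment p q"
    using closed_segment_subset[OF pq(1,2) convex_\<Omega>] by (auto simp: m0_def)
  have pm0: "p - m0 = (1/2) *\<^sub>R (p - q)"
    by (simp add: m0_def midpoint_def algebra_simps flip: scaleR_add_left)
  have "norm (F (\<phi> \<rho> (m0 + 1 *\<^sub>R (p - m0))) - F (\<phi> \<rho> (m0 + 0 *\<^sub>R (p - m0)))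
      - F' (\<phi> \<rho> (m0 + 0 *\<^sub>R (p - m0))) (\<phi> \<rho> (m0 + 1 *\<^sub>R (p - m0)) - \<phi> \<rho> (m0 + 0 *\<^sub>R (p - m0)))) \<le> M2 * len\<^sup>2 / 2"
  proof (rule F_second_order[OF m0(1) pq(1) \<rho> refl])
    fix \<theta> \<theta>' :: real assume \<theta>: "0 \<le> \<theta>" "\<theta> \<le> \<theta>'" "\<theta>' \<le> 1"
    define \<kappa> where "\<kappa> = (\<theta>' - \<theta>) / 2"
    have \<kappa>: "0 \<le> \<kappa>" "\<kappa> \<le> 1" using \<theta> by (auto simp: \<kappa>_def)
    have seg: "m0 + t *\<^sub>R (p - m0) \<in> closed_segment p q" if "0 \<le> t" "t \<le> 1" for t
      using convexD_alt[OF convex_closed_segment m0(2) ends_in_segment(1), of t] that by (simp add: algebra_simps)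
    have "(m0 + \<theta>' *\<^sub>R (p - m0)) - (m0 + \<theta> *\<^sub>R (p - m0)) = \<kappa> *\<^sub>R (p - q)"
      unfolding pm0 \<kappa>_def by (simp flip: scaleR_diff_left add: diff_divide_distrib)
    then have "norm (\<phi> \<rho> (m0 + \<theta>' *\<^sub>R (p - m0)) - \<phi> \<rho> (m0 + \<theta> *\<^sub>R (p - m0)) - \<kappa> *\<^sub>R (\<phi> \<rho> p - \<phi> \<rho> q)) \<le> secant_const * \<kappa> * (dist p q)\<^sup>2"
      using \<theta> by (intro flow_secant pq \<rho> seg \<kappa>) auto
    then have "dist (\<phi> \<rho> (m0 + \<theta>' *\<^sub>R (p - m0))) (\<phi> \<rho> (m0 + \<theta> *\<^sub>R (p - m0)))
        \<le> secant_const * \<kappa> * (dist p q)\<^sup>2 + norm (\<kappa> *\<^sub>R (\<phi> \<rho> p - \<phi> \<rho> q))"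
      unfolding dist_norm using norm_triangle_sub[of "\<phi> \<rho> (m0 + \<theta>' *\<^sub>R (p - m0)) - \<phi> \<rho> (m0 + \<theta> *\<^sub>R (p - m0))" "\<kappa> *\<^sub>R (\<phi> \<rho> p - \<phi> \<rho> q)"]
      by linarith
    also have "norm (\<kappa> *\<^sub>R (\<phi> \<rho> p - \<phi> \<rho> q)) = \<kappa> * dist (\<phi> \<rho> p) (\<phi> \<rho> q)"
      using \<kappa> by (simp add: dist_norm)
    also have "secant_const * \<kappa> * (dist p q)\<^sup>2 + \<kappa> * dist (\<phi> \<rho> p) (\<phi> \<rho> q) = len * (\<theta>' - \<theta>)"
      by (simp add: len_def \<kappa>_def field_simps)
    finally show "dist (\<phi> \<rho> (m0 + \<theta>' *\<^sub>R (p - m0))) (\<phi> \<rho> (m0 + \<theta> *\<^sub>R (p - m0))) \<le> len * (\<theta>' - \<theta>)" .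
  qed
  then show ?thesis by (simp add: x_def m_def m0_def[symmetric] len_def power_divide)
qed

lemma midpoint_remainder:
  assumes pq: "p \<in> \<Omega>" "q \<in> \<Omega>" "dist p q < close_radius" and \<rho>: "\<rho> \<in> {0..T}"
  defines "x \<equiv> \<phi> \<rho> p" and "y \<equiv> \<phi> \<rho> q" and "m \<equiv> \<phi> \<rho> (midpoint p q)"
  shows "norm ((F x - F m) + (F y - F m) - F' m ((x - m) + (y - m)))
    \<le> M2 * (dist x y + secant_const * (dist p q)\<^sup>2)\<^sup>2 / 4"
proof -
  have 1: "norm (F x - F m - F' m (x - m)) \<le> M2 * (dist x y + secant_const * (dist p q)\<^sup>2)\<^sup>2 / 8"
    using half_segment_remainder[OF assms(1-4)] by (simp add: x_def y_def m_def)
  have 2: "norm (F y - F m - F' m (y - m)) \<le> M2 * (dist x y + secant_const * (dist p q)\<^sup>2)\<^sup>2 / 8"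
    using half_segment_remainder[OF pq(2,1) _ \<rho>] pq(3)
    by (simp add: x_def y_def m_def dist_commute midpoint_sym)
  have "(F x - F m) + (F y - F m) - F' m ((x - m) + (y - m))
    = (F x - F m - F' m (x - m)) + (F y - F m - F' m (y - m))"
    by (simp add: blinfun.bilinear_simps)
  then have "norm ((F x - F m) + (F y - F m) - F' m ((x - m) + (y - m)))
    \<le> norm (F x - F m - F' m (x - m)) + norm (F y - F m - F' m (y - m))"
    by (metis norm_triangle_ineq)
  then show ?thesis using 1 2 by linarith
qed

text \<open>Linearization at a nearby trajectory, so that the growth rate of a chord and the decay rate of a
displacement can be compared at the same point.\<close>

lemma separation_growth:
  assumes "p \<in> \<Omega>" "q \<in> \<Omega>" and m0: "m0 \<in> \<Omega>" "dist m0 p \<le> \<eta>" "dist m0 q \<le> \<eta>" "\<eta> < close_radius"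
    and s: "s \<in> {0..T}"
  shows "(\<phi> s p - \<phi> s q) \<bullet> (F (\<phi> s p) - F (\<phi> s q))
    \<le> (up (\<phi> s m0) + L * E * \<eta>) * (dist (\<phi> s p) (\<phi> s q))\<^sup>2"
proof -
  define d d' m where "d = \<phi> s p - \<phi> s q" and "d' = F (\<phi> s p) - F (\<phi> s q)" and "m = \<phi> s m0"
  define R where "R = d' - F' m d"
  have \<eta>: "0 \<le> \<eta>" using m0(2) zero_le_dist[of m0 p] by linarith
  have "E * \<eta> \<le> E * close_radius" using m0(4) by (intro mult_left_mono) auto
  then have E\<eta>: "E * \<eta> \<le> \<epsilon>" using close_radius_le_\<epsilon> by linarith
  have in_ball: "\<phi> s z \<in> cball (\<phi> s m0) (E * \<eta>)" if z: "z \<in> \<Omega>" "dist m0 z \<le> \<eta>" for z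
  proof -
    have "dist (\<phi> s m0) (\<phi> s z) \<le> E * dist m0 z"
      using z m0(4) by (intro flow_expand m0 s) auto
    also have "\<dots> \<le> E * \<eta>" using z by (intro mult_left_mono) auto
    finally show ?thesis by simp
  qed
  have "norm R \<le> L * (E * \<eta>) * norm d"
    unfolding R_def d'_def d_def m_def
    by (intro F_linearization m0(1) s E\<eta> in_ball assms)
  then have "norm d * norm R \<le> norm d * (L * (E * \<eta>) * norm d)"
    by (intro mult_left_mono) auto
  then have "d \<bullet> R \<le> L * E * \<eta> * (norm d)\<^sup>2"
    using norm_cauchy_schwarz[of d R] by (simp add: power2_eq_square algebra_simps)
  moreover have "d \<bullet> F' m d \<le> up m * (norm d)\<^sup>2"
    using F'_upper[OF m0(1) s] by (simp add: m_def power2_norm_eq_inner)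
  moreover have "d \<bullet> d' = d \<bullet> F' m d + d \<bullet> R"
    by (simp add: R_def inner_diff_right)
  ultimately have "d \<bullet> d' \<le> (up m + L * E * \<eta>) * (norm d)\<^sup>2" by (simp add: distrib_right)
  then show ?thesis by (simp add: d_def d'_def m_def dist_norm)
qed

text \<open>The constant of the error terms that are smaller than \<open>(dist p q)\<^sup>2\<close> by a factor \<open>dist p q\<close>.\<close>

definition "remainder_const B = M2 / 8 * (2 * (secant_const * E) + (secant_const * E)\<^sup>2) + L * E ^ 4 * B\<^sup>2"

definition "exp_integral \<tau> = integral {0..\<tau>} (\<lambda>\<rho>. exp (a * \<rho>))"

lemma remainder_const_nonneg: "0 \<le> remainder_const B"
  using M2_nonneg L_nonneg secant_const_nonneg by (simp add: remainder_const_def)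

text \<open>The central estimate. A trajectory starts at \<open>\<xi>\<close> near the midpoint of a short chord and ends on the
segment from the image of the midpoint to a point at distance \<open>norm w\<close> from the midpoint of the
images; the claim bounds how far from the midpoint it started. Let \<open>x\<close>, \<open>y\<close>, \<open>m\<close>, \<open>k\<close> be
the trajectories of \<open>p\<close>, \<open>q\<close>, their midpoint and \<open>\<xi>\<close>, and put
\<open>e = (k - m) - (\<sigma> / 2) *\<^sub>R ((x - m) + (y - m))\<close>. Then \<open>e\<close> is \<open>\<xi> - midpoint p q\<close> at time 0 and
\<open>\<sigma> *\<^sub>R w\<close> at time \<open>\<tau>\<close>. It satisfies the equation linearized at \<open>m\<close> up to the curvature of the flow
along the chord, which is at most \<open>M2 / 8 * D\<^sup>2\<close> for \<open>D = dist x y\<close>, up to higher order. The norm of \<open>e\<close> grows at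
least at rate \<open>lo\<close>, apart from this curvature, and \<open>D\<close> at most at rate \<open>up\<close>. Hence the quotient
\<open>norm e / D\<^sup>2\<close> decreases at most at rate \<open>a\<close> plus the constant \<open>M2 / 8\<close>, and solving
this inequality backwards from time \<open>\<tau>\<close> gives the claim.\<close>

lemma distortion_estimate:
  assumes pq: "p \<in> \<Omega>" "q \<in> \<Omega>" "dist p q < close_radius" "p \<noteq> q" and \<tau>: "\<tau> \<in> {0..T}"
    and \<xi>: "\<xi> \<in> \<Omega>" "dist \<xi> (midpoint p q) \<le> B * (dist p q)\<^sup>2" "B * (dist p q)\<^sup>2 < close_radius" and "0 \<le> B"
    and \<sigma>: "0 \<le> \<sigma>" "\<sigma> \<le> 1"
    and end_pos: "\<phi> \<tau> \<xi> - \<phi> \<tau> (midpoint p q) = \<sigma> *\<^sub>R (midpoint (\<phi> \<tau> p) (\<phi> \<tau> q) + w - \<phi> \<tau> (midpoint p q))"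
    and w: "norm w \<le> W * (dist (\<phi> \<tau> p) (\<phi> \<tau> q))\<^sup>2"
  shows "dist \<xi> (midpoint p q) \<le>
     exp (2 * L * E * dist p q * T) * (exp (a * \<tau>) * W + (M2 / 8 + remainder_const B * dist p q) * exp_integral \<tau>) * (dist p q)\<^sup>2"
proof -
  define \<eta> where "\<eta> = dist p q"
  define m0 where "m0 = midpoint p q"
  have \<eta>: "0 < \<eta>" "\<eta> < close_radius" "\<eta> \<le> 1" using pq close_radius_le_1 by (auto simp: \<eta>_def)
  have m0: "m0 \<in> \<Omega>"
    using closed_segment_subset[OF pq(1,2) convex_\<Omega>] by (auto simp: m0_def)
  define x y m k where "x s = \<phi> s p" and "y s = \<phi> s q" and "m s = \<phi> s m0" and "k s = \<phi> s \<xi>" for s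
  define D where "D s = dist (x s) (y s)" for s
  define G where "G = exp (2 * L * E * \<eta> * T)"
  \<comment> \<open>The rate, enlarged by the error of linearizing the growth of \<open>D\<close>.\<close>
  define a1 where "a1 = a + 2 * L * E * \<eta>"
  define c where "c = M2 / 8 + remainder_const B * \<eta>"
  have c_nonneg: "0 \<le> c" using M2_nonneg remainder_const_nonneg \<eta> by (simp add: c_def)
  define d where "d s = x s - y s" for s
  define d' where "d' s = F (x s) - F (y s)" for s
  define e where "e s = (k s - m s) - (\<sigma> / 2) *\<^sub>R ((x s - m s) + (y s - m s))" for s
  define e' where "e' s = (F (k s) - F (m s)) - (\<sigma> / 2) *\<^sub>R ((F (x s) - F (m s)) + (F (y s) - F (m s)))" for s
  have d_deriv: "(d has_vector_derivative d' s) (at s within {0..\<tau>})" if "s \<in> {0..\<tau>}" for s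
    unfolding d_def d'_def x_def y_def using that \<tau> by (intro flow_diff_ode pq) auto
  have e_deriv: "(e has_vector_derivative e' s) (at s within {0..\<tau>})" if "s \<in> {0..\<tau>}" for s
    unfolding e_def e'_def x_def y_def m_def k_def using that \<tau>
    by (intro has_vector_derivative_diff[OF flow_diff_ode[OF \<xi>(1) m0]]
         bounded_linear.has_vector_derivative[OF bounded_linear_scaleR_right
           has_vector_derivative_add[OF flow_diff_ode[OF pq(1) m0] flow_diff_ode[OF pq(2) m0]]]) auto
  have dd: "d s \<bullet> d s = (D s)\<^sup>2" for s
    by (simp add: d_def D_def dist_norm power2_norm_eq_inner)
  have \<eta>D: "\<eta> \<le> E * D s" if "s \<in> {0..T}" for s
    using flow_contract[OF pq(1-3) that] by (simp add: \<eta>_def D_def x_def y_def)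
  have D_pos: "0 < D s" if "s \<in> {0..T}" for s
    using \<eta>D[OF that] \<eta>(1) by (metis exp_gt_zero less_le_trans zero_less_mult_pos)
  have dist_m0: "dist m0 p = \<eta> / 2" "dist m0 q = \<eta> / 2"
    by (simp_all add: m0_def \<eta>_def dist_midpoint)
  have grow: "d s \<bullet> d' s \<le> (up (m s) + L * E * \<eta>) * (D s)\<^sup>2" if "s \<in> {0..T}" for s
    unfolding d_def d'_def x_def y_def m_def D_def
    using dist_m0 \<eta> by (intro separation_growth pq(1,2) m0 that) auto
  have shrink: "lo (m s) * (e s \<bullet> e s) - norm (e s) * (c * (D s)\<^sup>2) \<le> e s \<bullet> e' s" if s: "s \<in> {0..T}" for s
  proof -
    define R1 where "R1 = F (k s) - F (m s) - F' (m s) (k s - m s)"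
    define R2 where "R2 = (F (x s) - F (m s)) + (F (y s) - F (m s)) - F' (m s) ((x s - m s) + (y s - m s))"
    have \<xi>close: "dist m0 \<xi> < close_radius" using \<xi>(2,3) by (simp add: m0_def dist_commute)
    have dk: "dist (m s) (k s) \<le> E * (B * \<eta>\<^sup>2)"
    proof -
      have "dist (m s) (k s) \<le> E * dist m0 \<xi>"
        unfolding m_def k_def by (rule flow_expand[OF m0 \<xi>(1) \<xi>close s])
      also have "\<dots> \<le> E * (B * \<eta>\<^sup>2)" using \<xi>(2) by (intro mult_left_mono) (auto simp: m0_def \<eta>_def dist_commute)
      finally show ?thesis .
    qed
    have "norm R1 \<le> L * dist (m s) (k s) * norm (k s - m s)"
      unfolding R1_def m_def
      using F_linearization[OF m0 s flow_expand_\<epsilon>(2)[OF m0 \<xi>(1) \<xi>close s]] by (simp add: m_def k_def)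
    also have "\<dots> = L * (dist (m s) (k s) * dist (m s) (k s))" by (simp add: dist_norm norm_minus_commute)
    also have "\<dots> \<le> L * ((E * (B * \<eta>\<^sup>2)) * (E * (B * \<eta>\<^sup>2)))"
      using dk L_nonneg \<open>0 \<le> B\<close> by (intro mult_left_mono mult_mono) auto
    also have "\<dots> = L * E\<^sup>2 * B\<^sup>2 * \<eta>\<^sup>2 * \<eta>\<^sup>2" by (simp add: power2_eq_square algebra_simps)
    also have "\<dots> \<le> L * E\<^sup>2 * B\<^sup>2 * \<eta> * (E * D s)\<^sup>2"
    proof (rule mult_mono)
      show "L * E\<^sup>2 * B\<^sup>2 * \<eta>\<^sup>2 \<le> L * E\<^sup>2 * B\<^sup>2 * \<eta>"
        using \<eta> L_nonneg by (intro mult_left_mono) (auto simp: power2_eq_square mult_left_le_one_le)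
      show "\<eta>\<^sup>2 \<le> (E * D s)\<^sup>2" using \<eta>D[OF s] \<eta> by (intro power_mono) auto
    qed (use L_nonneg \<eta> in auto)
    also have "\<dots> = L * E ^ 4 * B\<^sup>2 * \<eta> * (D s)\<^sup>2" by (simp add: power_mult_distrib algebra_simps flip: power_add)
    finally have R1: "norm R1 \<le> L * E ^ 4 * B\<^sup>2 * \<eta> * (D s)\<^sup>2" .
    have "norm R2 \<le> M2 * (D s + secant_const * \<eta>\<^sup>2)\<^sup>2 / 4"
      using midpoint_remainder[OF pq(1-3) s]
      by (simp add: R2_def x_def y_def m_def D_def m0_def \<eta>_def)
    also have "\<dots> \<le> M2 * (D s * (1 + secant_const * E * \<eta>))\<^sup>2 / 4"
    proof -
      have "secant_const * \<eta> * \<eta> \<le> secant_const * \<eta> * (E * D s)" using \<eta>D[OF s] secant_const_nonneg \<eta> by (intro mult_left_mono) auto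
      then have "D s + secant_const * \<eta>\<^sup>2 \<le> D s * (1 + secant_const * E * \<eta>)" by (simp add: power2_eq_square algebra_simps)
      then show ?thesis
        using D_pos[OF s] secant_const_nonneg M2_nonneg by (intro divide_right_mono mult_left_mono power_mono) auto
    qed
    also have "\<dots> = M2 / 4 * (D s)\<^sup>2 * (1 + secant_const * E * \<eta>)\<^sup>2"
      by (simp add: power_mult_distrib)
    also have "\<dots> \<le> M2 / 4 * (D s)\<^sup>2 * (1 + (2 * (secant_const * E) + (secant_const * E)\<^sup>2) * \<eta>)"
    proof (rule mult_left_mono)
      have "(secant_const * E)\<^sup>2 * (\<eta> * \<eta>) \<le> (secant_const * E)\<^sup>2 * \<eta>"
        using \<eta> by (intro mult_left_mono) (auto simp: mult_left_le_one_le)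
      then show "(1 + secant_const * E * \<eta>)\<^sup>2 \<le> 1 + (2 * (secant_const * E) + (secant_const * E)\<^sup>2) * \<eta>"
        by (simp add: power2_eq_square algebra_simps)
    qed (use M2_nonneg in auto)
    finally have R2: "norm R2 \<le> M2 / 4 * (D s)\<^sup>2 * (1 + (2 * (secant_const * E) + (secant_const * E)\<^sup>2) * \<eta>)" .
    have "norm ((\<sigma> / 2) *\<^sub>R R2) \<le> 1 / 2 * norm R2"
      using \<sigma> by (simp add: mult_left_le_one_le)
    also have "\<dots> \<le> M2 / 8 * (1 + (2 * (secant_const * E) + (secant_const * E)\<^sup>2) * \<eta>) * (D s)\<^sup>2"
      using R2 by (simp add: algebra_simps)
    finally have "norm R1 + norm ((\<sigma> / 2) *\<^sub>R R2) \<le> c * (D s)\<^sup>2"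
      using R1 by (simp add: c_def remainder_const_def algebra_simps)
    then have g: "norm (R1 - (\<sigma> / 2) *\<^sub>R R2) \<le> c * (D s)\<^sup>2"
      using norm_triangle_ineq4[of R1 "(\<sigma> / 2) *\<^sub>R R2"] by linarith
    have "e' s = F' (m s) (e s) + (R1 - (\<sigma> / 2) *\<^sub>R R2)"
      by (simp add: e'_def e_def R1_def R2_def blinfun.bilinear_simps algebra_simps)
    then have "e s \<bullet> e' s = e s \<bullet> F' (m s) (e s) + e s \<bullet> (R1 - (\<sigma> / 2) *\<^sub>R R2)"
      by (simp add: inner_add_right)
    moreover have "lo (m s) * (e s \<bullet> e s) \<le> e s \<bullet> F' (m s) (e s)"
      using F'_lower[OF m0 s] by (simp add: m_def)
    moreover have "\<bar>e s \<bullet> (R1 - (\<sigma> / 2) *\<^sub>R R2)\<bar> \<le> norm (e s) * (c * (D s)\<^sup>2)"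
      using Cauchy_Schwarz_ineq2[of "e s" "R1 - (\<sigma> / 2) *\<^sub>R R2"] mult_left_mono[OF g norm_ge_zero[of "e s"]]
      by linarith
    ultimately show ?thesis by linarith
  qed
  define v where "v s = 1 / (D s)\<^sup>2" for s
  \<comment> \<open>The square of \<open>exp (a1 * s) * norm e / D\<^sup>2\<close>. The exponential compensates the decay of the quotient, and squaring avoids differentiating the norm at zeros of \<open>e\<close>.\<close>
  define Z where "Z s = exp (2 * (a1 * s)) * (e s \<bullet> e s) * (v s)\<^sup>2" for s
  define Z' where "Z' s = exp (2 * (a1 * s)) * (v s)\<^sup>2 * (2 * a1 * (e s \<bullet> e s) + 2 * (e s \<bullet> e' s) - 4 * (e s \<bullet> e s) * ((d s \<bullet> d' s) * v s))" for s
  have sqrt_Z: "sqrt (Z s) = exp (a1 * s) * norm (e s) * v s" for s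
  proof -
    have "Z s = (exp (a1 * s) * norm (e s) * v s)\<^sup>2"
      by (simp add: Z_def power_mult_distrib power2_norm_eq_inner flip: exp_double)
    then show ?thesis by (simp add: real_sqrt_unique v_def)
  qed
  have "1 * (sqrt (Z 0) - sqrt (Z \<tau>)) \<le> c * G * exp_integral \<tau> - c * G * exp_integral 0"
  proof (rule sqrt_difference_le_if_derivative_bound[where Z' = Z' and \<kappa>' = "\<lambda>s. c * G * exp (a * s)"])
    show "0 \<le> \<tau>" using \<tau> by simp
    fix s assume s: "s \<in> {0..\<tau>}"
    then have s': "s \<in> {0..T}" using \<tau> by auto
    have "((\<lambda>s. d s \<bullet> d s) has_real_derivative 2 * (d s \<bullet> d' s)) (at s within {0..\<tau>})"
      by (rule has_real_derivative_inner_self[OF d_deriv[OF s]])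
    moreover have "d s \<bullet> d s \<noteq> 0" using D_pos[OF s'] by (simp add: dd)
    ultimately have "((\<lambda>s. inverse (d s \<bullet> d s)) has_real_derivative
        - (inverse (d s \<bullet> d s) * (2 * (d s \<bullet> d' s)) * inverse (d s \<bullet> d s))) (at s within {0..\<tau>})"
      by (rule DERIV_inverse')
    moreover have "v = (\<lambda>s. inverse (d s \<bullet> d s))"
      by (simp add: v_def dd fun_eq_iff inverse_eq_divide)
    ultimately have v_deriv: "(v has_real_derivative - (2 * (d s \<bullet> d' s)) * (v s)\<^sup>2) (at s within {0..\<tau>})"
      by (simp add: power2_eq_square mult_ac)
    show "(Z has_real_derivative Z' s) (at s within {0..\<tau>})"
      unfolding Z_def
      by (rule derivative_eq_intros has_real_derivative_inner_self[OF e_deriv[OF s]] v_deriv refl)+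
         (simp add: Z'_def power2_eq_square algebra_simps)
    show "((\<lambda>s. c * G * exp_integral s) has_real_derivative c * G * exp (a * s)) (at s within {0..\<tau>})"
      unfolding exp_integral_def
      by (intro DERIV_cmult integral_has_real_derivative s continuous_intros)
    show "0 \<le> Z s" by (simp add: Z_def)
    show "0 \<le> c * G * exp (a * s)" using c_nonneg by (simp add: G_def)
    have v_pos: "0 < v s" and vD: "v s * (D s)\<^sup>2 = 1" using D_pos[OF s'] by (auto simp: v_def)
    have "(d s \<bullet> d' s) * v s \<le> (up (m s) + L * E * \<eta>) * (D s)\<^sup>2 * v s"
      using grow[OF s'] v_pos by (intro mult_right_mono) auto
    also have "\<dots> = up (m s) + L * E * \<eta>" using vD by (simp add: mult.assoc mult.commute[of "v s"])
    finally have "(e s \<bullet> e s) * ((d s \<bullet> d' s) * v s) \<le> (e s \<bullet> e s) * (up (m s) + L * E * \<eta>)"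
      by (intro mult_left_mono) auto
    moreover have "0 \<le> (a - (2 * up (m s) - lo (m s))) * (e s \<bullet> e s)"
      using up_lo[OF m0 s'] by (intro mult_nonneg_nonneg) (auto simp: m_def)
    ultimately have "- 2 * (norm (e s) * (c * (D s)\<^sup>2)) \<le> 2 * a1 * (e s \<bullet> e s) + 2 * (e s \<bullet> e' s) - 4 * (e s \<bullet> e s) * ((d s \<bullet> d' s) * v s)"
      using shrink[OF s'] by (simp add: a1_def algebra_simps)
    then have "exp (2 * (a1 * s)) * (v s)\<^sup>2 * (- 2 * (norm (e s) * (c * (D s)\<^sup>2))) \<le> Z' s"
      unfolding Z'_def by (intro mult_left_mono) auto
    also have "exp (2 * (a1 * s)) * (v s)\<^sup>2 * (- 2 * (norm (e s) * (c * (D s)\<^sup>2)))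
        = - 2 * c * exp (2 * (a1 * s)) * norm (e s) * v s * (v s * (D s)\<^sup>2)"
      by (simp add: power2_eq_square)
    also have "\<dots> = - 2 * (c * exp (a1 * s)) * sqrt (Z s)"
      unfolding sqrt_Z vD by (simp add: exp_double power2_eq_square)
    finally have "- 2 * (c * exp (a1 * s)) * sqrt (Z s) \<le> Z' s" .
    moreover have "c * exp (a1 * s) * sqrt (Z s) \<le> c * G * exp (a * s) * sqrt (Z s)"
    proof (rule mult_right_mono)
      have "2 * L * E * \<eta> * s \<le> 2 * L * E * \<eta> * T"
        using s' L_nonneg \<eta> by (intro mult_left_mono) auto
      then have "exp (a1 * s) \<le> G * exp (a * s)"
        by (simp add: a1_def G_def distrib_right flip: exp_add)
      then show "c * exp (a1 * s) \<le> c * G * exp (a * s)"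
        using c_nonneg by (simp add: mult.assoc mult_left_mono)
    qed (simp add: Z_def)
    ultimately show "- 2 * (c * G * exp (a * s)) * sqrt (Z s) \<le> 1 * Z' s" by linarith
  qed simp
  moreover have "exp_integral 0 = 0" by (simp add: exp_integral_def)
  moreover have "sqrt (Z 0) = dist \<xi> m0 / \<eta>\<^sup>2"
  proof -
    have "p + q = 2 *\<^sub>R m0" by (simp add: m0_def midpoint_def)
    then have "(p - m0) + (q - m0) = 0" by (simp add: scaleR_2 algebra_simps)
    then have "e 0 = \<xi> - m0"
      using flow_0 pq m0 \<xi>(1) by (simp add: e_def x_def y_def m_def k_def)
    then show ?thesis
      using flow_0 pq by (simp add: sqrt_Z v_def D_def x_def y_def \<eta>_def dist_norm)
  qed
  moreover have "sqrt (Z \<tau>) \<le> G * exp (a * \<tau>) * W"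
  proof -
    have "2 *\<^sub>R (midpoint (x \<tau>) (y \<tau>) - m \<tau>) = (x \<tau> - m \<tau>) + (y \<tau> - m \<tau>)"
      by (simp add: midpoint_def scaleR_diff_right scaleR_2)
    then have "(\<sigma> / 2) *\<^sub>R ((x \<tau> - m \<tau>) + (y \<tau> - m \<tau>)) = \<sigma> *\<^sub>R (midpoint (x \<tau>) (y \<tau>) - m \<tau>)"
      by (metis scaleR_scaleR times_divide_eq_left nonzero_mult_div_cancel_right zero_neq_numeral)
    then have "e \<tau> = (k \<tau> - m \<tau>) - \<sigma> *\<^sub>R (midpoint (x \<tau>) (y \<tau>) - m \<tau>)"
      by (simp only: e_def)
    also have "k \<tau> - m \<tau> = \<sigma> *\<^sub>R (midpoint (x \<tau>) (y \<tau>) + w - m \<tau>)"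
      using end_pos by (simp add: x_def y_def m_def k_def m0_def)
    finally have "e \<tau> = \<sigma> *\<^sub>R w"
      by (simp add: scaleR_diff_right scaleR_add_right)
    then have "norm (e \<tau>) \<le> norm w" using \<sigma> by (simp add: mult_left_le_one_le)
    then have "norm (e \<tau>) * v \<tau> \<le> W"
      using w D_pos[OF \<tau>] by (simp add: v_def D_def x_def y_def divide_le_eq)
    moreover have "0 \<le> norm (e \<tau>) * v \<tau>" by (simp add: v_def)
    moreover have "exp (a1 * \<tau>) \<le> G * exp (a * \<tau>)"
    proof -
      have "2 * L * E * \<eta> * \<tau> \<le> 2 * L * E * \<eta> * T"
        using \<tau> L_nonneg \<eta> by (intro mult_left_mono) auto
      then show ?thesis
        by (simp add: a1_def G_def distrib_right flip: exp_add)
    qed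
    ultimately have "exp (a1 * \<tau>) * (norm (e \<tau>) * v \<tau>) \<le> (G * exp (a * \<tau>)) * W"
      by (intro mult_mono) (auto simp: G_def)
    then show ?thesis unfolding sqrt_Z by (simp add: mult.assoc)
  qed
  ultimately have "dist \<xi> m0 / \<eta>\<^sup>2 \<le> G * exp (a * \<tau>) * W + c * G * exp_integral \<tau>" by simp
  also have "\<dots> = G * (exp (a * \<tau>) * W + c * exp_integral \<tau>)" by (simp add: algebra_simps)
  finally show ?thesis
    using \<eta>(1) by (simp add: divide_le_eq G_def c_def m0_def \<eta>_def)
qed

section \<open>Midpoint balls in the attainable set\<close>

text \<open>Move a point from the image of the midpoint \<open>m0\<close> straight to a given point of the ball around the
midpoint of the images. As long as it has a preimage in the closed ball of radius \<open>B * (dist p q)\<^sup>2\<close>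
around \<open>m0\<close>, the distortion estimate puts this preimage into the open ball. The image of the open ball
is open by invariance of domain and that of the closed ball is closed, so the moving point never
leaves the image.\<close>

lemma flow_image_contains_midpoint_balls:
  assumes \<tau>: "\<tau> \<in> {0..T}" and "0 < B"
    and key: "exp (a * \<tau>) * W + M2 / 8 * exp_integral \<tau> < B"
    and balls: "\<And>p q. p \<in> \<Omega> \<Longrightarrow> q \<in> \<Omega> \<Longrightarrow> cball (midpoint p q) (B * (dist p q)\<^sup>2) \<subseteq> \<Omega>"
  shows "\<exists>\<delta>>0. \<forall>p\<in>\<Omega>. \<forall>q\<in>\<Omega>. dist p q < \<delta> \<longrightarrow>
    cball (midpoint (\<phi> \<tau> p) (\<phi> \<tau> q)) (W * (dist (\<phi> \<tau> p) (\<phi> \<tau> q))\<^sup>2) \<subseteq> \<phi> \<tau> ` \<Omega>"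
proof -
  define \<Theta> where "\<Theta> \<eta> = exp (2 * L * E * \<eta> * T) * (exp (a * \<tau>) * W + (M2 / 8 + remainder_const B * \<eta>) * exp_integral \<tau>)" for \<eta>
  have "\<forall>\<^sub>F \<eta> in at_right 0. \<Theta> \<eta> < B"
  proof (rule order_tendstoD(2))
    show "(\<Theta> \<longlongrightarrow> \<Theta> 0) (at_right 0)"
      unfolding \<Theta>_def by (intro tendsto_intros)
    show "\<Theta> 0 < B" using key by (simp add: \<Theta>_def)
  qed
  moreover have "\<forall>\<^sub>F \<eta> in at_right 0. B * \<eta>\<^sup>2 < close_radius"
  proof (rule order_tendstoD(2))
    show "((\<lambda>\<eta>. B * \<eta>\<^sup>2) \<longlongrightarrow> B * 0\<^sup>2) (at_right 0)" by (intro tendsto_intros)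
    show "B * 0\<^sup>2 < close_radius" using close_radius_pos by simp
  qed
  ultimately have "\<forall>\<^sub>F \<eta> in at_right 0. \<Theta> \<eta> < B \<and> B * \<eta>\<^sup>2 < close_radius"
    by (rule eventually_conj)
  then obtain b where b: "0 < b" "\<And>\<eta>. 0 < \<eta> \<Longrightarrow> \<eta> < b \<Longrightarrow> \<Theta> \<eta> < B \<and> B * \<eta>\<^sup>2 < close_radius"
    unfolding eventually_at_right_field by auto
  define \<delta> where "\<delta> = min b close_radius"
  have "0 < \<delta>" using b(1) close_radius_pos by (simp add: \<delta>_def)
  define f where "f = \<phi> \<tau>"
  have f_cont: "continuous_on \<Omega> f" unfolding f_def by (rule flow_cont_space[OF \<tau>])
  have f_inj: "inj_on f \<Omega>" unfolding f_def by (rule flow_inj[OF \<tau>])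
  have "z \<in> f ` \<Omega>" if pq: "p \<in> \<Omega>" "q \<in> \<Omega>" "dist p q < \<delta>"
    and z: "z \<in> cball (midpoint (f p) (f q)) (W * (dist (f p) (f q))\<^sup>2)" for p q z
  proof (cases "p = q")
    case True
    then show ?thesis using z pq by simp
  next
    case False
    define \<eta> where "\<eta> = dist p q"
    have \<eta>: "0 < \<eta>" "\<eta> < close_radius" "\<Theta> \<eta> < B" "B * \<eta>\<^sup>2 < close_radius"
      using False pq(3) b(2)[of \<eta>] by (auto simp: \<eta>_def \<delta>_def)
    define m0 where "m0 = midpoint p q"
    have m0: "m0 \<in> \<Omega>"
      using closed_segment_subset[OF pq(1,2) convex_\<Omega>] by (auto simp: m0_def)
    define r0 where "r0 = B * \<eta>\<^sup>2"
    have "0 < r0" using \<open>0 < B\<close> \<eta> by (simp add: r0_def)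
    have cb: "cball m0 r0 \<subseteq> \<Omega>" using balls[OF pq(1,2)] by (simp add: m0_def r0_def \<eta>_def)
    then have ob: "ball m0 r0 \<subseteq> \<Omega>" using ball_subset_cball by blast
    define w where "w = z - midpoint (f p) (f q)"
    have w: "norm w \<le> W * (dist (f p) (f q))\<^sup>2"
      using z by (simp add: w_def dist_norm norm_minus_commute)
    \<comment> \<open>The path of the moving point; it ends at \<open>z\<close>.\<close>
    define P where "P \<sigma> = f m0 + \<sigma> *\<^sub>R (midpoint (f p) (f q) + w - f m0)" for \<sigma> :: real
    have P_cont: "continuous_on {0..1} P" unfolding P_def by (intro continuous_intros)
    have strict: "\<xi> \<in> ball m0 r0" if \<sigma>: "\<sigma> \<in> {0..1}" and \<xi>: "\<xi> \<in> cball m0 r0" "f \<xi> = P \<sigma>" for \<sigma> \<xi>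
    proof -
      have "dist \<xi> m0 \<le> \<Theta> \<eta> * \<eta>\<^sup>2"
        unfolding \<Theta>_def m0_def \<eta>_def
      proof (rule distortion_estimate[OF pq(1,2) _ False \<tau>, where \<sigma> = \<sigma> and w = w])
        show "\<xi> \<in> \<Omega>" using \<xi> cb by blast
        show "dist \<xi> (midpoint p q) \<le> B * (dist p q)\<^sup>2"
          using \<xi>(1) by (simp add: m0_def r0_def \<eta>_def dist_commute)
        show "\<phi> \<tau> \<xi> - \<phi> \<tau> (midpoint p q) = \<sigma> *\<^sub>R (midpoint (\<phi> \<tau> p) (\<phi> \<tau> q) + w - \<phi> \<tau> (midpoint p q))"
          using \<xi>(2) by (simp add: P_def f_def m0_def)
      qed (use \<eta> \<sigma> w \<open>0 < B\<close> in \<open>auto simp: \<eta>_def f_def\<close>)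
      also have "\<dots> < B * \<eta>\<^sup>2" using \<eta> by (intro mult_strict_right_mono) auto
      finally show ?thesis by (simp add: r0_def dist_commute)
    qed
    define S where "S = {0..1} \<inter> P -` (f ` ball m0 r0)"
    have "open (f ` ball m0 r0)"
      by (intro invariance_of_domain continuous_on_subset[OF f_cont ob] inj_on_subset[OF f_inj ob]) auto
    then have "openin (top_of_set {0..1}) S"
      unfolding S_def by (rule continuous_openin_preimage_gen[OF P_cont])
    moreover have "closedin (top_of_set {0..1}) S"
    proof -
      have "compact (f ` cball m0 r0)"
        by (intro compact_continuous_image continuous_on_subset[OF f_cont cb]) auto
      then have "closedin (top_of_set {0..1}) ({0..1} \<inter> P -` (f ` cball m0 r0))"
        using continuous_closedin_preimage[OF P_cont] compact_imp_closed by blast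
      also have "{0..1} \<inter> P -` (f ` cball m0 r0) = S"
        unfolding S_def using strict ball_subset_cball by fastforce
      finally show ?thesis .
    qed
    moreover have "connected {0..1::real}" by simp
    ultimately have "S = {} \<or> S = {0..1}"
      unfolding connected_clopen by blast
    moreover have "0 \<in> S"
      using \<open>0 < r0\<close> by (auto simp: S_def P_def)
    ultimately have "1 \<in> S" by auto
    moreover have "P 1 = z" by (simp add: P_def w_def)
    ultimately show ?thesis using ob by (auto simp: S_def)
  qed
  then show ?thesis
    using \<open>0 < \<delta>\<close> unfolding f_def by blast
qed

text \<open>Short chords of the image come from short chords of \<open>\<Omega>\<close>, because the inverse of the continuous
injection \<open>\<phi> \<tau>\<close> is uniformly continuous on the compact image.\<close>

lemma midpoint_balls_flow_image:
  assumes \<tau>: "\<tau> \<in> {0..T}" and "0 < B" "0 < R"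
    and key: "exp (a * \<tau>) / (8 * R) + M2 / 8 * exp_integral \<tau> < B"
    and balls: "\<And>p q. p \<in> \<Omega> \<Longrightarrow> q \<in> \<Omega> \<Longrightarrow> cball (midpoint p q) (B * (dist p q)\<^sup>2) \<subseteq> \<Omega>"
  shows "\<exists>d>0. midpoint_balls d R (\<phi> \<tau> ` \<Omega>)"
proof -
  have "exp (a * \<tau>) * (1 / (8 * R)) + M2 / 8 * exp_integral \<tau> < B" using key by simp
  from flow_image_contains_midpoint_balls[OF \<tau> \<open>0 < B\<close> this balls]
  obtain \<delta> where \<delta>: "0 < \<delta>" "\<And>p q. p \<in> \<Omega> \<Longrightarrow> q \<in> \<Omega> \<Longrightarrow> dist p q < \<delta> \<Longrightarrow>
    cball (midpoint (\<phi> \<tau> p) (\<phi> \<tau> q)) (1 / (8 * R) * (dist (\<phi> \<tau> p) (\<phi> \<tau> q))\<^sup>2) \<subseteq> \<phi> \<tau> ` \<Omega>"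
    by blast
  define g where "g = the_inv_into \<Omega> (\<phi> \<tau>)"
  have g: "g (\<phi> \<tau> p) = p" if "p \<in> \<Omega>" for p
    unfolding g_def using that by (rule the_inv_into_f_f[OF flow_inj[OF \<tau>]])
  have "continuous_on (\<phi> \<tau> ` \<Omega>) g"
    using g by (intro continuous_on_inv[OF flow_cont_space[OF \<tau>] compact_\<Omega>]) auto
  moreover have "compact (\<phi> \<tau> ` \<Omega>)"
    by (rule compact_continuous_image[OF flow_cont_space[OF \<tau>] compact_\<Omega>])
  ultimately have "uniformly_continuous_on (\<phi> \<tau> ` \<Omega>) g"
    by (rule compact_uniformly_continuous)
  then obtain d where d: "0 < d" "\<And>x y. x \<in> \<phi> \<tau> ` \<Omega> \<Longrightarrow> y \<in> \<phi> \<tau> ` \<Omega> \<Longrightarrow> dist y x < d \<Longrightarrow> dist (g y) (g x) < \<delta>"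
    using \<delta>(1) unfolding uniformly_continuous_on_def by metis
  have "midpoint_balls d R (\<phi> \<tau> ` \<Omega>)"
    unfolding midpoint_balls_def
  proof (intro ballI impI)
    fix x y assume xy: "x \<in> \<phi> \<tau> ` \<Omega>" "y \<in> \<phi> \<tau> ` \<Omega>" "dist x y < d"
    then obtain p q where pq: "p \<in> \<Omega>" "q \<in> \<Omega>" "x = \<phi> \<tau> p" "y = \<phi> \<tau> q" by blast
    have "dist p q < \<delta>" using d(2)[OF xy(2,1)] xy(3) pq g by simp
    from \<delta>(2)[OF pq(1,2) this] show "cball (midpoint x y) ((dist x y)\<^sup>2 / (8 * R)) \<subseteq> \<phi> \<tau> ` \<Omega>"
      by (simp add: pq)
  qed
  then show ?thesis using d(1) by blast
qed

lemma flow_expand_local: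
  assumes pq: "p \<in> \<Omega>" "q \<in> \<Omega>" "dist p q < close_radius" and \<tau>: "\<tau> \<in> {0..T}"
    and lp: "\<And>\<rho>. \<rho> \<in> {0..T} \<Longrightarrow> up (\<phi> \<rho> p) \<le> lp"
  shows "dist (\<phi> \<tau> p) (\<phi> \<tau> q) \<le> exp ((lp + L * E * dist p q) * \<tau>) * dist p q"
proof -
  define b where "b = lp + L * E * dist p q"
  define d where "d s = \<phi> s p - \<phi> s q" for s
  define d' where "d' s = F (\<phi> s p) - F (\<phi> s q)" for s
  define Z where "Z s = exp (2 * (- b * s)) * (d s \<bullet> d s)" for s
  define Z' where "Z' s = exp (2 * (- b * s)) * (2 * (d s \<bullet> d' s) - 2 * b * (d s \<bullet> d s))" for s
  have sqrt_Z: "sqrt (Z s) = exp (- b * s) * norm (d s)" for s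
  proof -
    have "Z s = (exp (- b * s) * norm (d s))\<^sup>2"
      by (simp add: Z_def power_mult_distrib power2_norm_eq_inner flip: exp_double)
    then show ?thesis by (simp add: real_sqrt_unique)
  qed
  have "- 1 * (sqrt (Z 0) - sqrt (Z \<tau>)) \<le> 0 - 0"
  proof (rule sqrt_difference_le_if_derivative_bound[where a = 0 and b = \<tau> and Z = Z and Z' = Z' and \<kappa> = "\<lambda>_. 0" and \<kappa>' = "\<lambda>_. 0"])
    show "0 \<le> \<tau>" using \<tau> by simp
    fix s assume s: "s \<in> {0..\<tau>}"
    then have s': "s \<in> {0..T}" using \<tau> by auto
    have d_deriv: "(d has_vector_derivative d' s) (at s within {0..\<tau>})"
      unfolding d_def d'_def using s \<tau> by (intro flow_diff_ode pq) auto
    show "(Z has_real_derivative Z' s) (at s within {0..\<tau>})"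
      unfolding Z_def
      by (rule derivative_eq_intros has_real_derivative_inner_self[OF d_deriv] refl)+
         (simp add: Z'_def algebra_simps)
    show "0 \<le> Z s" by (simp add: Z_def)
    have "d s \<bullet> d' s \<le> (up (\<phi> s p) + L * E * dist p q) * (dist (\<phi> s p) (\<phi> s q))\<^sup>2"
      unfolding d_def d'_def using pq by (intro separation_growth s') auto
    also have "\<dots> \<le> b * (dist (\<phi> s p) (\<phi> s q))\<^sup>2"
      using lp[OF s'] by (intro mult_right_mono) (auto simp: b_def)
    also have "\<dots> = b * (d s \<bullet> d s)"
      by (simp add: d_def dist_norm power2_norm_eq_inner)
    finally show "- 2 * 0 * sqrt (Z s) \<le> - 1 * Z' s"
      by (simp add: Z'_def mult_nonneg_nonpos)
  qed auto
  then have "exp (- b * \<tau>) * norm (d \<tau>) \<le> norm (d 0)" by (simp add: sqrt_Z)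
  then have "exp (b * \<tau>) * (exp (- b * \<tau>) * norm (d \<tau>)) \<le> exp (b * \<tau>) * norm (d 0)"
    by (intro mult_left_mono) auto
  moreover have "exp (b * \<tau>) * (exp (- b * \<tau>) * norm (d \<tau>)) = norm (d \<tau>)"
    by (simp add: exp_minus)
  ultimately have "norm (d \<tau>) \<le> exp (b * \<tau>) * norm (d 0)" by linarith
  then show ?thesis
    using flow_0 pq by (simp add: d_def b_def dist_norm)
qed

text \<open>Locally the expansion factor is \<open>exp (lp * \<tau>)\<close> up to an error that vanishes with the distance;
integrating along a segment in \<open>\<Omega>\<close> removes the error.\<close>

lemma flow_expand_global:
  assumes pq: "p \<in> \<Omega>" "q \<in> \<Omega>" and \<tau>: "\<tau> \<in> {0..T}"
    and lp: "\<And>p \<rho>. p \<in> \<Omega> \<Longrightarrow> \<rho> \<in> {0..T} \<Longrightarrow> up (\<phi> \<rho> p) \<le> lp"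
  shows "dist (\<phi> \<tau> p) (\<phi> \<tau> q) \<le> exp (lp * \<tau>) * dist p q"
proof -
  define h where "h = dist p q"
  define \<gamma> where "\<gamma> \<theta> = p + \<theta> *\<^sub>R (q - p)" for \<theta> :: real
  have \<gamma>_mem: "\<gamma> \<theta> \<in> \<Omega>" if "0 \<le> \<theta>" "\<theta> \<le> 1" for \<theta>
    using convexD_alt[OF convex_\<Omega> pq, of \<theta>] that by (simp add: \<gamma>_def algebra_simps)
  have \<gamma>_dist: "dist (\<gamma> y) (\<gamma> x) = h * (y - x)" if "x \<le> y" for x y
  proof -
    have "\<gamma> y - \<gamma> x = (y - x) *\<^sub>R (q - p)" by (simp add: \<gamma>_def algebra_simps)
    then show ?thesis using that by (simp add: dist_norm h_def norm_minus_commute)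
  qed
  have "norm (\<phi> \<tau> (\<gamma> 1) - \<phi> \<tau> (\<gamma> 0)) \<le> exp (lp * \<tau>) * h * 1 - exp (lp * \<tau>) * h * 0"
  proof (rule norm_increment_le_if_right_slopes[where f = "\<lambda>\<theta>. \<phi> \<tau> (\<gamma> \<theta>)" and \<beta>' = "\<lambda>_. exp (lp * \<tau>) * h"])
    show "continuous_on {0..1} (\<lambda>\<theta>. \<phi> \<tau> (\<gamma> \<theta>))"
      by (rule continuous_on_compose2[OF flow_cont_space[OF \<tau>]])
         (auto simp: \<gamma>_def[abs_def] intro!: continuous_intros \<gamma>_mem[unfolded \<gamma>_def])
    show "((\<lambda>\<theta>. exp (lp * \<tau>) * h * \<theta>) has_real_derivative exp (lp * \<tau>) * h) (at x)" for x
      by (auto intro!: derivative_eq_intros)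
    fix x e :: real assume x: "0 \<le> x" "x < 1" "0 < e"
    have "\<forall>\<^sub>F y in at_right x. exp ((lp + L * E * (h * (y - x))) * \<tau>) * h < exp (lp * \<tau>) * h + e"
    proof (rule order_tendstoD(2))
      show "((\<lambda>y. exp ((lp + L * E * (h * (y - x))) * \<tau>) * h) \<longlongrightarrow> exp ((lp + L * E * (h * (x - x))) * \<tau>) * h) (at_right x)"
        by (intro tendsto_intros)
    qed (use x in simp)
    moreover have "\<forall>\<^sub>F y in at_right x. h * (y - x) < close_radius"
    proof (rule order_tendstoD(2))
      show "((\<lambda>y. h * (y - x)) \<longlongrightarrow> h * (x - x)) (at_right x)" by (intro tendsto_intros)
    qed (use close_radius_pos in simp)
    ultimately show "\<forall>\<^sub>F y in at_right x. norm (\<phi> \<tau> (\<gamma> y) - \<phi> \<tau> (\<gamma> x)) \<le> (exp (lp * \<tau>) * h + e) * (y - x)"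
      using eventually_at_right_real[OF x(2)]
    proof eventually_elim
      case (elim y)
      have dy: "dist (\<gamma> y) (\<gamma> x) = h * (y - x)" using elim by (intro \<gamma>_dist) auto
      have "dist (\<phi> \<tau> (\<gamma> y)) (\<phi> \<tau> (\<gamma> x)) \<le> exp ((lp + L * E * dist (\<gamma> y) (\<gamma> x)) * \<tau>) * dist (\<gamma> y) (\<gamma> x)"
        using elim x dy by (intro flow_expand_local \<tau> lp \<gamma>_mem) auto
      also have "\<dots> = exp ((lp + L * E * (h * (y - x))) * \<tau>) * h * (y - x)"
        by (simp add: dy)
      also have "\<dots> \<le> (exp (lp * \<tau>) * h + e) * (y - x)"
        using elim by (intro mult_right_mono) auto
      finally show ?case by (simp add: dist_norm)
    qed
  qed simp
  then show ?thesis by (simp add: \<gamma>_def h_def dist_norm norm_minus_commute)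
qed

end

section \<open>Extreme eigenvalues of the symmetric part\<close>

lemma inner_symmetric_matrix:
  fixes S :: "real^'n^'n"
  assumes "transpose S = S"
  shows "x \<bullet> (S *v y) = y \<bullet> (S *v x)"
  by (metis assms dot_lmul_matrix inner_commute transpose_matrix_vector)

text \<open>If the residual \<open>r = l *\<^sub>R v - S *v v\<close> of a maximizer of the quadratic form on the unit sphere were
nonzero, a small step from \<open>v\<close> along \<open>- r\<close> would make the nonnegative form \<open>Q\<close> negative.\<close>

lemma eigenvalue_of_maximizer:
  fixes S :: "real^'n^'n"
  assumes sym: "transpose S = S"
    and v: "norm v = 1" and max: "\<And>w. norm w = 1 \<Longrightarrow> w \<bullet> (S *v w) \<le> v \<bullet> (S *v v)"
  shows "S *v v = (v \<bullet> (S *v v)) *\<^sub>R v"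
proof -
  define l where "l = v \<bullet> (S *v v)"
  define Q where "Q w = l * (w \<bullet> w) - w \<bullet> (S *v w)" for w
  note S_sym = inner_symmetric_matrix[OF sym]
  have Q_nonneg: "0 \<le> Q w" for w
  proof (cases "w = 0")
    case False
    have "sgn w \<bullet> (S *v sgn w) \<le> l"
      unfolding l_def using False by (intro max) (simp add: norm_sgn)
    moreover have "sgn w \<bullet> (S *v sgn w) = (w \<bullet> (S *v w)) / (norm w)\<^sup>2"
      by (simp add: sgn_div_norm matrix_vector_mult_scaleR power2_eq_square field_simps)
    ultimately show ?thesis
      using False by (simp add: Q_def divide_le_eq power2_norm_eq_inner)
  qed (simp add: Q_def)
  define r where "r = l *\<^sub>R v - S *v v"
  have vr: "v \<bullet> r = 0"
    using v by (simp add: r_def inner_diff_right l_def[symmetric]) (simp add: norm_eq_sqrt_inner)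
  have "Q v = 0" using v by (simp add: Q_def l_def norm_eq_sqrt_inner)
  have expand: "Q (v - c *\<^sub>R r) = - 2 * c * (r \<bullet> r) + c\<^sup>2 * Q r" for c
  proof -
    have "Q (v - c *\<^sub>R r) = Q v - 2 * c * (r \<bullet> (l *\<^sub>R v - S *v v)) + c\<^sup>2 * Q r"
      using S_sym[of v r]
      by (simp add: Q_def inner_diff_left inner_diff_right matrix_vector_mult_diff_distrib
          matrix_vector_mult_scaleR inner_commute[of v r] power2_eq_square algebra_simps)
    then show ?thesis using \<open>Q v = 0\<close> by (simp add: r_def[symmetric])
  qed
  have "r \<bullet> r = 0"
  proof (rule ccontr)
    assume "r \<bullet> r \<noteq> 0"
    then have pos: "0 < r \<bullet> r" by simp
    define c where "c = (r \<bullet> r) / (Q r + 1)"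
    have Q1: "0 < Q r + 1" using Q_nonneg[of r] by simp
    have "0 < c" using pos Q1 by (simp add: c_def)
    have "c * Q r \<le> c * (Q r + 1)" using \<open>0 < c\<close> by simp
    also have "\<dots> = r \<bullet> r" using Q1 by (simp add: c_def)
    finally have "c * (c * Q r) \<le> c * (r \<bullet> r)" using \<open>0 < c\<close> by simp
    then have "Q (v - c *\<^sub>R r) \<le> - c * (r \<bullet> r)"
      by (simp add: expand power2_eq_square algebra_simps)
    then show False using Q_nonneg[of "v - c *\<^sub>R r"] mult_pos_pos[OF \<open>0 < c\<close> pos] by simp
  qed
  then show ?thesis by (simp add: r_def l_def)
qed

text \<open>Eigenvectors for different eigenvalues are orthogonal. Finiteness gives \<open>Max\<close> and \<open>Min\<close> of the
spectrum their intended meaning.\<close>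

lemma finite_eigenvalues_symmetric:
  fixes S :: "real^'n^'n"
  assumes sym: "transpose S = S"
  shows "finite (eigenvalues S)"
proof -
  note S_sym = inner_symmetric_matrix[OF sym]
  have "\<forall>l\<in>eigenvalues S. \<exists>v. v \<noteq> 0 \<and> S *v v = l *\<^sub>R v"
    by (auto simp: eigenvalues_def)
  then obtain f where f: "\<And>l. l \<in> eigenvalues S \<Longrightarrow> f l \<noteq> 0 \<and> S *v f l = l *\<^sub>R f l"
    by metis
  have inj: "inj_on f (eigenvalues S)"
    by (rule inj_onI) (metis f scaleR_cancel_right)
  have "pairwise orthogonal (f ` eigenvalues S)"
  proof (clarsimp simp: pairwise_def)
    fix l k assume lk: "l \<in> eigenvalues S" "k \<in> eigenvalues S" "f l \<noteq> f k"
    have "k * (f l \<bullet> f k) = l * (f l \<bullet> f k)"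
      using S_sym[of "f l" "f k"] f lk by (simp add: inner_commute)
    then show "orthogonal (f l) (f k)"
      using lk by (auto simp: orthogonal_def)
  qed
  moreover have "0 \<notin> f ` eigenvalues S" using f by auto
  ultimately have "independent (f ` eigenvalues S)"
    by (rule pairwise_orthogonal_independent)
  then show ?thesis
    using finite_imageD[OF _ inj] independent_imp_finite by blast
qed

lemma exists_top_eigenvector:
  fixes S :: "real^'n^'n"
  assumes sym: "transpose S = S"
  obtains v where "norm v = 1" "S *v v = (v \<bullet> (S *v v)) *\<^sub>R v"
    "\<And>w. w \<bullet> (S *v w) \<le> (v \<bullet> (S *v v)) * (w \<bullet> w)"
proof -
  have "continuous_on (sphere 0 1) (\<lambda>w. w \<bullet> (S *v w))"
    by (intro continuous_intros matrix_vector_mult_linear_continuous_on)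
  moreover have "sphere (0::real^'n) 1 \<noteq> {}" by (simp add: sphere_eq_empty)
  ultimately obtain v where v: "norm v = 1" "\<And>w. norm w = 1 \<Longrightarrow> w \<bullet> (S *v w) \<le> v \<bullet> (S *v v)"
    using continuous_attains_sup[of "sphere (0::real^'n) 1" "\<lambda>w. w \<bullet> (S *v w)"] by auto
  have "w \<bullet> (S *v w) \<le> (v \<bullet> (S *v v)) * (w \<bullet> w)" for w
  proof (cases "w = 0")
    case False
    have "sgn w \<bullet> (S *v sgn w) \<le> v \<bullet> (S *v v)"
      using v(2)[of "sgn w"] False by (simp add: norm_sgn)
    moreover have "sgn w \<bullet> (S *v sgn w) = (w \<bullet> (S *v w)) / (norm w)\<^sup>2"
      by (simp add: sgn_div_norm matrix_vector_mult_scaleR power2_eq_square field_simps)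
    ultimately show ?thesis
      using False by (simp add: divide_le_eq power2_norm_eq_inner)
  qed simp
  then show thesis using that v(1) eigenvalue_of_maximizer[OF sym v] by blast
qed

lemma symmetric_quadratic_form_le_Max:
  fixes S :: "real^'n^'n"
  assumes sym: "transpose S = S"
  shows "w \<bullet> (S *v w) \<le> Max (eigenvalues S) * (w \<bullet> w)"
proof -
  obtain v where v: "norm v = 1" "S *v v = (v \<bullet> (S *v v)) *\<^sub>R v"
    "\<And>w. w \<bullet> (S *v w) \<le> (v \<bullet> (S *v v)) * (w \<bullet> w)"
    using exists_top_eigenvector[OF sym] by blast
  have "v \<noteq> 0" using v(1) by auto
  then have "v \<bullet> (S *v v) \<in> eigenvalues S"
    using v(2) unfolding eigenvalues_def by blast
  then have "v \<bullet> (S *v v) \<le> Max (eigenvalues S)"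
    by (rule Max_ge[OF finite_eigenvalues_symmetric[OF sym]])
  then have "(v \<bullet> (S *v v)) * (w \<bullet> w) \<le> Max (eigenvalues S) * (w \<bullet> w)"
    by (rule mult_right_mono) simp
  then show ?thesis using v(3)[of w] by linarith
qed

lemma symmetric_quadratic_form_ge_Min:
  fixes S :: "real^'n^'n"
  assumes sym: "transpose S = S"
  shows "Min (eigenvalues S) * (w \<bullet> w) \<le> w \<bullet> (S *v w)"
proof -
  have neg: "(- S) *v w = - (S *v w)" for w
    by (simp add: vec_eq_iff matrix_vector_mult_def sum_negf)
  have "transpose (- S) = - S" using sym by (simp add: transpose_def vec_eq_iff)
  then obtain v where v: "norm v = 1" "(- S) *v v = (v \<bullet> ((- S) *v v)) *\<^sub>R v"
    "\<And>w. w \<bullet> ((- S) *v w) \<le> (v \<bullet> ((- S) *v v)) * (w \<bullet> w)"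
    using exists_top_eigenvector by blast
  have "v \<noteq> 0" "S *v v = (v \<bullet> (S *v v)) *\<^sub>R v" using v(1,2) by (auto simp: neg)
  then have "v \<bullet> (S *v v) \<in> eigenvalues S"
    unfolding eigenvalues_def by blast
  then have "Min (eigenvalues S) \<le> v \<bullet> (S *v v)"
    by (rule Min_le[OF finite_eigenvalues_symmetric[OF sym]])
  then have "Min (eigenvalues S) * (w \<bullet> w) \<le> (v \<bullet> (S *v v)) * (w \<bullet> w)"
    by (rule mult_right_mono) simp
  then show ?thesis using v(3)[of w] by (simp add: neg)
qed

lemma transpose_symmetric_part: "transpose (symmetric_part A) = symmetric_part A"
  by (simp add: symmetric_part_def transpose_def vec_eq_iff)

lemma inner_symmetric_part:
  fixes A :: "real^'n^'n"
  shows "v \<bullet> (symmetric_part A *v v) = v \<bullet> (A *v v)"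
proof -
  have "v \<bullet> (transpose A *v v) = v \<bullet> (A *v v)"
    by (metis dot_lmul_matrix inner_commute transpose_matrix_vector)
  then show ?thesis
    by (simp add: symmetric_part_def scaleR_matrix_vector_assoc[symmetric] matrix_vector_mult_add_rdistrib inner_add_right)
qed

lemma mu_plus_upper:
  fixes A :: "(real^'n) \<Rightarrow>\<^sub>L (real^'n)"
  shows "v \<bullet> A v \<le> mu_plus (matrix A) * (v \<bullet> v)"
proof -
  have "v \<bullet> (matrix A *v v) = v \<bullet> A v"
    by (simp add: matrix_works bounded_linear.linear[OF blinfun.bounded_linear_right])
  then show ?thesis
    using symmetric_quadratic_form_le_Max[OF transpose_symmetric_part, of v "matrix A"]
    by (simp add: mu_plus_def inner_symmetric_part)
qed

lemma mu_minus_lower: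
  fixes A :: "(real^'n) \<Rightarrow>\<^sub>L (real^'n)"
  shows "mu_minus (matrix A) * (v \<bullet> v) \<le> v \<bullet> A v"
proof -
  have "v \<bullet> (matrix A *v v) = v \<bullet> A v"
    by (simp add: matrix_works bounded_linear.linear[OF blinfun.bounded_linear_right])
  then show ?thesis
    using symmetric_quadratic_form_ge_Min[OF transpose_symmetric_part, of "matrix A" v]
    by (simp add: mu_minus_def inner_symmetric_part)
qed

section \<open>Strongly convex sets and their midpoint balls\<close>

lemma r_convexD:
  assumes "r_convex s \<Omega>" "x \<in> \<Omega>" "y \<in> \<Omega>"
    and "\<And>c. dist c x \<le> s \<Longrightarrow> dist c y \<le> s \<Longrightarrow> dist c z \<le> s"
  shows "z \<in> \<Omega>"
  using assms unfolding r_convex_def by fastforce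

lemma r_convex_imp_convex:
  assumes "r_convex s \<Omega>"
  shows "convex \<Omega>"
  unfolding convex_contains_segment
proof (intro ballI subsetI)
  fix x y z assume xy: "x \<in> \<Omega>" "y \<in> \<Omega>" "z \<in> closed_segment x y"
  show "z \<in> \<Omega>"
  proof (rule r_convexD[OF assms xy(1,2)])
    fix c assume "dist c x \<le> s" "dist c y \<le> s"
    then have "closed_segment x y \<subseteq> cball c s" by (intro closed_segment_subset) auto
    then show "dist c z \<le> s" using xy by auto
  qed
qed

text \<open>If two points were farther apart, no ball of radius \<open>s\<close> would contain both and their lens would be
the whole space.\<close>

lemma r_convex_dist_le:
  assumes "r_convex s \<Omega>" "\<Omega> \<noteq> UNIV" "x \<in> \<Omega>" "y \<in> \<Omega>"
  shows "dist x y \<le> 2 * s"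
proof (rule ccontr)
  assume far: "\<not> dist x y \<le> 2 * s"
  have "z \<in> \<Omega>" for z
  proof (rule r_convexD[OF assms(1,3,4)])
    fix c assume "dist c x \<le> s" "dist c y \<le> s"
    then show "dist c z \<le> s" using far dist_triangle3[of x y c] by linarith
  qed
  then show False using assms(2) by blast
qed

text \<open>If a ball of radius \<open>s\<close> around \<open>c\<close> contains \<open>x\<close> and \<open>y\<close>, then by the parallelogram law the midpoint is
within \<open>sqrt (s\<^sup>2 - u)\<close> of \<open>c\<close>, where \<open>u = (dist x y)\<^sup>2 / 4\<close>, and this is at most \<open>s - u / (2 * s)\<close>.\<close>

lemma r_convex_midpoint_cball:
  assumes "r_convex s \<Omega>" "x \<in> \<Omega>" "y \<in> \<Omega>"
  shows "cball (midpoint x y) (1 / (8 * s) * (dist x y)\<^sup>2) \<subseteq> \<Omega>"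
proof
  fix z assume z: "z \<in> cball (midpoint x y) (1 / (8 * s) * (dist x y)\<^sup>2)"
  have "0 < s" using assms(1) by (simp add: r_convex_def)
  define u where "u = (dist x y)\<^sup>2 / 4"
  show "z \<in> \<Omega>"
  proof (rule r_convexD[OF assms])
    fix c assume c: "dist c x \<le> s" "dist c y \<le> s"
    define v w where "v = midpoint x y - c" and "w = (1 / 2) *\<^sub>R (x - y)"
    have "x - c = v + w" "y - c = v - w"
      by (simp_all add: v_def w_def midpoint_def algebra_simps flip: scaleR_add_left)
    then have "(dist c x)\<^sup>2 + (dist c y)\<^sup>2 = 2 * (norm v)\<^sup>2 + 2 * (norm w)\<^sup>2"
      by (simp add: dist_norm norm_minus_commute[of c] power2_norm_eq_inner inner_add_left inner_add_right
          inner_diff_left inner_diff_right inner_commute)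
    moreover have "(norm w)\<^sup>2 = u" by (simp add: w_def u_def dist_norm power_divide)
    moreover have "(dist c x)\<^sup>2 \<le> s\<^sup>2" "(dist c y)\<^sup>2 \<le> s\<^sup>2" using c by (auto intro: power_mono)
    ultimately have vu: "(norm v)\<^sup>2 + u \<le> s\<^sup>2" by linarith
    then have "u \<le> s\<^sup>2" using zero_le_power2[of "norm v"] by linarith
    moreover have "s * (2 * s) = 2 * s\<^sup>2" by (simp add: power2_eq_square)
    ultimately have "u \<le> s * (2 * s)" using zero_le_power2[of s] by linarith
    then have pos: "0 \<le> s - u / (2 * s)"
      using \<open>0 < s\<close> by (simp add: divide_le_eq)
    have "(s - u / (2 * s))\<^sup>2 = s\<^sup>2 - u + (u / (2 * s))\<^sup>2"
      using \<open>0 < s\<close> by (simp add: power2_diff)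
    then have "(norm v)\<^sup>2 \<le> (s - u / (2 * s))\<^sup>2" using vu zero_le_power2[of "u / (2 * s)"] by linarith
    then have "norm v \<le> s - u / (2 * s)" using pos by (rule power2_le_imp_le)
    moreover have "dist (midpoint x y) z \<le> u / (2 * s)" using z by (simp add: u_def)
    moreover have "dist c (midpoint x y) = norm v" by (simp add: v_def dist_norm norm_minus_commute)
    ultimately show "dist c z \<le> s" using dist_triangle[of c z "midpoint x y"] by linarith
  qed
qed

lemma r_convex_imp_compact:
  assumes "r_convex s \<Omega>" "\<Omega> \<noteq> UNIV" "closed \<Omega>"
  shows "compact \<Omega>"
proof -
  have "bounded \<Omega>"
  proof (cases "\<Omega> = {}")
    case False
    then obtain x where "x \<in> \<Omega>" by blast
    then show ?thesis
      unfolding bounded_def using r_convex_dist_le[OF assms(1,2)] by blast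
  qed simp
  then show ?thesis using assms(3) by (simp add: compact_eq_bounded_closed)
qed

section \<open>Tubes around trajectories\<close>

locale C11_flow =
  fixes X :: "(real^'n) set" and F :: "real^'n \<Rightarrow> real^'n"
    and F' :: "real^'n \<Rightarrow> (real^'n) \<Rightarrow>\<^sub>L (real^'n)" and \<phi> :: "real \<Rightarrow> real^'n \<Rightarrow> real^'n"
  assumes open_X: "open X" and C11: "C11_on X F F'" and flow: "is_flow X F \<phi>"
begin

lemma flow_zero: "p \<in> X \<Longrightarrow> \<phi> 0 p = p"
  and flow_in_X: "p \<in> X \<Longrightarrow> 0 \<le> \<rho> \<Longrightarrow> \<phi> \<rho> p \<in> X"
  and flow_derivative: "p \<in> X \<Longrightarrow> 0 \<le> \<rho> \<Longrightarrow> ((\<lambda>\<rho>. \<phi> \<rho> p) has_vector_derivative F (\<phi> \<rho> p)) (at \<rho> within {0..})"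
  using flow by (auto simp: is_flow_def global_solution_def)

lemma flow_derivative_Icc:
  assumes "p \<in> X" "\<rho> \<in> {0..T}"
  shows "((\<lambda>\<rho>. \<phi> \<rho> p) has_vector_derivative F (\<phi> \<rho> p)) (at \<rho> within {0..T})"
  using assms by (intro has_vector_derivative_within_subset[OF flow_derivative]) auto

lemma flow_continuous_time: "p \<in> X \<Longrightarrow> continuous_on {0..T} (\<lambda>\<rho>. \<phi> \<rho> p)"
  using has_vector_derivative_continuous[OF flow_derivative_Icc] continuous_on_eq_continuous_within by blast

lemma tube_around_compact:
  assumes "compact C" "C \<subseteq> X"
  shows "\<exists>A L \<epsilon>. 0 \<le> A \<and> 0 \<le> L \<and> 0 < \<epsilon> \<and> (\<forall>c\<in>C. cball c \<epsilon> \<subseteq> X) \<and>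
    (\<forall>c\<in>C. \<forall>a\<in>cball c \<epsilon>. norm (F' a) \<le> A) \<and>
    (\<forall>c\<in>C. \<forall>a\<in>cball c \<epsilon>. \<forall>b\<in>cball c \<epsilon>. norm (F' a - F' b) \<le> L * dist a b)"
proof -
  obtain \<epsilon> where \<epsilon>: "0 < \<epsilon>" "(\<Union>c\<in>C. cball c \<epsilon>) \<subseteq> X"
    using compact_subset_open_imp_cball_epsilon_subset[OF assms(1) open_X assms(2)] by metis
  have sub: "cball c \<epsilon> \<subseteq> X" if "c \<in> C" for c using \<epsilon>(2) that by blast
  obtain L where L: "L-lipschitz_on X F'" using C11 by (auto simp: C11_on_def)
  have L_bound: "norm (F' a - F' b) \<le> L * dist a b" if "a \<in> X" "b \<in> X" for a b
    using lipschitz_onD[OF L that] by (simp add: dist_norm)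
  have "compact (F' ` C)"
    using C11 assms by (intro compact_continuous_image) (auto simp: C11_on_def intro: continuous_on_subset)
  then obtain A0 where A0: "0 < A0" "\<And>c. c \<in> C \<Longrightarrow> norm (F' c) \<le> A0"
    using compact_imp_bounded bounded_pos by (metis image_eqI)
  show ?thesis
  proof (rule exI[of _ "A0 + L * \<epsilon>"], rule exI[of _ L], rule exI[of _ \<epsilon>], intro conjI ballI)
    show "0 \<le> L" by (rule lipschitz_on_nonneg[OF L])
    then show "0 \<le> A0 + L * \<epsilon>" using A0 \<epsilon> by simp
    fix c a assume ca: "c \<in> C" "a \<in> cball c \<epsilon>"
    have "norm (F' a - F' c) \<le> L * dist a c"
      using ca(1) sub[OF ca(1)] ca(2) assms(2) by (intro L_bound) blast+
    also have "\<dots> \<le> L * \<epsilon>" using ca \<open>0 \<le> L\<close> by (intro mult_left_mono) (auto simp: dist_commute)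
    finally show "norm (F' a) \<le> A0 + L * \<epsilon>"
      using A0(2)[OF ca(1)] norm_triangle_sub[of "F' a" "F' c"] by linarith
  next
    show "0 < \<epsilon>" by (rule \<epsilon>(1))
  next
    fix c assume c: "c \<in> C"
    show "cball c \<epsilon> \<subseteq> X" by (rule sub[OF c])
    fix a b assume "a \<in> cball c \<epsilon>" "b \<in> cball c \<epsilon>"
    then show "norm (F' a - F' b) \<le> L * dist a b" using sub[OF c] by (intro L_bound) blast+
  qed
qed

text \<open>A trajectory that starts close to that of \<open>p\<close> satisfies the Gronwall bound as long as it stays within
\<open>\<epsilon>\<close>, and the bound itself prevents it from reaching distance \<open>\<epsilon>\<close>.\<close>

lemma flow_locally_lipschitz:
  assumes p: "p \<in> X" and "0 \<le> T"
  obtains \<eta> K where "0 < \<eta>" "0 \<le> K"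
    "\<And>q \<rho>. q \<in> X \<Longrightarrow> dist p q < \<eta> \<Longrightarrow> \<rho> \<in> {0..T} \<Longrightarrow> dist (\<phi> \<rho> p) (\<phi> \<rho> q) \<le> K * dist p q"
proof -
  define C where "C = (\<lambda>\<rho>. \<phi> \<rho> p) ` {0..T}"
  have "compact C" unfolding C_def
    by (intro compact_continuous_image flow_continuous_time p) auto
  have "C \<subseteq> X" using flow_in_X[OF p] by (auto simp: C_def)
  obtain A L \<epsilon> where "0 \<le> A" "0 \<le> L" "0 < \<epsilon>" "\<forall>c\<in>C. cball c \<epsilon> \<subseteq> X"
    "\<forall>c\<in>C. \<forall>a\<in>cball c \<epsilon>. norm (F' a) \<le> A"
    "\<forall>c\<in>C. \<forall>a\<in>cball c \<epsilon>. \<forall>b\<in>cball c \<epsilon>. norm (F' a - F' b) \<le> L * dist a b"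
    using tube_around_compact[OF \<open>compact C\<close> \<open>C \<subseteq> X\<close>] by (elim exE conjE)
  note tube = this[rule_format]
  have F_lip: "norm (F a - F c) \<le> A * norm (a - c)" if "c \<in> C" "a \<in> cball c \<epsilon>" for a c
  proof (rule differentiable_bound[of "cball c \<epsilon>" F "\<lambda>x. F' x"])
    show "(F has_derivative F' x) (at x within cball c \<epsilon>)" if "x \<in> cball c \<epsilon>" for x
    proof -
      have "x \<in> X" using tube(4)[OF \<open>c \<in> C\<close>] that by blast
      then have "(F has_derivative F' x) (at x)" using C11 by (simp add: C11_on_def)
      then show ?thesis by (rule has_derivative_at_withinI)
    qed
    show "onorm (F' x) \<le> A" if "x \<in> cball c \<epsilon>" for x
      using tube(5)[OF \<open>c \<in> C\<close> that] by (simp add: norm_blinfun.rep_eq)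
  qed (use that tube(3) in auto)
  show thesis
  proof (rule that[of "\<epsilon> / exp (A * T)" "exp (A * T)"])
    show "0 < \<epsilon> / exp (A * T)" using tube(3) by simp
    show "0 \<le> exp (A * T)" by simp
    fix q \<rho> assume q: "q \<in> X" "dist p q < \<epsilon> / exp (A * T)" and \<rho>: "\<rho> \<in> {0..T}"
    have small: "exp (A * T) * dist p q < \<epsilon>" using q(2) by (simp add: field_simps)
    define d where "d \<rho> = dist (\<phi> \<rho> p) (\<phi> \<rho> q)" for \<rho>
    have d_cont: "continuous_on {0..T} d"
      unfolding d_def by (intro continuous_intros flow_continuous_time p q)
    have gron: "d \<beta> \<le> exp (A * T) * dist p q" if \<beta>: "\<beta> \<in> {0..T}" "\<And>x. x \<in> {0..\<beta>} \<Longrightarrow> d x \<le> \<epsilon>" for \<beta>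
    proof -
      have "norm (\<phi> \<beta> q - \<phi> \<beta> p) \<le> exp (A * (\<beta> - 0)) * (norm (\<phi> 0 q - \<phi> 0 p) + 0 * (\<beta> - 0))"
      proof (rule gronwall_norm(1)[where e' = "\<lambda>x. F (\<phi> x q) - F (\<phi> x p)"])
        fix x assume x: "x \<in> {0..\<beta>}"
        show "((\<lambda>\<rho>. \<phi> \<rho> q - \<phi> \<rho> p) has_vector_derivative F (\<phi> x q) - F (\<phi> x p)) (at x within {0..\<beta>})"
          by (intro has_vector_derivative_diff flow_derivative_Icc p q x)
        show "norm (F (\<phi> x q) - F (\<phi> x p)) \<le> A * norm (\<phi> x q - \<phi> x p) + 0"
          using F_lip[of "\<phi> x p" "\<phi> x q"] \<beta>(2)[OF x] x \<beta>(1) by (auto simp: C_def d_def)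
      qed (use \<beta> tube in auto)
      also have "\<dots> \<le> exp (A * T) * dist p q"
        using \<beta> tube(1) flow_zero p q(1)
        by (auto simp: dist_norm norm_minus_commute intro!: mult_right_mono mult_left_mono)
      finally show ?thesis by (simp add: d_def dist_norm norm_minus_commute)
    qed
    have "d x < \<epsilon>" if "x \<in> {0..T}" for x
    proof (rule ccontr)
      assume "\<not> d x < \<epsilon>"
      define S where "S = {x \<in> {0..T}. \<epsilon> \<le> d x}"
      have "closed S"
        unfolding S_def by (intro continuous_on_closed_Collect_le continuous_intros d_cont)
      then have "compact S"
        unfolding compact_eq_bounded_closed S_def
        by (auto intro: bounded_subset[OF bounded_closed_interval[of 0 T]])
      moreover have "x \<in> S" using that \<open>\<not> d x < \<epsilon>\<close> by (simp add: S_def)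
      ultimately obtain c where c: "c \<in> S" "\<And>x. x \<in> S \<Longrightarrow> c \<le> x"
        using compact_attains_inf[of S] by blast
      then have c': "c \<in> {0..T}" "\<epsilon> \<le> d c" by (auto simp: S_def)
      have "dist p q \<le> exp (A * T) * dist p q"
        using tube(1) \<open>0 \<le> T\<close> by (simp add: mult_left_mono mult_le_cancel_right1)
      then have d0: "d 0 < \<epsilon>" using small flow_zero p q(1) by (simp add: d_def)
      have "\<exists>z\<ge>0. z \<le> c \<and> d z = \<epsilon>"
        using c' d0 by (intro IVT' continuous_on_subset[OF d_cont]) auto
      then obtain z where z: "0 \<le> z" "z \<le> c" "d z = \<epsilon>" by blast
      then have "z \<in> S" using c' by (simp add: S_def)
      then have "d c = \<epsilon>" using c(2)[of z] z by simp
      have "d x \<le> \<epsilon>" if "x \<in> {0..c}" for x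
      proof (cases "x = c")
        case True
        then show ?thesis using \<open>d c = \<epsilon>\<close> by simp
      next
        case False
        then have "x \<notin> S" using that c(2)[of x] by auto
        then show ?thesis using that c' by (auto simp: S_def)
      qed
      from gron[OF c'(1) this] show False using small \<open>d c = \<epsilon>\<close> by simp
    qed
    then have "d x \<le> \<epsilon>" if "x \<in> {0..\<rho>}" for x
      using that \<rho> by (simp add: less_imp_le)
    from gron[OF \<rho> this] show "dist (\<phi> \<rho> p) (\<phi> \<rho> q) \<le> exp (A * T) * dist p q" by (simp add: d_def)
  qed
qed

lemma flow_jointly_continuous:
  assumes "0 \<le> T"
  shows "continuous_on ({0..T} \<times> X) (\<lambda>(\<rho>, p). \<phi> \<rho> p)"
  unfolding continuous_on_iff
proof (clarify)
  fix \<rho> p and e :: real assume \<rho>: "\<rho> \<in> {0..T}" and p: "p \<in> X" and "0 < e"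
  obtain \<eta> K where \<eta>: "0 < \<eta>" "0 \<le> K"
    "\<And>q \<rho>. q \<in> X \<Longrightarrow> dist p q < \<eta> \<Longrightarrow> \<rho> \<in> {0..T} \<Longrightarrow> dist (\<phi> \<rho> p) (\<phi> \<rho> q) \<le> K * dist p q"
    using flow_locally_lipschitz[OF p assms] by blast
  obtain \<delta>1 where \<delta>1: "0 < \<delta>1" "\<And>\<rho>'. \<rho>' \<in> {0..T} \<Longrightarrow> dist \<rho>' \<rho> < \<delta>1 \<Longrightarrow> dist (\<phi> \<rho>' p) (\<phi> \<rho> p) < e / 2"
    using flow_continuous_time[OF p, of T] \<rho> \<open>0 < e\<close> unfolding continuous_on_iff
    by (metis half_gt_zero)
  define \<delta> where "\<delta> = min \<delta>1 (min \<eta> (e / (2 * (K + 1))))"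
  have \<delta>: "0 < \<delta>" "\<delta> \<le> \<delta>1" "\<delta> \<le> \<eta>" "\<delta> \<le> e / (2 * (K + 1))"
    using \<delta>1 \<eta> \<open>0 < e\<close> by (auto simp: \<delta>_def)
  show "\<exists>d>0. \<forall>x'\<in>{0..T} \<times> X. dist x' (\<rho>, p) < d \<longrightarrow>
      dist (case x' of (\<rho>, p) \<Rightarrow> \<phi> \<rho> p) (\<phi> \<rho> p) < e"
  proof (intro exI[of _ \<delta>] conjI \<delta> ballI impI)
    fix z assume z: "z \<in> {0..T} \<times> X" "dist z (\<rho>, p) < \<delta>"
    obtain \<rho>' q where zq: "z = (\<rho>', q)" "\<rho>' \<in> {0..T}" "q \<in> X" using z(1) by auto
    have dz: "dist \<rho>' \<rho> < \<delta>" "dist p q < \<delta>"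
      using dist_fst_le[of z "(\<rho>, p)"] dist_snd_le[of z "(\<rho>, p)"] z(2) zq by (auto simp: dist_commute)
    have "dist (\<phi> \<rho>' p) (\<phi> \<rho>' q) \<le> K * dist p q" using \<eta>(3) zq dz \<delta> by simp
    also have "\<dots> \<le> (K + 1) * dist p q" by (intro mult_right_mono) auto
    also have "\<dots> \<le> (K + 1) * (e / (2 * (K + 1)))" using dz \<delta>(4) \<eta>(2) by (intro mult_left_mono) auto
    also have "\<dots> = e / 2" using \<eta>(2) by (simp add: field_simps)
    finally have 1: "dist (\<phi> \<rho>' p) (\<phi> \<rho>' q) \<le> e / 2" .
    have 2: "dist (\<phi> \<rho>' p) (\<phi> \<rho> p) < e / 2" using \<delta>1(2) zq dz \<delta> by simp
    show "dist (case z of (\<rho>, p) \<Rightarrow> \<phi> \<rho> p) (\<phi> \<rho> p) < e"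
      using 1 2 dist_triangle[of "\<phi> \<rho>' q" "\<phi> \<rho> p" "\<phi> \<rho>' p"] by (simp add: zq dist_commute)
  qed
qed

lemma exists_flow_tube:
  assumes "compact \<Omega>" "convex \<Omega>" "\<Omega> \<subseteq> X" "0 \<le> T"
  obtains A L \<epsilon> where "flow_tube F F' \<phi> \<Omega> T A L \<epsilon>"
proof -
  have cont: "continuous_on ({0..T} \<times> \<Omega>) (\<lambda>(\<rho>, p). \<phi> \<rho> p)"
    by (rule continuous_on_subset[OF flow_jointly_continuous[OF assms(4)]]) (use assms(3) in auto)
  define C where "C = (\<lambda>(\<rho>, p). \<phi> \<rho> p) ` ({0..T} \<times> \<Omega>)"
  have "compact C"
    unfolding C_def by (intro compact_continuous_image cont compact_Times assms) auto
  have "C \<subseteq> X" using flow_in_X assms(3) by (auto simp: C_def)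
  obtain A L \<epsilon> where "0 \<le> A" "0 \<le> L" "0 < \<epsilon>" "\<forall>c\<in>C. cball c \<epsilon> \<subseteq> X"
    "\<forall>c\<in>C. \<forall>a\<in>cball c \<epsilon>. norm (F' a) \<le> A"
    "\<forall>c\<in>C. \<forall>a\<in>cball c \<epsilon>. \<forall>b\<in>cball c \<epsilon>. norm (F' a - F' b) \<le> L * dist a b"
    using tube_around_compact[OF \<open>compact C\<close> \<open>C \<subseteq> X\<close>] by (elim exE conjE)
  note tube = this[rule_format]
  have mem: "\<phi> \<rho> p \<in> C" if "p \<in> \<Omega>" "\<rho> \<in> {0..T}" for \<rho> p using that by (auto simp: C_def)
  have deriv: "(F has_derivative F' a) (at a)" if "a \<in> X" for a
    using C11 that by (auto simp: C11_on_def)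
  have "flow_tube F F' \<phi> \<Omega> T A L \<epsilon>"
  proof
    show "\<phi> 0 p = p" if "p \<in> \<Omega>" for p using that assms(3) flow_zero by blast
    show "((\<lambda>\<rho>. \<phi> \<rho> p) has_vector_derivative F (\<phi> \<rho> p)) (at \<rho> within {0..T})" if "p \<in> \<Omega>" "\<rho> \<in> {0..T}" for p \<rho>
      using that assms(3) flow_derivative_Icc by blast
    show "(F has_derivative F' a) (at a)" if "p \<in> \<Omega>" "\<rho> \<in> {0..T}" "a \<in> cball (\<phi> \<rho> p) \<epsilon>" for p \<rho> a
      using tube(4)[OF mem[OF that(1,2)]] that(3) by (intro deriv) blast
    show "norm (F' a) \<le> A" if "p \<in> \<Omega>" "\<rho> \<in> {0..T}" "a \<in> cball (\<phi> \<rho> p) \<epsilon>" for p \<rho> a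
      by (rule tube(5)[OF mem[OF that(1,2)] that(3)])
    show "norm (F' a - F' b) \<le> L * dist a b"
      if "p \<in> \<Omega>" "\<rho> \<in> {0..T}" "a \<in> cball (\<phi> \<rho> p) \<epsilon>" "b \<in> cball (\<phi> \<rho> p) \<epsilon>" for p \<rho> a b
      by (rule tube(6)[OF mem[OF that(1,2)] that(3,4)])
  qed (use assms cont tube in auto)
  then show thesis by (rule that)
qed

end

section \<open>Attainable sets are strongly convex\<close>

lemma pointwise_lipschitz_if_Limsup_le:
  fixes F' :: "'a::{real_normed_vector, perfect_space} \<Rightarrow> 'b::real_normed_vector"
  assumes lim: "Limsup (at 0) (\<lambda>h. ereal (norm (F' (x + h) - F' x) / norm h)) \<le> ereal M"
  shows "0 \<le> M"
    and "0 < e \<Longrightarrow> \<forall>\<^sub>F b in nhds x. norm (F' b - F' x) \<le> (M + e) * dist b x"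
proof -
  have "ereal 0 \<le> Limsup (at 0) (\<lambda>h. ereal (norm (F' (x + h) - F' x) / norm h))"
    by (rule le_Limsup) auto
  then have "ereal 0 \<le> ereal M" using lim by (rule order_trans)
  then show "0 \<le> M" by simp
  assume "0 < e"
  then have "Limsup (at 0) (\<lambda>h. ereal (norm (F' (x + h) - F' x) / norm h)) < ereal (M + e)"
    using lim by (rule_tac le_less_trans) auto
  then have "\<forall>\<^sub>F h in at 0. ereal (norm (F' (x + h) - F' x) / norm h) < ereal (M + e)"
    by (rule Limsup_lessD)
  then obtain d where d: "0 < d" "\<And>h. h \<noteq> 0 \<Longrightarrow> dist h 0 < d \<Longrightarrow> norm (F' (x + h) - F' x) / norm h < M + e"
    unfolding eventually_at by auto
  have "norm (F' b - F' x) \<le> (M + e) * dist b x" if "dist b x < d" for b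
  proof (cases "b = x")
    case False
    then show ?thesis
      using d(2)[of "b - x"] that by (simp add: dist_norm divide_less_eq)
  qed simp
  then show "\<forall>\<^sub>F b in nhds x. norm (F' b - F' x) \<le> (M + e) * dist b x"
    using d(1) unfolding eventually_nhds_metric by blast
qed

theorem theorem4p2:
  fixes X \<Omega> :: "(real^'n) set"
    and F :: "real^'n \<Rightarrow> real^'n"
    and F' :: "real^'n \<Rightarrow> (real^'n) \<Rightarrow>\<^sub>L (real^'n)"
    and \<phi> :: "real \<Rightarrow> real^'n \<Rightarrow> real^'n"
    and s t M1 M2 lm lp :: real
  assumes "open X"
    and "C11_on X F F'"
    and "\<forall>x0\<in>X. \<exists>u. global_solution X F u x0"
    and "is_flow X F \<phi>"
    and "s > 0" and "t > 0"
    and "\<Omega> \<subseteq> X" and "r_convex s \<Omega>" and "closed \<Omega>" and "\<Omega> \<noteq> UNIV"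
    and "\<forall>\<rho>\<in>{0..t}. \<forall>x\<in>\<phi> \<rho> ` \<Omega>.
           M1 \<ge> 2 * mu_plus (matrix (F' x)) - mu_minus (matrix (F' x)) \<and>
           ereal M2 \<ge> Limsup (at 0) (\<lambda>h. ereal (norm (F' (x + h) - F' x) / norm h)) \<and>
           lm \<le> mu_minus (matrix (F' x)) \<and>
           mu_minus (matrix (F' x)) \<le> mu_plus (matrix (F' x)) \<and>
           mu_plus (matrix (F' x)) \<le> lp"
    and "s * M2 * integral {0..t} (\<lambda>\<rho>. exp (M1 * \<rho>)) < 1"
  shows "\<forall>\<tau>\<in>{0..t}. 0 \<le> 2 * lp - lm \<or> \<tau> = t \<longrightarrow>
           r_convex
             (s * exp ((2 * lp - lm) * t) / (1 - s * M2 * integral {0..t} (\<lambda>\<rho>. exp (M1 * \<rho>))))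
             (\<phi> \<tau> ` \<Omega>)"
proof (intro ballI impI)
  fix \<tau> assume \<tau>: "\<tau> \<in> {0..t}" and sign: "0 \<le> 2 * lp - lm \<or> \<tau> = t"
  define I where "I = integral {0..t} (\<lambda>\<rho>. exp (M1 * \<rho>))"
  define b where "b = 2 * lp - lm"
  define r where "r = s * exp (b * t) / (1 - s * M2 * I)"
  have den: "0 < 1 - s * M2 * I" using assms(12) by (simp add: I_def)
  have "0 < s" "0 < t" by fact+
  have "0 < r" using den \<open>0 < s\<close> by (simp add: r_def)
  have "r_convex r (\<phi> \<tau> ` \<Omega>)"
  proof (cases "\<Omega> = {}")
    case True
    then show ?thesis using \<open>0 < r\<close> by (simp add: r_convex_def)
  next
    case False
    then obtain p0 where p0: "p0 \<in> \<Omega>" by blast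
    interpret C11_flow X F F' \<phi> using assms(1,2,4) by unfold_locales
    have "compact \<Omega>" using r_convex_imp_compact assms(8-10) by blast
    moreover have "convex \<Omega>" using r_convex_imp_convex[OF assms(8)] .
    ultimately obtain A L \<epsilon> where tube: "flow_tube F F' \<phi> \<Omega> t A L \<epsilon>"
      using exists_flow_tube[of \<Omega> t] assms(7) \<open>0 < t\<close> by auto
    define up lo where "up x = mu_plus (matrix (F' x))" and "lo x = mu_minus (matrix (F' x))" for x
    have bounds: "M1 \<ge> 2 * up (\<phi> \<rho> p) - lo (\<phi> \<rho> p)"
      "Limsup (at 0) (\<lambda>h. ereal (norm (F' (\<phi> \<rho> p + h) - F' (\<phi> \<rho> p)) / norm h)) \<le> ereal M2"
      "lm \<le> lo (\<phi> \<rho> p)" "lo (\<phi> \<rho> p) \<le> up (\<phi> \<rho> p)" "up (\<phi> \<rho> p) \<le> lp"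
      if "p \<in> \<Omega>" "\<rho> \<in> {0..t}" for p \<rho>
      using assms(11) that unfolding up_def lo_def by blast+
    have "0 \<le> M2" using pointwise_lipschitz_if_Limsup_le(1)[OF bounds(2)[OF p0, of 0]] \<open>0 < t\<close> by simp
    have "lm \<le> lp" using bounds(3-5)[OF p0, of 0] \<open>0 < t\<close> by simp
    \<comment> \<open>Both \<open>M1\<close> and \<open>2 * lp - lm\<close> bound \<open>2 * mu_plus - mu_minus\<close> on the tube. With their minimum, one exponential rate serves both the integral, where \<open>M1\<close> is prescribed, and the factor \<open>exp ((2 * lp - lm) * t)\<close>.\<close>
    define a where "a = min M1 b"
    interpret flow_tube F F' \<phi> \<Omega> t A L \<epsilon> by (rule tube)
    interpret curved_flow_tube F F' \<phi> \<Omega> t A L \<epsilon> M2 a up lo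
    proof unfold_locales
      show "0 \<le> M2" by fact
      fix p \<rho> assume p: "p \<in> \<Omega>" "\<rho> \<in> {0..t}"
      show "\<forall>\<^sub>F b in nhds (\<phi> \<rho> p). norm (F' b - F' (\<phi> \<rho> p)) \<le> (M2 + e) * dist b (\<phi> \<rho> p)" if "0 < e" for e
        by (rule pointwise_lipschitz_if_Limsup_le(2)[OF bounds(2)[OF p] that])
      show "v \<bullet> F' (\<phi> \<rho> p) v \<le> up (\<phi> \<rho> p) * (v \<bullet> v)" for v
        unfolding up_def by (rule mu_plus_upper)
      show "lo (\<phi> \<rho> p) * (v \<bullet> v) \<le> v \<bullet> F' (\<phi> \<rho> p) v" for v
        unfolding lo_def by (rule mu_minus_lower)
      show "2 * up (\<phi> \<rho> p) - lo (\<phi> \<rho> p) \<le> a"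
        using bounds[OF p] by (simp add: a_def b_def)
    qed
    have b\<tau>: "b * \<tau> \<le> b * t"
      using sign \<tau> by (auto simp: b_def intro: mult_left_mono)
    have "a * \<tau> \<le> b * \<tau>" using \<tau> by (intro mult_right_mono) (auto simp: a_def)
    then have exp_a: "exp (a * \<tau>) \<le> exp (b * t)" using b\<tau> by simp
    have exp_integral_le: "exp_integral \<tau> \<le> I"
    proof -
      have int: "(\<lambda>\<rho>. exp (c * \<rho>)) integrable_on {0..x}" for c x :: real
        by (intro integrable_continuous_interval continuous_intros)
      have "exp_integral \<tau> \<le> integral {0..\<tau>} (\<lambda>\<rho>. exp (M1 * \<rho>))"
        unfolding exp_integral_def by (intro integral_le int) (auto simp: a_def intro!: mult_right_mono)
      also have "\<dots> \<le> I"
        unfolding I_def using \<tau> by (intro integral_subset_le int) auto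
      finally show ?thesis .
    qed
    define K where "K = \<phi> \<tau> ` \<Omega>"
    have "compact K" unfolding K_def
      by (intro compact_continuous_image flow_cont_space \<tau> \<open>compact \<Omega>\<close>)
    then have "closed K" by (rule compact_imp_closed)
    have "connected K" unfolding K_def
      by (intro connected_continuous_image flow_cont_space \<tau> convex_connected \<open>convex \<Omega>\<close>)
    have mb: "\<exists>d>0. midpoint_balls d R K" if "r < R" for R
      unfolding K_def
    proof (rule midpoint_balls_flow_image[OF \<tau>])
      show "0 < 1 / (8 * s)" using \<open>0 < s\<close> by simp
      show "0 < R" using that \<open>0 < r\<close> by simp
      show "cball (midpoint p q) (1 / (8 * s) * (dist p q)\<^sup>2) \<subseteq> \<Omega>" if "p \<in> \<Omega>" "q \<in> \<Omega>" for p q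
        by (rule r_convex_midpoint_cball[OF assms(8) that])
      have "exp (a * \<tau>) / (8 * R) \<le> exp (b * t) / (8 * R)"
        using exp_a \<open>0 < R\<close> by (intro divide_right_mono) auto
      also have "\<dots> < exp (b * t) / (8 * r)"
        using that \<open>0 < r\<close> by (intro divide_strict_left_mono) auto
      \<comment> \<open>This identity is the definition of \<open>r\<close>.\<close>
      also have "\<dots> = 1 / (8 * s) - M2 / 8 * I"
        using den \<open>0 < s\<close> by (simp add: r_def field_simps)
      finally have "exp (a * \<tau>) / (8 * R) < 1 / (8 * s) - M2 / 8 * I" .
      moreover have "M2 / 8 * exp_integral \<tau> \<le> M2 / 8 * I"
        using exp_integral_le \<open>0 \<le> M2\<close> by (intro mult_left_mono) auto
      ultimately show "exp (a * \<tau>) / (8 * R) + M2 / 8 * exp_integral \<tau> < 1 / (8 * s)" by linarith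
    qed
    have diam: "dist x y \<le> 2 * r" if "x \<in> K" "y \<in> K" for x y
    proof -
      obtain p q where pq: "p \<in> \<Omega>" "q \<in> \<Omega>" "x = \<phi> \<tau> p" "y = \<phi> \<tau> q"
        using \<open>x \<in> K\<close> \<open>y \<in> K\<close> unfolding K_def by blast
      have "dist x y \<le> exp (lp * \<tau>) * dist p q"
        unfolding pq(3,4) by (rule flow_expand_global[OF pq(1,2) \<tau> bounds(5)])
      also have "\<dots> \<le> exp (b * t) * (2 * s)"
      proof (rule mult_mono)
        have "lp * \<tau> \<le> b * \<tau>" using \<tau> \<open>lm \<le> lp\<close> by (intro mult_right_mono) (auto simp: b_def)
        then show "exp (lp * \<tau>) \<le> exp (b * t)" using b\<tau> by simp
        show "dist p q \<le> 2 * s" by (rule r_convex_dist_le[OF assms(8,10) pq(1,2)])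
      qed auto
      also have "\<dots> \<le> 2 * r"
      proof -
        have "0 \<le> I" unfolding I_def
          by (intro Henstock_Kurzweil_Integration.integral_nonneg integrable_continuous_interval continuous_intros) auto
        then have "1 - s * M2 * I \<le> 1" using \<open>0 < s\<close> \<open>0 \<le> M2\<close> by simp
        then have "s * exp (b * t) * (1 - s * M2 * I) \<le> s * exp (b * t)"
          using \<open>0 < s\<close> by (simp add: mult_left_le)
        then show ?thesis using den by (simp add: r_def le_divide_eq mult_ac)
      qed
      finally show ?thesis .
    qed
    show ?thesis
      unfolding r_convex_def K_def[symmetric]
      using \<open>0 < r\<close> lens_subset_if_midpoint_balls[OF \<open>closed K\<close> \<open>connected K\<close> \<open>0 < r\<close> mb _ _ diam] by blast
  qed
  then show "r_convex (s * exp ((2 * lp - lm) * t) / (1 - s * M2 * integral {0..t} (\<lambda>\<rho>. exp (M1 * \<rho>)))) (\<phi> \<tau> ` \<Omega>)"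
    by (simp add: r_def b_def I_def)
qed

end
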